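(* Let $\Lambda_{(\phi,\psi)}=\begin{pmatrix} A & N\\ M & B\end{pmatrix}$ be a Morita ring which is an Artin algebra. Then the indecomposable projective $\Lambda_{(\phi,\psi)}$-modules are, up to isomorphism, the objects of the form $$\mathsf T_A(P)=(P,\ M\otimes_AP,\ \mathrm{id}_{M\otimes_AP},\ \Psi_P)\qquad\text{and}\qquad \mathsf T_B(Q)=(N\otimes_BQ,\ Q,\ \Phi_Q,\ \mathrm{id}_{N\otimes_BQ}),$$ where $P$ is an indecomposable projective $A$-module and $Q$ is an indecomposable projective $B$-module.
   Context: $A,B$ are unital associative rings, $N$ is an $A$-$B$-bimodule, $M$ is a $B$-$A$-bimodule, $\phi:M\otimes_AN\to B$ is a $B$-$B$-bimodule homomorphism and $\psi:N\otimes_BM\to A$ is an $A$-$A$-bimodule homomorphism such that $\phi(m\otimes n)m'=m\psi(n\otimes m')$ and $n\phi(m\otimes n')=\psi(n\otimes m)n'$ for all $m,m'\in M$, $n,n'\in N$. The Morita ring $\Lambda_{(\phi,\psi)}$ is the set of matrices $\begin{pmatrix} a & n\\ m & b\end{pmatrix}$ with componentwise addition and multiplication $\begin{pmatrix} a & n\\ m & b\end{pmatrix}\begin{pmatrix} a' & n'\\ m' & b'\end{pmatrix}=\begin{pmatrix} aa'+\psi(n\otimes m') & an'+nb'\\ ma'+bm' & bb'+\phi(m\otimes n')\end{pmatrix}$. Modules are finitely generated left modules. For an $A$-module $X$ and a $B$-module $Y$, $\Psi_X:N\otimes_BM\otimes_AX\to X$ is $n\otimes m\otimes x\mapsto\psi(n\otimes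 m)x$ and $\Phi_Y:M\otimes_AN\otimes_BY\to Y$ is $m\otimes n\otimes y\mapsto\phi(m\otimes n)y$. $\Lambda_{(\phi,\psi)}$-modules are identified with tuples $(X,Y,f,g)$, where $X$ is an $A$-module, $Y$ a $B$-module, $f:M\otimes_AX\to Y$ is $B$-linear, $g:N\otimes_BY\to X$ is $A$-linear, and $g(n\otimes f(m\otimes x))=\psi(n\otimes m)x$, $f(m\otimes g(n\otimes y))=\phi(m\otimes n)y$; the corresponding module is $X\oplus Y$ with $\begin{pmatrix} a & n\\ m & b\end{pmatrix}(x,y)=(ax+g(n\otimes y),by+f(m\otimes x))$. *)

theory Defs
  imports "HOL-Algebra.Module" "HOL-Algebra.Ideal" "HOL-Algebra.Free_Abelian_Groups"
begin

section \<open>Modules over associative unital rings\<close>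

text \<open>
  The locale \<open>module\<close> of HOL-Algebra requires a commutative ring of scalars. We reuse its records
  (whose ring fields \<open>mult\<close> and \<open>one\<close> carry no information here) for left modules over
  arbitrary rings.
\<close>

locale left_module = R?: ring R + M?: abelian_group M
  for R :: "('r, 'k) ring_scheme" (structure) and M :: "('r, 'm, 'l) module_scheme" (structure) +
  assumes lsmult_closed:
      "\<lbrakk>a \<in> carrier R; x \<in> carrier M\<rbrakk> \<Longrightarrow> a \<odot>\<^bsub>M\<^esub> x \<in> carrier M"
    and lsmult_l_distr:
      "\<lbrakk>a \<in> carrier R; b \<in> carrier R; x \<in> carrier M\<rbrakk> \<Longrightarrow>
        (a \<oplus>\<^bsub>R\<^esub> b) \<odot>\<^bsub>M\<^esub> x = a \<odot>\<^bsub>M\<^esub> x \<oplus>\<^bsub>M\<^esub> b \<odot>\<^bsub>M\<^esub> x"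
    and lsmult_r_distr:
      "\<lbrakk>a \<in> carrier R; x \<in> carrier M; y \<in> carrier M\<rbrakk> \<Longrightarrow>
        a \<odot>\<^bsub>M\<^esub> (x \<oplus>\<^bsub>M\<^esub> y) = a \<odot>\<^bsub>M\<^esub> x \<oplus>\<^bsub>M\<^esub> a \<odot>\<^bsub>M\<^esub> y"
    and lsmult_assoc:
      "\<lbrakk>a \<in> carrier R; b \<in> carrier R; x \<in> carrier M\<rbrakk> \<Longrightarrow>
        (a \<otimes>\<^bsub>R\<^esub> b) \<odot>\<^bsub>M\<^esub> x = a \<odot>\<^bsub>M\<^esub> (b \<odot>\<^bsub>M\<^esub> x)"
    and lsmult_one:
      "x \<in> carrier M \<Longrightarrow> \<one>\<^bsub>R\<^esub> \<odot>\<^bsub>M\<^esub> x = x"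

definition left_hom ::
    "('r, 'k) ring_scheme \<Rightarrow> ('r, 'x, 'l1) module_scheme \<Rightarrow> ('r, 'y, 'l2) module_scheme \<Rightarrow> ('x \<Rightarrow> 'y) set"
  where "left_hom R X Y = {f \<in> hom (add_monoid X) (add_monoid Y).
    \<forall>r\<in>carrier R. \<forall>x\<in>carrier X. f (r \<odot>\<^bsub>X\<^esub> x) = r \<odot>\<^bsub>Y\<^esub> f x}"

definition isomorphic_modules ::
    "('r, 'k) ring_scheme \<Rightarrow> ('r, 'x, 'l1) module_scheme \<Rightarrow> ('r, 'y, 'l2) module_scheme \<Rightarrow> bool"
  where "isomorphic_modules R X Y \<longleftrightarrow> (\<exists>f\<in>left_hom R X Y. bij_betw f (carrier X) (carrier Y))"

definition finitely_generated :: "('r, 'k) ring_scheme \<Rightarrow> ('r, 'x, 'l) module_scheme \<Rightarrow> bool"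
  where "finitely_generated R X \<longleftrightarrow> (\<exists>S. finite S \<and> S \<subseteq> carrier X \<and>
    (\<forall>x\<in>carrier X. \<exists>c\<in>S \<rightarrow> carrier R. x = (\<Oplus>\<^bsub>X\<^esub>s\<in>S. c s \<odot>\<^bsub>X\<^esub> s)))"

definition fg_module :: "('r, 'k) ring_scheme \<Rightarrow> ('r, 'x, 'l) module_scheme \<Rightarrow> bool"
  where "fg_module R X \<longleftrightarrow> left_module R X \<and> finitely_generated R X"

definition left_submodule ::
    "('r, 'k) ring_scheme \<Rightarrow> ('r, 'x, 'l) module_scheme \<Rightarrow> 'x set \<Rightarrow> bool"
  where "left_submodule R X U \<longleftrightarrow> additive_subgroup U X \<and>
    (\<forall>r\<in>carrier R. \<forall>u\<in>U. r \<odot>\<^bsub>X\<^esub> u \<in> U)"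

definition indecomposable :: "('r, 'k) ring_scheme \<Rightarrow> ('r, 'x, 'l) module_scheme \<Rightarrow> bool"
  where "indecomposable R X \<longleftrightarrow> carrier X \<noteq> {\<zero>\<^bsub>X\<^esub>} \<and>
    (\<forall>U V. left_submodule R X U \<and> left_submodule R X V \<and>
       U <+>\<^bsub>X\<^esub> V = carrier X \<and> U \<inter> V = {\<zero>\<^bsub>X\<^esub>} \<longrightarrow> U = {\<zero>\<^bsub>X\<^esub>} \<or> V = {\<zero>\<^bsub>X\<^esub>})"

text \<open>
  Lifting along epimorphisms in the category of finitely generated modules. The test modules \<open>U\<close>,
  \<open>V\<close> live on the type \<open>(nat \<Rightarrow> 'r) set\<close>. This loses no generality: a module with \<open>n\<close> generators
  is isomorphic to a quotient of \<open>R\<^sup>n\<close>, whose elements are cosets, that is, sets of functions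
  \<open>nat \<Rightarrow> 'r\<close> supported on \<open>{..<n}\<close>.
\<close>

definition projective :: "('r, 'k) ring_scheme \<Rightarrow> ('r, 'x, 'l) module_scheme \<Rightarrow> bool"
  where "projective R P \<longleftrightarrow>
    (\<forall>(U :: ('r, (nat \<Rightarrow> 'r) set) module) (V :: ('r, (nat \<Rightarrow> 'r) set) module) p h.
       fg_module R U \<and> fg_module R V \<and>
       p \<in> left_hom R U V \<and> p ` carrier U = carrier V \<and> h \<in> left_hom R P V \<longrightarrow>
       (\<exists>k\<in>left_hom R P U. \<forall>x\<in>carrier P. p (k x) = h x))"

definition indecomposable_projective :: "('r, 'k) ring_scheme \<Rightarrow> ('r, 'x, 'l) module_scheme \<Rightarrow> bool"
  where "indecomposable_projective R P \<longleftrightarrow>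
    fg_module R P \<and> indecomposable R P \<and> projective R P"


section \<open>Artin algebras\<close>

definition artinian_cring :: "('r, 'k) ring_scheme \<Rightarrow> bool"
  where "artinian_cring R \<longleftrightarrow> cring R \<and>
    (\<forall>I :: nat \<Rightarrow> 'r set. (\<forall>n. ideal (I n) R \<and> I (Suc n) \<subseteq> I n) \<longrightarrow> (\<exists>n. \<forall>k\<ge>n. I k = I n))"

text \<open>\<open>L\<close> is an Artin algebra over the commutative artinian ring \<open>R\<close>, with structure map \<open>\<iota>\<close>.\<close>

definition artin_algebra :: "('r, 'k) ring_scheme \<Rightarrow> ('r \<Rightarrow> 'a) \<Rightarrow> 'a ring \<Rightarrow> bool"
  where "artin_algebra R \<iota> L \<longleftrightarrow> artinian_cring R \<and> ring L \<and> \<iota> \<in> ring_hom R L \<and>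
    (\<forall>r\<in>carrier R. \<forall>x\<in>carrier L. \<iota> r \<otimes>\<^bsub>L\<^esub> x = x \<otimes>\<^bsub>L\<^esub> \<iota> r) \<and>
    finitely_generated R (ring.extend L (module.fields (\<lambda>r x. \<iota> r \<otimes>\<^bsub>L\<^esub> x)))"


section \<open>Bimodules\<close>

record ('r, 's, 'm) bimodule = "('r, 'm) module" +
  rsmult :: "'m \<Rightarrow> 's \<Rightarrow> 'm" (infixl \<open>\<lhd>\<index>\<close> 70)

locale right_module = S?: ring S + M?: abelian_group M
  for S :: "('s, 'k) ring_scheme" (structure) and M :: "('r, 's, 'm, 'l) bimodule_scheme" (structure) +
  assumes rsmult_closed:
      "\<lbrakk>x \<in> carrier M; a \<in> carrier S\<rbrakk> \<Longrightarrow> x \<lhd>\<^bsub>M\<^esub> a \<in> carrier M"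
    and rsmult_l_distr:
      "\<lbrakk>x \<in> carrier M; y \<in> carrier M; a \<in> carrier S\<rbrakk> \<Longrightarrow>
        (x \<oplus>\<^bsub>M\<^esub> y) \<lhd>\<^bsub>M\<^esub> a = x \<lhd>\<^bsub>M\<^esub> a \<oplus>\<^bsub>M\<^esub> y \<lhd>\<^bsub>M\<^esub> a"
    and rsmult_r_distr:
      "\<lbrakk>x \<in> carrier M; a \<in> carrier S; b \<in> carrier S\<rbrakk> \<Longrightarrow>
        x \<lhd>\<^bsub>M\<^esub> (a \<oplus>\<^bsub>S\<^esub> b) = x \<lhd>\<^bsub>M\<^esub> a \<oplus>\<^bsub>M\<^esub> x \<lhd>\<^bsub>M\<^esub> b"
    and rsmult_assoc:
      "\<lbrakk>x \<in> carrier M; a \<in> carrier S; b \<in> carrier S\<rbrakk> \<Longrightarrow>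
        x \<lhd>\<^bsub>M\<^esub> (a \<otimes>\<^bsub>S\<^esub> b) = (x \<lhd>\<^bsub>M\<^esub> a) \<lhd>\<^bsub>M\<^esub> b"
    and rsmult_one:
      "x \<in> carrier M \<Longrightarrow> x \<lhd>\<^bsub>M\<^esub> \<one>\<^bsub>S\<^esub> = x"

locale bimodule =
  fixes R :: "('r, 'k1) ring_scheme" and S :: "('s, 'k2) ring_scheme"
    and M :: "('r, 's, 'm, 'l) bimodule_scheme"
  assumes left: "left_module R M"
    and right: "right_module S M"
    and assoc: "\<lbrakk>r \<in> carrier R; x \<in> carrier M; s \<in> carrier S\<rbrakk> \<Longrightarrow>
      (r \<odot>\<^bsub>M\<^esub> x) \<lhd>\<^bsub>M\<^esub> s = r \<odot>\<^bsub>M\<^esub> (x \<lhd>\<^bsub>M\<^esub> s)"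

definition bimodule_hom ::
    "('r, 'k1) ring_scheme \<Rightarrow> ('s, 'k2) ring_scheme \<Rightarrow> ('r, 's, 'x, 'l1) bimodule_scheme \<Rightarrow>
     ('r, 's, 'y, 'l2) bimodule_scheme \<Rightarrow> ('x \<Rightarrow> 'y) set"
  where "bimodule_hom R S X Y = {f \<in> left_hom R X Y.
    \<forall>x\<in>carrier X. \<forall>s\<in>carrier S. f (x \<lhd>\<^bsub>X\<^esub> s) = f x \<lhd>\<^bsub>Y\<^esub> s}"

definition regular_bimodule :: "'a ring \<Rightarrow> ('a, 'a, 'a) bimodule"
  where "regular_bimodule R =
    \<lparr>carrier = carrier R, mult = (\<otimes>\<^bsub>R\<^esub>), one = \<one>\<^bsub>R\<^esub>, ring.zero = \<zero>\<^bsub>R\<^esub>, ring.add = (\<oplus>\<^bsub>R\<^esub>),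
     smult = (\<otimes>\<^bsub>R\<^esub>), rsmult = (\<otimes>\<^bsub>R\<^esub>)\<rparr>"


section \<open>Tensor products over a noncommutative ring\<close>

text \<open>
  In this section \<open>M\<close> is used as a right \<open>A\<close>-module and \<open>X\<close> is a left \<open>A\<close>-module. Their tensor
  product is the free abelian group on \<open>M \<times> X\<close> modulo the subgroup generated by the usual
  relations; \<open>frag_of (m, x)\<close> is the basis element belonging to \<open>(m, x)\<close>.
\<close>

type_synonym ('m, 'x) tensor = "('m \<times> 'x \<Rightarrow>\<^sub>0 int) set"

definition tensor_relations ::
    "'a ring \<Rightarrow> ('b, 'a, 'm, 'l1) bimodule_scheme \<Rightarrow> ('a, 'x, 'l2) module_scheme \<Rightarrow> ('m, 'x) tensor"
  where "tensor_relations A M X =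
    {frag_of (m \<oplus>\<^bsub>M\<^esub> m', x) - frag_of (m, x) - frag_of (m', x) |m m' x.
       m \<in> carrier M \<and> m' \<in> carrier M \<and> x \<in> carrier X} \<union>
    {frag_of (m, x \<oplus>\<^bsub>X\<^esub> x') - frag_of (m, x) - frag_of (m, x') |m x x'.
       m \<in> carrier M \<and> x \<in> carrier X \<and> x' \<in> carrier X} \<union>
    {frag_of (m \<lhd>\<^bsub>M\<^esub> a, x) - frag_of (m, a \<odot>\<^bsub>X\<^esub> x) |m a x.
       m \<in> carrier M \<and> a \<in> carrier A \<and> x \<in> carrier X}"

definition tensor_free ::
    "('b, 'a, 'm, 'l1) bimodule_scheme \<Rightarrow> ('a, 'x, 'l2) module_scheme \<Rightarrow> ('m \<times> 'x \<Rightarrow>\<^sub>0 int) monoid"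
  where "tensor_free M X = free_Abelian_group (carrier M \<times> carrier X)"

definition tensor_kernel ::
    "'a ring \<Rightarrow> ('b, 'a, 'm, 'l1) bimodule_scheme \<Rightarrow> ('a, 'x, 'l2) module_scheme \<Rightarrow> ('m, 'x) tensor"
  where "tensor_kernel A M X = generate (tensor_free M X) (tensor_relations A M X)"

definition tensor_elem ::
    "'a ring \<Rightarrow> ('b, 'a, 'm, 'l1) bimodule_scheme \<Rightarrow> ('a, 'x, 'l2) module_scheme \<Rightarrow>
     'm \<Rightarrow> 'x \<Rightarrow> ('m, 'x) tensor"
  where "tensor_elem A M X m x = tensor_kernel A M X #>\<^bsub>tensor_free M X\<^esub> frag_of (m, x)"

text \<open>The underlying additive group; its multiplicative fields are dummies.\<close>

definition tensor_group ::
    "'a ring \<Rightarrow> ('b, 'a, 'm, 'l1) bimodule_scheme \<Rightarrow> ('a, 'x, 'l2) module_scheme \<Rightarrow> ('m, 'x) tensor ring"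
  where "tensor_group A M X = (let G = tensor_free M X Mod tensor_kernel A M X in
    \<lparr>carrier = carrier G, mult = undefined, one = undefined, ring.zero = \<one>\<^bsub>G\<^esub>, ring.add = (\<otimes>\<^bsub>G\<^esub>)\<rparr>)"

text \<open>
  The additive map out of a tensor product, into the additive group of \<open>Y\<close>, that sends
  \<open>m \<otimes> x\<close> to \<open>\<beta> m x\<close>, where \<open>\<beta>\<close> is a balanced biadditive map: a tensor is a coset \<open>T\<close> of formal
  sums \<open>c\<close>, and the sum below is the same for all representatives \<open>c \<in> T\<close>.
\<close>

definition tensor_lift :: "('y, 'l) ring_scheme \<Rightarrow> ('m \<Rightarrow> 'x \<Rightarrow> 'y) \<Rightarrow> ('m, 'x) tensor \<Rightarrow> 'y"
  where "tensor_lift Y \<beta> T = the_elem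
    ((\<lambda>c. \<Oplus>\<^bsub>Y\<^esub>p\<in>Poly_Mapping.keys c. [Poly_Mapping.lookup c p] \<cdot>\<^bsub>Y\<^esub> \<beta> (fst p) (snd p)) ` T)"

text \<open>For a \<open>B\<close>-\<open>A\<close>-bimodule \<open>M\<close>, the left \<open>B\<close>-module \<open>M \<otimes>\<^sub>A X\<close> with \<open>b (m \<otimes> x) = b m \<otimes> x\<close>.\<close>

definition tensor ::
    "'a ring \<Rightarrow> ('b, 'a, 'm, 'l1) bimodule_scheme \<Rightarrow> ('a, 'x, 'l2) module_scheme \<Rightarrow>
     ('b, ('m, 'x) tensor) module"
  where "tensor A M X = ring.extend (tensor_group A M X) (module.fields
    (\<lambda>b. tensor_lift (tensor_group A M X) (\<lambda>m x. tensor_elem A M X (b \<odot>\<^bsub>M\<^esub> m) x)))"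

text \<open>
  For an \<open>A\<close>-\<open>C\<close>-bimodule \<open>N\<close>, the same with right \<open>C\<close>-action \<open>(m \<otimes> n) c = m \<otimes> n c\<close>.
\<close>

definition bitensor ::
    "'a ring \<Rightarrow> ('b, 'a, 'm, 'l1) bimodule_scheme \<Rightarrow> ('a, 'c, 'n, 'l2) bimodule_scheme \<Rightarrow>
     ('b, 'c, ('m, 'n) tensor) bimodule"
  where "bitensor A M N = module.extend (tensor A M N) (bimodule.fields
    (\<lambda>t c. tensor_lift (tensor_group A M N) (\<lambda>m n. tensor_elem A M N m (n \<lhd>\<^bsub>N\<^esub> c)) t))"


section \<open>Morita rings\<close>

locale morita_context =
  fixes A :: "'a ring" and B :: "'b ring"
    and N :: "('a, 'b, 'n) bimodule" and M :: "('b, 'a, 'm) bimodule"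
    and \<phi> :: "('m, 'n) tensor \<Rightarrow> 'b" and \<psi> :: "('n, 'm) tensor \<Rightarrow> 'a"
  assumes ring_A: "ring A" and ring_B: "ring B"
    and bimodule_N: "bimodule A B N" and bimodule_M: "bimodule B A M"
    and phi_hom: "\<phi> \<in> bimodule_hom B B (bitensor A M N) (regular_bimodule B)"
    and psi_hom: "\<psi> \<in> bimodule_hom A A (bitensor B N M) (regular_bimodule A)"
    and phi_psi: "\<lbrakk>m \<in> carrier M; n \<in> carrier N; m' \<in> carrier M\<rbrakk> \<Longrightarrow>
      \<phi> (tensor_elem A M N m n) \<odot>\<^bsub>M\<^esub> m' = m \<lhd>\<^bsub>M\<^esub> \<psi> (tensor_elem B N M n m')"
    and psi_phi: "\<lbrakk>n \<in> carrier N; m \<in> carrier M; n' \<in> carrier N\<rbrakk> \<Longrightarrow>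
      n \<lhd>\<^bsub>N\<^esub> \<phi> (tensor_elem A M N m n') = \<psi> (tensor_elem B N M n m) \<odot>\<^bsub>N\<^esub> n'"

text \<open>The quadruple \<open>(a, n, m, b)\<close> stands for the matrix with rows \<open>a n\<close> and \<open>m b\<close>.\<close>

definition morita_ring ::
    "'a ring \<Rightarrow> 'b ring \<Rightarrow> ('a, 'b, 'n) bimodule \<Rightarrow> ('b, 'a, 'm) bimodule \<Rightarrow>
     (('m, 'n) tensor \<Rightarrow> 'b) \<Rightarrow> (('n, 'm) tensor \<Rightarrow> 'a) \<Rightarrow> ('a \<times> 'n \<times> 'm \<times> 'b) ring"
  where "morita_ring A B N M \<phi> \<psi> =
    \<lparr>carrier = carrier A \<times> carrier N \<times> carrier M \<times> carrier B,
     mult = (\<lambda>(a, n, m, b) (a', n', m', b').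
       (a \<otimes>\<^bsub>A\<^esub> a' \<oplus>\<^bsub>A\<^esub> \<psi> (tensor_elem B N M n m'),
        a \<odot>\<^bsub>N\<^esub> n' \<oplus>\<^bsub>N\<^esub> n \<lhd>\<^bsub>N\<^esub> b',
        m \<lhd>\<^bsub>M\<^esub> a' \<oplus>\<^bsub>M\<^esub> b \<odot>\<^bsub>M\<^esub> m',
        b \<otimes>\<^bsub>B\<^esub> b' \<oplus>\<^bsub>B\<^esub> \<phi> (tensor_elem A M N m n'))),
     one = (\<one>\<^bsub>A\<^esub>, \<zero>\<^bsub>N\<^esub>, \<zero>\<^bsub>M\<^esub>, \<one>\<^bsub>B\<^esub>),
     ring.zero = (\<zero>\<^bsub>A\<^esub>, \<zero>\<^bsub>N\<^esub>, \<zero>\<^bsub>M\<^esub>, \<zero>\<^bsub>B\<^esub>),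
     ring.add = (\<lambda>(a, n, m, b) (a', n', m', b').
       (a \<oplus>\<^bsub>A\<^esub> a', n \<oplus>\<^bsub>N\<^esub> n', m \<oplus>\<^bsub>M\<^esub> m', b \<oplus>\<^bsub>B\<^esub> b'))\<rparr>"

text \<open>Tuples \<open>(X, Y, f, g)\<close> with \<open>f : M \<otimes>\<^sub>A X \<rightarrow> Y\<close> and \<open>g : N \<otimes>\<^sub>B Y \<rightarrow> X\<close>.\<close>

type_synonym ('a, 'b, 'n, 'm, 'x, 'y) morita_tuple =
  "('a, 'x) module \<times> ('b, 'y) module \<times> (('m, 'x) tensor \<Rightarrow> 'y) \<times> (('n, 'y) tensor \<Rightarrow> 'x)"

text \<open>The module \<open>X \<oplus> Y\<close> over the Morita ring that corresponds to the tuple \<open>(X, Y, f, g)\<close>.\<close>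

fun tuple_module ::
    "'a ring \<Rightarrow> 'b ring \<Rightarrow> ('a, 'b, 'n) bimodule \<Rightarrow> ('b, 'a, 'm) bimodule \<Rightarrow>
     ('a, 'b, 'n, 'm, 'x, 'y) morita_tuple \<Rightarrow> ('a \<times> 'n \<times> 'm \<times> 'b, 'x \<times> 'y) module"
  where "tuple_module A B N M (X, Y, f, g) =
    \<lparr>carrier = carrier X \<times> carrier Y, mult = undefined, one = undefined,
     ring.zero = (\<zero>\<^bsub>X\<^esub>, \<zero>\<^bsub>Y\<^esub>),
     ring.add = (\<lambda>(x, y) (x', y'). (x \<oplus>\<^bsub>X\<^esub> x', y \<oplus>\<^bsub>Y\<^esub> y')),
     smult = (\<lambda>(a, n, m, b) (x, y).
       (a \<odot>\<^bsub>X\<^esub> x \<oplus>\<^bsub>X\<^esub> g (tensor_elem B N Y n y),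
        b \<odot>\<^bsub>Y\<^esub> y \<oplus>\<^bsub>Y\<^esub> f (tensor_elem A M X m x)))\<rparr>"

definition Psi_map ::
    "'b ring \<Rightarrow> ('a, 'b, 'n) bimodule \<Rightarrow> ('b, 'a, 'm) bimodule \<Rightarrow> (('n, 'm) tensor \<Rightarrow> 'a) \<Rightarrow>
     ('a, 'x) module \<Rightarrow> ('n, ('m, 'x) tensor) tensor \<Rightarrow> 'x"
  where "Psi_map B N M \<psi> X =
    tensor_lift X (\<lambda>n t. tensor_lift X (\<lambda>m x. \<psi> (tensor_elem B N M n m) \<odot>\<^bsub>X\<^esub> x) t)"

definition Phi_map ::
    "'a ring \<Rightarrow> ('a, 'b, 'n) bimodule \<Rightarrow> ('b, 'a, 'm) bimodule \<Rightarrow> (('m, 'n) tensor \<Rightarrow> 'b) \<Rightarrow>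
     ('b, 'y) module \<Rightarrow> ('m, ('n, 'y) tensor) tensor \<Rightarrow> 'y"
  where "Phi_map A N M \<phi> Y =
    tensor_lift Y (\<lambda>m t. tensor_lift Y (\<lambda>n y. \<phi> (tensor_elem A M N m n) \<odot>\<^bsub>Y\<^esub> y) t)"

definition T_A ::
    "'a ring \<Rightarrow> 'b ring \<Rightarrow> ('a, 'b, 'n) bimodule \<Rightarrow> ('b, 'a, 'm) bimodule \<Rightarrow> (('n, 'm) tensor \<Rightarrow> 'a) \<Rightarrow>
     ('a, 'x) module \<Rightarrow> ('a, 'b, 'n, 'm, 'x, ('m, 'x) tensor) morita_tuple"
  where "T_A A B N M \<psi> P = (P, tensor A M P, id, Psi_map B N M \<psi> P)"

definition T_B ::
    "'a ring \<Rightarrow> 'b ring \<Rightarrow> ('a, 'b, 'n) bimodule \<Rightarrow> ('b, 'a, 'm) bimodule \<Rightarrow> (('m, 'n) tensor \<Rightarrow> 'b) \<Rightarrow>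
     ('b, 'y) module \<Rightarrow> ('a, 'b, 'n, 'm, ('n, 'y) tensor, 'y) morita_tuple"
  where "T_B A B N M \<phi> Q = (tensor B N Q, Q, Phi_map A N M \<phi> Q, id)"

end

theory Submission
  imports Defs "HOL-Algebra.QuotRing"
begin

text \<open>
  Let \<open>e\<close> and \<open>e'\<close> be the diagonal idempotents of the Morita ring \<open>\<Lambda>\<close>. The corner rings \<open>e \<Lambda> e\<close> and \<open>e' \<Lambda> e'\<close>
  are \<open>A\<close> and \<open>B\<close>, and \<open>T_A(P)\<close> is the module \<open>\<Lambda> e \<otimes>\<^sub>A P\<close> induced from \<open>P\<close>, just as \<open>T_B(Q)\<close> is induced from \<open>Q\<close>
  along the other corner. The theorem is a statement on corners and induced modules, combined with
  the fact that an indecomposable projective module over an artinian ring is never the sum of two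
  proper submodules.

  Finitely generated projective modules are handled through dual bases
  (\<open>indecomposable_projective_iff\<close>): elements \<open>w\<^sub>i\<close> and functionals \<open>\<phi>\<^sub>i\<close> with \<open>x = \<Sum> \<phi>\<^sub>i(x) w\<^sub>i\<close> for all \<open>x\<close>.

  From \<open>P\<close> to \<open>T = T_A(P)\<close>: only three properties of \<open>T\<close> matter, collected in the locale
  \<open>induced_module\<close>. The corner \<open>e T\<close> is \<open>P\<close>, it generates \<open>T\<close>, and functionals \<open>P \<rightarrow> A\<close> extend to functionals
  \<open>T \<rightarrow> \<Lambda>\<close>. Thus a dual basis of \<open>P\<close> is one of \<open>T\<close> as well (\<open>induced_dual_basis\<close>). If \<open>T = U \<oplus> V\<close>, then
  \<open>P = e U \<oplus> e V\<close>, so \<open>e V = 0\<close> or \<open>e U = 0\<close> for indecomposable \<open>P\<close>; then \<open>U\<close> or \<open>V\<close> contains \<open>P\<close> and is all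
  of \<open>T\<close> (\<open>induced_indecomposable\<close>).

  From an indecomposable projective \<open>\<Lambda>\<close>-module \<open>Z\<close> to \<open>P\<close>: \<open>Z\<close> satisfies the descending chain condition,
  because \<open>\<Lambda>\<close> is finitely generated over a commutative artinian ring. Shrinking two
  submodules with sum \<open>Z\<close> to minimal ones makes the sum direct, so one of them is \<open>Z\<close>
  (\<open>indecomposable_projective_hollow\<close>). Therefore \<open>Z\<close> is
  generated by a single element \<open>s\<close>, and as \<open>s = e s + e' s\<close>, even by \<open>z = e s\<close> or by \<open>e' s\<close>. In the first case,
  projectivity provides a linear map \<open>\<alpha> : Z \<rightarrow> \<Lambda>\<close> with \<open>\<alpha>(x) z = x\<close>. Then \<open>P = e Z\<close> is an indecomposable
  projective \<open>A\<close>-module (\<open>corner_indecomposable_projective\<close>), and \<open>x \<mapsto> \<alpha>(x) z\<close>, read in \<open>T_A(P)\<close>, is an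
  isomorphism from \<open>Z\<close> to \<open>T_A(P)\<close> (\<open>isomorphic_induced_module\<close>). The second case is the same with the
  corner \<open>B\<close>.

  That \<open>T_A(P)\<close> is induced from \<open>P\<close> is verified by computations with tensors (\<open>T_A_induced\<close>). For \<open>T_B(Q)\<close> it
  follows by interchanging the two rings of the Morita context (\<open>T_B_induced\<close>).
\<close>

section \<open>Submodules and homomorphisms\<close>

lemma additive_zero:
  assumes "abelian_group X" "abelian_group Y" "f \<in> hom (add_monoid X) (add_monoid Y)"
  shows "f \<zero>\<^bsub>X\<^esub> = \<zero>\<^bsub>Y\<^esub>"
proof -
  have "f \<one>\<^bsub>add_monoid X\<^esub> = \<one>\<^bsub>add_monoid Y\<^esub>"
    by (rule hom_one[OF assms(3) abelian_group.a_group[OF assms(1)] abelian_group.a_group[OF assms(2)]])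
  then show ?thesis by simp
qed

lemma additive_finsum:
  assumes "abelian_group X" "abelian_group Y" "f \<in> hom (add_monoid X) (add_monoid Y)"
    and "\<And>i. i \<in> I \<Longrightarrow> g i \<in> carrier X"
  shows "f (\<Oplus>\<^bsub>X\<^esub>i\<in>I. g i) = (\<Oplus>\<^bsub>Y\<^esub>i\<in>I. f (g i))"
proof -
  interpret X: abelian_group X by fact
  interpret Y: abelian_group Y by fact
  have f: "\<And>x. x \<in> carrier X \<Longrightarrow> f x \<in> carrier Y"
    "\<And>x y. x \<in> carrier X \<Longrightarrow> y \<in> carrier X \<Longrightarrow> f (x \<oplus>\<^bsub>X\<^esub> y) = f x \<oplus>\<^bsub>Y\<^esub> f y"
    using assms(3) by (auto simp: hom_def)
  show ?thesis
    using assms(4)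
  proof (induction I rule: infinite_finite_induct)
    case (insert i I)
    have "f (\<Oplus>\<^bsub>X\<^esub>i\<in>insert i I. g i) = f (g i \<oplus>\<^bsub>X\<^esub> (\<Oplus>\<^bsub>X\<^esub>i\<in>I. g i))"
      using insert by (subst X.finsum_insert) auto
    also have "\<dots> = f (g i) \<oplus>\<^bsub>Y\<^esub> (\<Oplus>\<^bsub>Y\<^esub>i\<in>I. f (g i))"
      using insert by (subst f(2)) (auto intro!: X.finsum_closed)
    also have "\<dots> = (\<Oplus>\<^bsub>Y\<^esub>i\<in>insert i I. f (g i))"
      using insert f(1) by (subst Y.finsum_insert) auto
    finally show ?case .
  qed (use additive_zero[OF assms(1-3)] in auto)
qed

abbreviation cyclic :: "('r, 'k) ring_scheme \<Rightarrow> ('r, 'x, 'l) module_scheme \<Rightarrow> 'x \<Rightarrow> 'x set"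
  where "cyclic R X x \<equiv> (\<lambda>r. r \<odot>\<^bsub>X\<^esub> x) ` carrier R"

context left_module
begin

lemma smult_zero_left: "x \<in> carrier M \<Longrightarrow> \<zero>\<^bsub>R\<^esub> \<odot>\<^bsub>M\<^esub> x = \<zero>\<^bsub>M\<^esub>"
proof -
  assume x: "x \<in> carrier M"
  have "\<zero>\<^bsub>R\<^esub> \<odot>\<^bsub>M\<^esub> x \<oplus>\<^bsub>M\<^esub> \<zero>\<^bsub>R\<^esub> \<odot>\<^bsub>M\<^esub> x = \<zero>\<^bsub>R\<^esub> \<odot>\<^bsub>M\<^esub> x \<oplus>\<^bsub>M\<^esub> \<zero>\<^bsub>M\<^esub>"
    using lsmult_l_distr[of "\<zero>\<^bsub>R\<^esub>" "\<zero>\<^bsub>R\<^esub>" x] x lsmult_closed by simp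
  then show ?thesis using x by (simp add: lsmult_closed)
qed

lemma smult_zero_right: "a \<in> carrier R \<Longrightarrow> a \<odot>\<^bsub>M\<^esub> \<zero>\<^bsub>M\<^esub> = \<zero>\<^bsub>M\<^esub>"
proof -
  assume a: "a \<in> carrier R"
  have "a \<odot>\<^bsub>M\<^esub> \<zero>\<^bsub>M\<^esub> \<oplus>\<^bsub>M\<^esub> a \<odot>\<^bsub>M\<^esub> \<zero>\<^bsub>M\<^esub> = a \<odot>\<^bsub>M\<^esub> \<zero>\<^bsub>M\<^esub> \<oplus>\<^bsub>M\<^esub> \<zero>\<^bsub>M\<^esub>"
    using lsmult_r_distr[of a "\<zero>\<^bsub>M\<^esub>" "\<zero>\<^bsub>M\<^esub>"] a lsmult_closed by simp
  then show ?thesis using a by (simp add: lsmult_closed)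
qed

lemma smult_minus_one: "x \<in> carrier M \<Longrightarrow> (\<ominus>\<^bsub>R\<^esub> \<one>\<^bsub>R\<^esub>) \<odot>\<^bsub>M\<^esub> x = \<ominus>\<^bsub>M\<^esub> x"
proof -
  assume x: "x \<in> carrier M"
  have "(\<ominus>\<^bsub>R\<^esub> \<one>\<^bsub>R\<^esub>) \<odot>\<^bsub>M\<^esub> x \<oplus>\<^bsub>M\<^esub> x = \<zero>\<^bsub>M\<^esub>"
    using lsmult_l_distr[of "\<ominus>\<^bsub>R\<^esub> \<one>\<^bsub>R\<^esub>" "\<one>\<^bsub>R\<^esub>" x] x
    by (simp add: lsmult_one R.l_neg smult_zero_left)
  then show ?thesis using x by (simp add: M.minus_equality lsmult_closed)
qed

lemma smult_finsum:
  assumes "r \<in> carrier R" "\<And>i. i \<in> I \<Longrightarrow> g i \<in> carrier M"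
  shows "r \<odot>\<^bsub>M\<^esub> (\<Oplus>\<^bsub>M\<^esub>i\<in>I. g i) = (\<Oplus>\<^bsub>M\<^esub>i\<in>I. r \<odot>\<^bsub>M\<^esub> g i)"
  using assms lsmult_closed lsmult_r_distr
  by (intro additive_finsum[OF M.abelian_group_axioms M.abelian_group_axioms]) (auto simp: hom_def)

lemma left_submodule_iff:
  "left_submodule R M U \<longleftrightarrow> U \<subseteq> carrier M \<and> \<zero>\<^bsub>M\<^esub> \<in> U \<and>
     (\<forall>u\<in>U. \<forall>v\<in>U. u \<oplus>\<^bsub>M\<^esub> v \<in> U) \<and> (\<forall>r\<in>carrier R. \<forall>u\<in>U. r \<odot>\<^bsub>M\<^esub> u \<in> U)"
  (is "?L \<longleftrightarrow> ?R")
proof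
  assume ?L
  then have "subgroup U (add_monoid M)"
    by (simp add: left_submodule_def additive_subgroup_def)
  with \<open>?L\<close> show ?R
    using subgroup.subset[of U "add_monoid M"] subgroup.one_closed[of U "add_monoid M"]
      subgroup.m_closed[of U "add_monoid M"]
    by (simp add: left_submodule_def)
next
  assume R: ?R
  have "subgroup U (add_monoid M)"
  proof (rule group.subgroupI[OF M.a_group])
    fix u assume "u \<in> U"
    then have "(\<ominus>\<^bsub>R\<^esub> \<one>\<^bsub>R\<^esub>) \<odot>\<^bsub>M\<^esub> u \<in> U" using R by blast
    moreover have "u \<in> carrier M" using R \<open>u \<in> U\<close> by blast
    ultimately have "\<ominus>\<^bsub>M\<^esub> u \<in> U" using smult_minus_one by metis
    then show "inv\<^bsub>add_monoid M\<^esub> u \<in> U" unfolding a_inv_def .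
  qed (use R in auto)
  with R show ?L by (simp add: left_submodule_def additive_subgroup_def)
qed

lemma left_submoduleD:
  assumes "left_submodule R M U"
  shows "U \<subseteq> carrier M" "\<zero>\<^bsub>M\<^esub> \<in> U" "u \<in> U \<Longrightarrow> u \<in> carrier M"
    and "u \<in> U \<Longrightarrow> v \<in> U \<Longrightarrow> u \<oplus>\<^bsub>M\<^esub> v \<in> U"
    and "r \<in> carrier R \<Longrightarrow> u \<in> U \<Longrightarrow> r \<odot>\<^bsub>M\<^esub> u \<in> U"
  using assms unfolding left_submodule_iff by auto

lemma left_submodule_minus:
  assumes "left_submodule R M U" "u \<in> U" "v \<in> U" shows "u \<ominus>\<^bsub>M\<^esub> v \<in> U"
proof -
  have "(\<ominus>\<^bsub>R\<^esub> \<one>\<^bsub>R\<^esub>) \<odot>\<^bsub>M\<^esub> v \<in> U"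
    using assms by (intro left_submoduleD(5)) auto
  moreover have "v \<in> carrier M" using assms left_submoduleD(3) by metis
  ultimately show ?thesis
    using assms(1,2) smult_minus_one[of v] left_submoduleD(4)[OF assms(1)] unfolding a_minus_def by metis
qed

lemma left_submodule_finsum:
  assumes "left_submodule R M U" "\<And>i. i \<in> I \<Longrightarrow> f i \<in> U"
  shows "(\<Oplus>\<^bsub>M\<^esub>i\<in>I. f i) \<in> U"
  using assms(2)
proof (induction I rule: infinite_finite_induct)
  case (insert i I)
  have U: "U \<subseteq> carrier M" using left_submoduleD(1)[OF assms(1)] .
  then have "(\<Oplus>\<^bsub>M\<^esub>i\<in>insert i I. f i) = f i \<oplus>\<^bsub>M\<^esub> (\<Oplus>\<^bsub>M\<^esub>i\<in>I. f i)"
    using insert by (intro finsum_insert) auto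
  then show ?case using insert left_submoduleD(4)[OF assms(1)] by auto
qed (use left_submoduleD(2)[OF assms(1)] in auto)

lemma left_submodule_add_left:
  assumes "left_submodule R M U" "u \<in> U" "x \<in> carrier M" "u \<oplus>\<^bsub>M\<^esub> x \<in> U" shows "x \<in> U"
proof -
  have u: "u \<in> carrier M" using assms left_submoduleD(3) by metis
  have "(u \<oplus>\<^bsub>M\<^esub> x) \<ominus>\<^bsub>M\<^esub> u = x"
    using u assms(3) by (simp add: a_minus_def M.a_comm[of u x] M.a_assoc M.r_neg)
  then show ?thesis using left_submodule_minus[OF assms(1,4,2)] by simp
qed

lemma zero_submodule: "left_submodule R M {\<zero>\<^bsub>M\<^esub>}"
  by (auto simp: left_submodule_iff smult_zero_right)

lemma full_submodule: "left_submodule R M (carrier M)"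
  by (auto simp: left_submodule_iff lsmult_closed)

lemma Int_submodule:
  "left_submodule R M U \<Longrightarrow> left_submodule R M V \<Longrightarrow> left_submodule R M (U \<inter> V)"
  by (auto simp: left_submodule_iff)

lemma mem_set_add: "x \<in> U <+>\<^bsub>M\<^esub> V \<longleftrightarrow> (\<exists>u\<in>U. \<exists>v\<in>V. x = u \<oplus>\<^bsub>M\<^esub> v)"
  by (auto simp: set_add_def')

lemma set_add_commute:
  assumes "U \<subseteq> carrier M" "V \<subseteq> carrier M" shows "U <+>\<^bsub>M\<^esub> V = V <+>\<^bsub>M\<^esub> U"
proof -
  have "u \<oplus>\<^bsub>M\<^esub> v = v \<oplus>\<^bsub>M\<^esub> u" if "u \<in> U" "v \<in> V" for u v
    using that assms by (intro M.a_comm) auto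
  then show ?thesis unfolding set_eq_iff mem_set_add by metis
qed

lemma sum_submodule:
  assumes U: "left_submodule R M U" and V: "left_submodule R M V"
  shows "left_submodule R M (U <+>\<^bsub>M\<^esub> V)"
  unfolding left_submodule_iff
proof (intro conjI ballI)
  note sub = left_submoduleD(3)[OF U] left_submoduleD(3)[OF V]
  show "U <+>\<^bsub>M\<^esub> V \<subseteq> carrier M" using sub by (auto simp: mem_set_add)
  have "\<zero>\<^bsub>M\<^esub> \<oplus>\<^bsub>M\<^esub> \<zero>\<^bsub>M\<^esub> \<in> U <+>\<^bsub>M\<^esub> V"
    unfolding mem_set_add using left_submoduleD(2)[OF U] left_submoduleD(2)[OF V] by metis
  then show "\<zero>\<^bsub>M\<^esub> \<in> U <+>\<^bsub>M\<^esub> V" by simp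
  fix x assume "x \<in> U <+>\<^bsub>M\<^esub> V"
  then obtain u v where *: "u \<in> U" "v \<in> V" "x = u \<oplus>\<^bsub>M\<^esub> v" by (auto simp: mem_set_add)
  show "x \<oplus>\<^bsub>M\<^esub> y \<in> U <+>\<^bsub>M\<^esub> V" if y: "y \<in> U <+>\<^bsub>M\<^esub> V" for y
  proof -
    obtain u' v' where **: "u' \<in> U" "v' \<in> V" "y = u' \<oplus>\<^bsub>M\<^esub> v'"
      using y by (auto simp: mem_set_add)
    have "x \<oplus>\<^bsub>M\<^esub> y = (u \<oplus>\<^bsub>M\<^esub> u') \<oplus>\<^bsub>M\<^esub> (v \<oplus>\<^bsub>M\<^esub> v')"
      using * ** sub by (simp add: M.a_ac)
    moreover have "u \<oplus>\<^bsub>M\<^esub> u' \<in> U" "v \<oplus>\<^bsub>M\<^esub> v' \<in> V"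
      using * ** left_submoduleD(4)[OF U] left_submoduleD(4)[OF V] by auto
    ultimately show ?thesis unfolding mem_set_add by blast
  qed
  show "r \<odot>\<^bsub>M\<^esub> x \<in> U <+>\<^bsub>M\<^esub> V" if r: "r \<in> carrier R" for r
  proof -
    have "r \<odot>\<^bsub>M\<^esub> x = r \<odot>\<^bsub>M\<^esub> u \<oplus>\<^bsub>M\<^esub> r \<odot>\<^bsub>M\<^esub> v"
      using * sub r by (simp add: lsmult_r_distr)
    moreover have "r \<odot>\<^bsub>M\<^esub> u \<in> U" "r \<odot>\<^bsub>M\<^esub> v \<in> V"
      using * r left_submoduleD(5)[OF U] left_submoduleD(5)[OF V] by auto
    ultimately show ?thesis unfolding mem_set_add by blast
  qed
qed

lemma cyclic_submodule:
  assumes x: "x \<in> carrier M"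
  shows "left_submodule R M (cyclic R M x)"
  unfolding left_submodule_iff
proof (intro conjI ballI)
  show "cyclic R M x \<subseteq> carrier M" using x lsmult_closed by auto
  show "\<zero>\<^bsub>M\<^esub> \<in> cyclic R M x"
    using smult_zero_left[OF x] by (metis R.zero_closed imageI)
  fix y assume "y \<in> cyclic R M x"
  then obtain r where r: "r \<in> carrier R" "y = r \<odot>\<^bsub>M\<^esub> x" by (rule imageE)
  show "y \<oplus>\<^bsub>M\<^esub> z \<in> cyclic R M x" if z: "z \<in> cyclic R M x" for z
  proof -
    obtain s where s: "s \<in> carrier R" "z = s \<odot>\<^bsub>M\<^esub> x" using z by (rule imageE)
    have "y \<oplus>\<^bsub>M\<^esub> z = (r \<oplus>\<^bsub>R\<^esub> s) \<odot>\<^bsub>M\<^esub> x" using r s x by (simp add: lsmult_l_distr)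
    then show ?thesis using r s by (metis R.add.m_closed imageI)
  qed
  show "s \<odot>\<^bsub>M\<^esub> y \<in> cyclic R M x" if "s \<in> carrier R" for s
    using r that x lsmult_assoc[of s r x] by (metis R.m_closed imageI)
qed

lemma subset_add_cyclic:
  assumes W: "left_submodule R M W" and y: "y \<in> carrier M"
  shows "W \<subseteq> W <+>\<^bsub>M\<^esub> cyclic R M y" "y \<in> W <+>\<^bsub>M\<^esub> cyclic R M y"
proof -
  note cyc = left_submoduleD(2)[OF cyclic_submodule[OF y]]
  show "W \<subseteq> W <+>\<^bsub>M\<^esub> cyclic R M y"
  proof
    fix w assume w: "w \<in> W"
    then have "w = w \<oplus>\<^bsub>M\<^esub> \<zero>\<^bsub>M\<^esub>" using left_submoduleD(3)[OF W] by simp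
    then show "w \<in> W <+>\<^bsub>M\<^esub> cyclic R M y"
      unfolding mem_set_add using w cyc by metis
  qed
  have "y = \<zero>\<^bsub>M\<^esub> \<oplus>\<^bsub>M\<^esub> \<one>\<^bsub>R\<^esub> \<odot>\<^bsub>M\<^esub> y" using y by (simp add: lsmult_one)
  then show "y \<in> W <+>\<^bsub>M\<^esub> cyclic R M y"
    unfolding mem_set_add using left_submoduleD(2)[OF W] R.one_closed by (metis imageI)
qed

text \<open>
  This turns a splitting of a generator, such as \<open>s = e s + e' s\<close> for complementary idempotents, into a
  sum of submodules.
\<close>

lemma cyclic_add:
  assumes y: "y \<in> carrier M" and z: "z \<in> carrier M"
    and gen: "cyclic R M (y \<oplus>\<^bsub>M\<^esub> z) = carrier M"
  shows "cyclic R M y <+>\<^bsub>M\<^esub> cyclic R M z = carrier M"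
    (is "?C <+>\<^bsub>M\<^esub> ?D = _")
proof
  show "?C <+>\<^bsub>M\<^esub> ?D \<subseteq> carrier M"
    by (rule left_submoduleD(1)[OF sum_submodule[OF cyclic_submodule[OF y] cyclic_submodule[OF z]]])
  have "r \<odot>\<^bsub>M\<^esub> (y \<oplus>\<^bsub>M\<^esub> z) \<in> ?C <+>\<^bsub>M\<^esub> ?D" if r: "r \<in> carrier R" for r
    unfolding lsmult_r_distr[OF r y z] mem_set_add
    using r by (intro bexI[of _ "r \<odot>\<^bsub>M\<^esub> y"] bexI[of _ "r \<odot>\<^bsub>M\<^esub> z"] refl imageI)
  then show "carrier M \<subseteq> ?C <+>\<^bsub>M\<^esub> ?D" unfolding gen[symmetric] by (rule image_subsetI)
qed

end

lemma indecomposableD: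
  assumes "indecomposable R X"
  shows "carrier X \<noteq> {\<zero>\<^bsub>X\<^esub>}"
    and "\<lbrakk>left_submodule R X U; left_submodule R X V; U <+>\<^bsub>X\<^esub> V = carrier X; U \<inter> V = {\<zero>\<^bsub>X\<^esub>}\<rbrakk> \<Longrightarrow>
      U = {\<zero>\<^bsub>X\<^esub>} \<or> V = {\<zero>\<^bsub>X\<^esub>}"
  using assms unfolding indecomposable_def by blast+

lemma left_hom_iff:
  "f \<in> left_hom R X Y \<longleftrightarrow> (\<forall>x\<in>carrier X. f x \<in> carrier Y) \<and>
     (\<forall>x\<in>carrier X. \<forall>y\<in>carrier X. f (x \<oplus>\<^bsub>X\<^esub> y) = f x \<oplus>\<^bsub>Y\<^esub> f y) \<and>
     (\<forall>r\<in>carrier R. \<forall>x\<in>carrier X. f (r \<odot>\<^bsub>X\<^esub> x) = r \<odot>\<^bsub>Y\<^esub> f x)"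
  by (auto simp: left_hom_def hom_def)

lemma left_homD:
  assumes "f \<in> left_hom R X Y"
  shows "x \<in> carrier X \<Longrightarrow> f x \<in> carrier Y"
    and "x \<in> carrier X \<Longrightarrow> y \<in> carrier X \<Longrightarrow> f (x \<oplus>\<^bsub>X\<^esub> y) = f x \<oplus>\<^bsub>Y\<^esub> f y"
    and "r \<in> carrier R \<Longrightarrow> x \<in> carrier X \<Longrightarrow> f (r \<odot>\<^bsub>X\<^esub> x) = r \<odot>\<^bsub>Y\<^esub> f x"
  using assms by (auto simp: left_hom_iff)

lemma left_hom_zero:
  assumes "left_module R X" "left_module R Y" "f \<in> left_hom R X Y"
  shows "f \<zero>\<^bsub>X\<^esub> = \<zero>\<^bsub>Y\<^esub>"
  using assms additive_zero by (auto simp: left_hom_def left_module_def)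

lemma left_hom_finsum:
  assumes "left_module R X" "left_module R Y" "f \<in> left_hom R X Y"
    and "\<And>i. i \<in> I \<Longrightarrow> g i \<in> carrier X"
  shows "f (\<Oplus>\<^bsub>X\<^esub>i\<in>I. g i) = (\<Oplus>\<^bsub>Y\<^esub>i\<in>I. f (g i))"
  using assms additive_finsum[of X Y f I g] by (auto simp: left_hom_def left_module_def)

lemma left_hom_image_submodule:
  assumes "left_module R X" "left_module R Y" "f \<in> left_hom R X Y" "left_submodule R X U"
  shows "left_submodule R Y (f ` U)"
proof -
  interpret X: left_module R X by fact
  interpret Y: left_module R Y by fact
  have U: "U \<subseteq> carrier X" "\<zero>\<^bsub>X\<^esub> \<in> U" "\<And>u v. u \<in> U \<Longrightarrow> v \<in> U \<Longrightarrow> u \<oplus>\<^bsub>X\<^esub> v \<in> U"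
      "\<And>r u. r \<in> carrier R \<Longrightarrow> u \<in> U \<Longrightarrow> r \<odot>\<^bsub>X\<^esub> u \<in> U"
    using assms(4) by (auto simp: X.left_submodule_iff)
  show ?thesis
    unfolding Y.left_submodule_iff
  proof (intro conjI ballI)
    show "\<zero>\<^bsub>Y\<^esub> \<in> f ` U" using left_hom_zero[OF assms(1-3)] U by (metis imageI)
    show "u \<oplus>\<^bsub>Y\<^esub> v \<in> f ` U" if "u \<in> f ` U" "v \<in> f ` U" for u v
      using that U left_homD(2)[OF assms(3)] by (auto simp: subset_iff image_iff) (metis U(3))
    show "r \<odot>\<^bsub>Y\<^esub> u \<in> f ` U" if "r \<in> carrier R" "u \<in> f ` U" for r u
      using that U left_homD(3)[OF assms(3)] by (auto simp: subset_iff image_iff) (metis U(4))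
  qed (use U left_homD(1)[OF assms(3)] in auto)
qed

lemma left_hom_kernel_submodule:
  assumes "left_module R X" "left_module R Y" "f \<in> left_hom R X Y"
  shows "left_submodule R X {x \<in> carrier X. f x = \<zero>\<^bsub>Y\<^esub>}"
proof -
  interpret X: left_module R X by fact
  interpret Y: left_module R Y by fact
  show ?thesis
    using left_hom_zero[OF assms] left_homD[OF assms(3)]
    by (auto simp: X.left_submodule_iff X.lsmult_closed Y.smult_zero_right)
qed

lemma left_hom_equaliser_submodule:
  assumes "left_module R X" "left_module R Y" "f \<in> left_hom R X Y" "g \<in> left_hom R X Y"
  shows "left_submodule R X {x \<in> carrier X. f x = g x}"
proof -
  interpret X: left_module R X by fact
  interpret Y: left_module R Y by fact
  show ?thesis
    using left_hom_zero[OF assms(1-3)] left_hom_zero[OF assms(1,2,4)]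
      left_homD[OF assms(3)] left_homD[OF assms(4)]
    by (auto simp: X.left_submodule_iff X.lsmult_closed)
qed

lemma left_hom_vimage_submodule:
  assumes "left_module R X" "left_module R Y" "f \<in> left_hom R X Y" "left_submodule R Y U"
  shows "left_submodule R X {x \<in> carrier X. f x \<in> U}"
proof -
  interpret X: left_module R X by fact
  interpret Y: left_module R Y by fact
  note U = Y.left_submoduleD[OF assms(4)]
  show ?thesis
    using left_hom_zero[OF assms(1-3)] left_homD[OF assms(3)] U
    by (auto simp: X.left_submodule_iff X.lsmult_closed)
qed

lemma left_hom_comp:
  "f \<in> left_hom R X Y \<Longrightarrow> g \<in> left_hom R Y Z \<Longrightarrow> (\<lambda>x. g (f x)) \<in> left_hom R X Z"
  by (simp add: left_hom_iff)

text \<open>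
  The module axioms are identities, so they pass to every surjective image; a structure that is
  transported along a bijection need not be checked again.
\<close>

lemma left_module_surj_image:
  fixes Y (structure)
  assumes "left_module R X" "f \<in> left_hom R X Y" "f ` carrier X = carrier Y" "f \<zero>\<^bsub>X\<^esub> = \<zero>"
  shows "left_module R Y"
proof -
  interpret X: left_module R X by fact
  note f = left_homD[OF assms(2)]
  note f' = f(2)[symmetric] f(3)[symmetric]
  have ex: "\<exists>x\<in>carrier X. y = f x" if "y \<in> carrier Y" for y using that assms(3) by auto
  have "abelian_group Y"
  proof (rule abelian_groupI)
    fix x y z assume "x \<in> carrier Y" "y \<in> carrier Y" "z \<in> carrier Y"
    then obtain a b c where *: "a \<in> carrier X" "x = f a" "b \<in> carrier X" "y = f b" "c \<in> carrier X" "z = f c"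
      using ex by metis
    then show "x \<oplus> y \<oplus> z = x \<oplus> (y \<oplus> z)" by (simp add: f' X.a_assoc)
  next
    fix x y assume "x \<in> carrier Y" "y \<in> carrier Y"
    then obtain a b where *: "a \<in> carrier X" "x = f a" "b \<in> carrier X" "y = f b" using ex by metis
    then show "x \<oplus> y \<in> carrier Y" by (simp add: f' f(1))
    show "x \<oplus> y = y \<oplus> x" using * by (simp add: f' X.a_comm)
  next
    show "\<zero> \<in> carrier Y" using f(1)[OF X.zero_closed] assms(4) by simp
  next
    fix x assume "x \<in> carrier Y"
    then obtain a where *: "a \<in> carrier X" "x = f a" using ex by metis
    then show "\<zero> \<oplus> x = x" by (simp add: assms(4)[symmetric] f')
    have "f (\<ominus>\<^bsub>X\<^esub> a) \<oplus> x = \<zero>"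
      using * by (simp add: f' X.l_neg assms(4))
    moreover have "f (\<ominus>\<^bsub>X\<^esub> a) \<in> carrier Y" using * f(1) by simp
    ultimately show "\<exists>y\<in>carrier Y. y \<oplus> x = \<zero>" by metis
  qed
  moreover have "left_module_axioms R Y"
  proof
    fix r s x assume r: "r \<in> carrier R" "s \<in> carrier R" and "x \<in> carrier Y"
    then obtain a where *: "a \<in> carrier X" "x = f a" using ex by metis
    show "(r \<oplus>\<^bsub>R\<^esub> s) \<odot> x = r \<odot> x \<oplus> s \<odot> x"
      using r * by (simp add: f' X.lsmult_l_distr X.lsmult_closed)
    show "(r \<otimes>\<^bsub>R\<^esub> s) \<odot> x = r \<odot> (s \<odot> x)"
      using r * by (simp add: f' X.lsmult_assoc X.lsmult_closed)
  next
    fix r x y assume r: "r \<in> carrier R" and "x \<in> carrier Y" "y \<in> carrier Y"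
    then obtain a b where *: "a \<in> carrier X" "x = f a" "b \<in> carrier X" "y = f b" using ex by metis
    show "r \<odot> (x \<oplus> y) = r \<odot> x \<oplus> r \<odot> y"
      using r * by (simp add: f' X.lsmult_r_distr X.lsmult_closed)
  next
    fix r x assume r: "r \<in> carrier R" and "x \<in> carrier Y"
    then obtain a where *: "a \<in> carrier X" "x = f a" using ex by metis
    then show "r \<odot> x \<in> carrier Y" using r by (simp add: f' f(1) X.lsmult_closed)
  next
    fix x assume "x \<in> carrier Y"
    then obtain a where *: "a \<in> carrier X" "x = f a" using ex by metis
    show "\<one>\<^bsub>R\<^esub> \<odot> x = x" using * by (simp add: f' X.lsmult_one)
  qed
  ultimately show ?thesis using X.R.ring_axioms by (simp add: left_module_def)
qed

lemma left_hom_inv_into: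
  fixes X (structure)
  assumes "left_module R X" "f \<in> left_hom R X Y" "bij_betw f (carrier X) (carrier Y)"
  shows "inv_into (carrier X) f \<in> left_hom R Y X"
proof -
  interpret X: left_module R X by fact
  let ?g = "inv_into (carrier X) f"
  have g: "?g y \<in> carrier X" "f (?g y) = y" if "y \<in> carrier Y" for y
    using that assms(3) by (auto simp: bij_betw_def inv_into_into f_inv_into_f)
  have gf: "?g (f x) = x" if "x \<in> carrier X" for x
    using that assms(3) by (auto simp: bij_betw_def)
  show ?thesis
    unfolding left_hom_iff
  proof (intro conjI ballI)
    fix y y' assume y: "y \<in> carrier Y" "y' \<in> carrier Y"
    have "?g (f (?g y \<oplus> ?g y')) = ?g y \<oplus> ?g y'"
      using g y by (intro gf) auto
    then show "?g (y \<oplus>\<^bsub>Y\<^esub> y') = ?g y \<oplus> ?g y'" using g y left_homD(2)[OF assms(2)] by auto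
  next
    fix r y assume y: "r \<in> carrier R" "y \<in> carrier Y"
    have "?g (f (r \<odot> ?g y)) = r \<odot> ?g y"
      using g y by (intro gf) (auto simp: X.lsmult_closed)
    then show "?g (r \<odot>\<^bsub>Y\<^esub> y) = r \<odot> ?g y" using g y left_homD(3)[OF assms(2)] by auto
  qed (use g in auto)
qed

lemma regular_module: "ring R \<Longrightarrow> left_module R (regular_bimodule R)"
proof -
  assume "ring R"
  then interpret ring R .
  have "abelian_group (regular_bimodule R)"
    by (rule abelian_groupI) (auto simp: regular_bimodule_def a_ac intro!: bexI[of _ "\<ominus>\<^bsub>R\<^esub> x" for x] l_neg)
  then show ?thesis
    using \<open>ring R\<close>
    by (auto simp: left_module_def left_module_axioms_def regular_bimodule_def l_distr r_distr m_assoc)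
qed

lemma regular_simps [simp]:
  "carrier (regular_bimodule R) = carrier R" "ring.zero (regular_bimodule R) = \<zero>\<^bsub>R\<^esub>"
  "ring.add (regular_bimodule R) = (\<oplus>\<^bsub>R\<^esub>)" "smult (regular_bimodule R) = (\<otimes>\<^bsub>R\<^esub>)"
  "rsmult (regular_bimodule R) = (\<otimes>\<^bsub>R\<^esub>)"
  by (simp_all add: regular_bimodule_def)

section \<open>Finitely generated modules and dual bases\<close>

text \<open>
  The linear combinations of the elements of \<open>S\<close> form a submodule, the smallest one containing \<open>S\<close>.
  Formulated with submodules, finite generation is easily carried along homomorphisms and allows
  inductions that add the elements of \<open>S\<close> one at a time.
\<close>

lemma finitely_generated_iff:
  fixes X (structure)
  assumes "left_module R X"
  shows "finitely_generated R X \<longleftrightarrow>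
    (\<exists>S. finite S \<and> S \<subseteq> carrier X \<and> (\<forall>U. left_submodule R X U \<and> S \<subseteq> U \<longrightarrow> U = carrier X))"
    (is "?L \<longleftrightarrow> ?R")
proof -
  interpret X: left_module R X by fact
  show ?thesis
  proof
    assume ?L
    then obtain S where S: "finite S" "S \<subseteq> carrier X"
      "\<And>x. x \<in> carrier X \<Longrightarrow> \<exists>c\<in>S \<rightarrow> carrier R. x = (\<Oplus>s\<in>S. c s \<odot> s)"
      unfolding finitely_generated_def by metis
    have "U = carrier X" if U: "left_submodule R X U" "S \<subseteq> U" for U
    proof
      show "U \<subseteq> carrier X" using X.left_submoduleD(1)[OF U(1)] .
      show "carrier X \<subseteq> U"
      proof
        fix x assume "x \<in> carrier X"
        then obtain c where c: "c \<in> S \<rightarrow> carrier R" "x = (\<Oplus>s\<in>S. c s \<odot> s)" using S by blast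
        have "c s \<odot> s \<in> U" if "s \<in> S" for s
          using U(2) c that by (intro X.left_submoduleD(5)[OF U(1)]) auto
        then show "x \<in> U" unfolding c by (rule X.left_submodule_finsum[OF U(1)])
      qed
    qed
    then show ?R using S(1,2) by metis
  next
    assume ?R
    then obtain S where S: "finite S" "S \<subseteq> carrier X"
      "\<And>U. left_submodule R X U \<Longrightarrow> S \<subseteq> U \<Longrightarrow> U = carrier X" by metis
    define U where "U = {x. \<exists>c\<in>S \<rightarrow> carrier R. x = (\<Oplus>s\<in>S. c s \<odot> s)}"
    have cl: "(\<lambda>s. c s \<odot> s) \<in> S \<rightarrow> carrier X" if "c \<in> S \<rightarrow> carrier R" for c
      using that S(2) by (auto intro!: X.lsmult_closed)
    have "left_submodule R X U"
      unfolding X.left_submodule_iff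
    proof (intro conjI ballI)
      show "U \<subseteq> carrier X" using cl by (auto simp: U_def)
      have "(\<Oplus>s\<in>S. \<zero>\<^bsub>R\<^esub> \<odot> s) = (\<Oplus>s\<in>S. \<zero>)"
        using S(2) by (intro X.finsum_cong') (auto simp: X.smult_zero_left subset_iff)
      then show "\<zero> \<in> U"
        unfolding U_def by (auto intro!: bexI[of _ "\<lambda>s. \<zero>\<^bsub>R\<^esub>"])
    next
      fix u v assume "u \<in> U" "v \<in> U"
      then obtain c d where c: "c \<in> S \<rightarrow> carrier R" "u = (\<Oplus>s\<in>S. c s \<odot> s)"
        and d: "d \<in> S \<rightarrow> carrier R" "v = (\<Oplus>s\<in>S. d s \<odot> s)" by (auto simp: U_def)
      have "u \<oplus> v = (\<Oplus>s\<in>S. c s \<odot> s \<oplus> d s \<odot> s)"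
        unfolding c d using cl c d by (simp add: X.finsum_addf)
      also have "\<dots> = (\<Oplus>s\<in>S. (c s \<oplus>\<^bsub>R\<^esub> d s) \<odot> s)"
        using c d S(2) by (intro X.finsum_cong') (auto simp: X.lsmult_l_distr subset_iff Pi_iff X.lsmult_closed)
      finally show "u \<oplus> v \<in> U"
        unfolding U_def using c d by (auto intro!: bexI[of _ "\<lambda>s. c s \<oplus>\<^bsub>R\<^esub> d s"])
    next
      fix r u assume r: "r \<in> carrier R" and "u \<in> U"
      then obtain c where c: "c \<in> S \<rightarrow> carrier R" "u = (\<Oplus>s\<in>S. c s \<odot> s)" by (auto simp: U_def)
      have "r \<odot> u = (\<Oplus>s\<in>S. r \<odot> (c s \<odot> s))"
        unfolding c(2) using cl[OF c(1)] r by (intro X.smult_finsum) auto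
      also have "\<dots> = (\<Oplus>s\<in>S. (r \<otimes>\<^bsub>R\<^esub> c s) \<odot> s)"
        using c S(2) r by (intro X.finsum_cong') (auto simp: X.lsmult_assoc subset_iff Pi_iff X.lsmult_closed)
      finally show "r \<odot> u \<in> U"
        unfolding U_def using c r by (auto intro!: bexI[of _ "\<lambda>s. r \<otimes>\<^bsub>R\<^esub> c s"])
    qed
    moreover have "S \<subseteq> U"
    proof
      fix t assume t: "t \<in> S"
      have "(\<Oplus>s\<in>S. (if t = s then \<one>\<^bsub>R\<^esub> else \<zero>\<^bsub>R\<^esub>) \<odot> s) = (\<Oplus>s\<in>S. if t = s then s else \<zero>)"
        using S(2) by (intro X.finsum_cong') (auto simp: X.smult_zero_left X.lsmult_one subset_iff)
      also have "\<dots> = t"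
        using X.finsum_singleton[OF t S(1), of "\<lambda>s. s"] S(2) by (auto simp: Pi_iff)
      finally show "t \<in> U"
        unfolding U_def by (auto intro!: bexI[of _ "\<lambda>s. if t = s then \<one>\<^bsub>R\<^esub> else \<zero>\<^bsub>R\<^esub>"])
    qed
    ultimately have "U = carrier X" by (rule S)
    then have "\<forall>x\<in>carrier X. \<exists>c\<in>S \<rightarrow> carrier R. x = (\<Oplus>s\<in>S. c s \<odot> s)"
      unfolding U_def by auto
    then show ?L unfolding finitely_generated_def using S(1,2) by metis
  qed
qed

text \<open>
  A coordinate system on a finitely generated projective module. It describes projectivity within
  the module itself, without reference to test modules and their types.
\<close>

definition dual_basis ::
    "'r ring \<Rightarrow> ('r, 'x, 'l) module_scheme \<Rightarrow> nat \<Rightarrow> (nat \<Rightarrow> 'x) \<Rightarrow> (nat \<Rightarrow> 'x \<Rightarrow> 'r) \<Rightarrow> bool"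
  where "dual_basis R P n w \<phi> \<longleftrightarrow>
    (\<forall>i<n. w i \<in> carrier P \<and> \<phi> i \<in> left_hom R P (regular_bimodule R)) \<and>
    (\<forall>x\<in>carrier P. x = (\<Oplus>\<^bsub>P\<^esub>i\<in>{..<n}. \<phi> i x \<odot>\<^bsub>P\<^esub> w i))"

lemma functional_closed: "\<phi> \<in> left_hom R P (regular_bimodule R) \<Longrightarrow> x \<in> carrier P \<Longrightarrow> \<phi> x \<in> carrier R"
  using left_homD(1)[of \<phi> R P "regular_bimodule R" x] by simp

text \<open>
  For a dual basis \<open>\<phi>\<close>, this is the homomorphism that a choice of images \<open>u i\<close> for the basis vectors
  defines.
\<close>

lemma functional_combination_hom:
  fixes X (structure)
  assumes "left_module R P" "left_module R X"
    and \<phi>: "\<And>i. i < n \<Longrightarrow> \<phi> i \<in> left_hom R P (regular_bimodule R)"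
    and u: "\<And>i. i < n \<Longrightarrow> u i \<in> carrier X"
  shows "(\<lambda>x. \<Oplus>i\<in>{..<n::nat}. \<phi> i x \<odot> u i) \<in> left_hom R P X"
proof -
  interpret P: left_module R P by fact
  interpret X: left_module R X by fact
  note cl = functional_closed[OF \<phi>]
  have cl': "\<phi> i x \<odot> u i \<in> carrier X" if "i < n" "x \<in> carrier P" for i x
    using that cl u by (auto intro!: X.lsmult_closed)
  show ?thesis
    unfolding left_hom_iff
  proof (intro conjI ballI)
    fix x assume x: "x \<in> carrier P"
    show "(\<Oplus>i\<in>{..<n}. \<phi> i x \<odot> u i) \<in> carrier X"
      using cl' x by (auto intro!: X.finsum_closed)
    show "(\<Oplus>i\<in>{..<n}. \<phi> i (x \<oplus>\<^bsub>P\<^esub> y) \<odot> u i) =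
      (\<Oplus>i\<in>{..<n}. \<phi> i x \<odot> u i) \<oplus> (\<Oplus>i\<in>{..<n}. \<phi> i y \<odot> u i)"
      if y: "y \<in> carrier P" for y
    proof -
      have "(\<Oplus>i\<in>{..<n}. \<phi> i (x \<oplus>\<^bsub>P\<^esub> y) \<odot> u i) = (\<Oplus>i\<in>{..<n}. \<phi> i x \<odot> u i \<oplus> \<phi> i y \<odot> u i)"
        using x y cl cl' u left_homD(2)[OF \<phi>] by (intro X.finsum_cong') (auto simp: X.lsmult_l_distr)
      then show ?thesis using x y cl' by (simp add: X.finsum_addf Pi_iff)
    qed
    show "(\<Oplus>i\<in>{..<n}. \<phi> i (r \<odot>\<^bsub>P\<^esub> x) \<odot> u i) = r \<odot> (\<Oplus>i\<in>{..<n}. \<phi> i x \<odot> u i)"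
      if r: "r \<in> carrier R" for r
    proof -
      have "(\<Oplus>i\<in>{..<n}. \<phi> i (r \<odot>\<^bsub>P\<^esub> x) \<odot> u i) = (\<Oplus>i\<in>{..<n}. r \<odot> (\<phi> i x \<odot> u i))"
        using x r cl cl' u left_homD(3)[OF \<phi>]
        by (intro X.finsum_cong') (auto simp: X.lsmult_assoc X.lsmult_closed)
      then show ?thesis using x r cl' by (subst X.smult_finsum) auto
    qed
  qed
qed

lemma dual_basis_finitely_generated:
  fixes P (structure)
  assumes "left_module R P" "dual_basis R P n w \<phi>" shows "finitely_generated R P"
proof -
  interpret P: left_module R P by fact
  have w: "\<And>i. i < n \<Longrightarrow> w i \<in> carrier P" "\<And>i. i < n \<Longrightarrow> \<phi> i \<in> left_hom R P (regular_bimodule R)"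
    and sum: "\<And>x. x \<in> carrier P \<Longrightarrow> x = (\<Oplus>i\<in>{..<n}. \<phi> i x \<odot> w i)"
    using assms(2) unfolding dual_basis_def by blast+
  have "U = carrier P" if U: "left_submodule R P U" "w ` {..<n} \<subseteq> U" for U
  proof
    show "U \<subseteq> carrier P" using P.left_submoduleD(1)[OF U(1)] .
    show "carrier P \<subseteq> U"
    proof
      fix x assume x: "x \<in> carrier P"
      have "(\<Oplus>i\<in>{..<n}. \<phi> i x \<odot> w i) \<in> U"
        using U(2) functional_closed[OF w(2) x]
        by (intro P.left_submodule_finsum[OF U(1)] P.left_submoduleD(5)[OF U(1)]) auto
      then show "x \<in> U" using sum[OF x] by metis
    qed
  qed
  moreover have "finite (w ` {..<n})" "w ` {..<n} \<subseteq> carrier P" using w by auto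
  ultimately show ?thesis unfolding finitely_generated_iff[OF assms(1)] by metis
qed

text \<open>
  To lift \<open>h\<close> along \<open>p\<close>, lift only the values \<open>h (w i)\<close> and extend with the coordinate functionals.
\<close>

lemma dual_basis_projective:
  fixes R :: "'r ring"
  assumes "left_module R P" "dual_basis R P n w \<phi>" shows "projective R P"
  unfolding projective_def
proof (intro allI impI, elim conjE)
  fix U V :: "('r, (nat \<Rightarrow> 'r) set) module" and p h
  assume *: "fg_module R U" "fg_module R V" "p \<in> left_hom R U V" "p ` carrier U = carrier V"
    "h \<in> left_hom R P V"
  interpret P: left_module R P by fact
  interpret U: left_module R U using *(1) by (simp add: fg_module_def)
  interpret V: left_module R V using *(2) by (simp add: fg_module_def)
  have w: "\<And>i. i < n \<Longrightarrow> w i \<in> carrier P" "\<And>i. i < n \<Longrightarrow> \<phi> i \<in> left_hom R P (regular_bimodule R)"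
    and sum: "\<And>x. x \<in> carrier P \<Longrightarrow> x = (\<Oplus>\<^bsub>P\<^esub>i\<in>{..<n}. \<phi> i x \<odot>\<^bsub>P\<^esub> w i)"
    using assms(2) unfolding dual_basis_def by blast+
  have "\<forall>i<n. \<exists>u. u \<in> carrier U \<and> p u = h (w i)"
  proof (intro allI impI)
    fix i assume "i < n"
    then have "h (w i) \<in> p ` carrier U" using *(4) left_homD(1)[OF *(5)] w(1) by metis
    then show "\<exists>u. u \<in> carrier U \<and> p u = h (w i)" by auto
  qed
  then obtain u where u: "\<And>i. i < n \<Longrightarrow> u i \<in> carrier U" "\<And>i. i < n \<Longrightarrow> p (u i) = h (w i)" by metis
  let ?k = "\<lambda>x. \<Oplus>\<^bsub>U\<^esub>i\<in>{..<n}. \<phi> i x \<odot>\<^bsub>U\<^esub> u i"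
  have k: "?k \<in> left_hom R P U"
    by (rule functional_combination_hom[OF assms(1) U.left_module_axioms w(2) u(1)])
  have "p (?k x) = h x" if x: "x \<in> carrier P" for x
  proof -
    note cl = functional_closed[OF w(2) x]
    have "p (?k x) = (\<Oplus>\<^bsub>V\<^esub>i\<in>{..<n}. p (\<phi> i x \<odot>\<^bsub>U\<^esub> u i))"
      using cl u(1) by (intro left_hom_finsum[OF U.left_module_axioms V.left_module_axioms *(3)])
        (auto intro!: U.lsmult_closed)
    also have "\<dots> = (\<Oplus>\<^bsub>V\<^esub>i\<in>{..<n}. h (\<phi> i x \<odot>\<^bsub>P\<^esub> w i))"
      using cl u w left_homD[OF *(5)] left_homD[OF *(3)]
      by (intro V.finsum_cong') (auto simp: V.lsmult_closed)
    also have "\<dots> = h (\<Oplus>\<^bsub>P\<^esub>i\<in>{..<n}. \<phi> i x \<odot>\<^bsub>P\<^esub> w i)"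
      using cl w by (intro left_hom_finsum[OF P.left_module_axioms V.left_module_axioms *(5), symmetric])
        (auto intro!: P.lsmult_closed)
    finally show ?thesis using sum[OF x] by simp
  qed
  with k show "\<exists>k\<in>left_hom R P U. \<forall>x\<in>carrier P. p (k x) = h x" by (intro bexI[of _ ?k] ballI)
qed

lemma finitely_generated_surj_image:
  assumes "left_module R X" "left_module R Y" "f \<in> left_hom R X Y" "f ` carrier X = carrier Y"
    and "finitely_generated R X"
  shows "finitely_generated R Y"
proof -
  interpret X: left_module R X by fact
  interpret Y: left_module R Y by fact
  obtain S where S: "finite S" "S \<subseteq> carrier X"
    "\<And>U. left_submodule R X U \<Longrightarrow> S \<subseteq> U \<Longrightarrow> U = carrier X"
    using assms(5) unfolding finitely_generated_iff[OF assms(1)] by metis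
  have "U = carrier Y" if U: "left_submodule R Y U" "f ` S \<subseteq> U" for U
  proof
    show "U \<subseteq> carrier Y" using Y.left_submoduleD(1)[OF U(1)] .
    have "{x \<in> carrier X. f x \<in> U} = carrier X"
      using S(2) U(2) by (intro S(3) left_hom_vimage_submodule[OF assms(1-3) U(1)]) auto
    then show "carrier Y \<subseteq> U" unfolding assms(4)[symmetric] by auto
  qed
  moreover have "finite (f ` S)" "f ` S \<subseteq> carrier Y" using S(1,2) assms(4) by auto
  ultimately show ?thesis unfolding finitely_generated_iff[OF assms(2)] by metis
qed

text \<open>
  A copy of \<open>X\<close> on the type of the values of the injection \<open>\<rho>\<close>; it brings a module to the type over
  which the test modules in the definition of projectivity range.
\<close>

definition transport_module :: "('x \<Rightarrow> 'y) \<Rightarrow> ('r, 'x, 'l) module_scheme \<Rightarrow> ('r, 'y) module"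
  where "transport_module \<rho> X = (let \<rho>' = inv_into (carrier X) \<rho> in
    \<lparr>carrier = \<rho> ` carrier X, mult = undefined, one = undefined, ring.zero = \<rho> \<zero>\<^bsub>X\<^esub>,
     ring.add = (\<lambda>u v. \<rho> (\<rho>' u \<oplus>\<^bsub>X\<^esub> \<rho>' v)), smult = (\<lambda>r u. \<rho> (r \<odot>\<^bsub>X\<^esub> \<rho>' u))\<rparr>)"

lemma transport_module_hom:
  assumes "left_module R X" "inj_on \<rho> (carrier X)"
  shows "\<rho> \<in> left_hom R X (transport_module \<rho> X)"
    and "bij_betw \<rho> (carrier X) (carrier (transport_module \<rho> X))"
    and "left_module R (transport_module \<rho> X)"
proof -
  interpret X: left_module R X by fact
  show *: "\<rho> \<in> left_hom R X (transport_module \<rho> X)"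
    using assms(2) by (auto simp: left_hom_iff transport_module_def Let_def)
  show "bij_betw \<rho> (carrier X) (carrier (transport_module \<rho> X))"
    using assms(2) by (auto simp: transport_module_def bij_betw_def Let_def)
  show "left_module R (transport_module \<rho> X)"
    by (rule left_module_surj_image[OF assms(1) *]) (auto simp: transport_module_def Let_def)
qed

text \<open>
  Test modules may live on any type from which their carriers inject into the type of sets of functions
  \<open>nat \<Rightarrow> 'r\<close>: the lifting problem is conjugated with \<open>\<rho>\<close> and \<open>\<sigma>\<close>.
\<close>

lemma projective_lifting:
  fixes \<rho> :: "'x \<Rightarrow> (nat \<Rightarrow> 'r) set" and \<sigma> :: "'y \<Rightarrow> (nat \<Rightarrow> 'r) set"
  assumes "projective (R :: ('r, 'k) ring_scheme) P" "left_module R P" "fg_module R X" "fg_module R Y"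
    and "inj_on \<rho> (carrier X)" "inj_on \<sigma> (carrier Y)"
    and "p \<in> left_hom R X Y" "p ` carrier X = carrier Y" "h \<in> left_hom R P Y"
  shows "\<exists>k\<in>left_hom R P X. \<forall>x\<in>carrier P. p (k x) = h x"
proof -
  have X: "left_module R X" and Y: "left_module R Y" using assms(3,4) by (auto simp: fg_module_def)
  note \<rho> = transport_module_hom[OF X assms(5)] and \<sigma> = transport_module_hom[OF Y assms(6)]
  let ?U = "transport_module \<rho> X" and ?V = "transport_module \<sigma> Y"
  let ?\<rho>' = "inv_into (carrier X) \<rho>"
  have \<rho>': "?\<rho>' \<in> left_hom R ?U X" by (rule left_hom_inv_into[OF X \<rho>(1,2)])
  have im: "\<rho> ` carrier X = carrier ?U" "\<sigma> ` carrier Y = carrier ?V" "?\<rho>' ` carrier ?U = carrier X"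
    using \<rho>(2) \<sigma>(2) bij_betw_inv_into[OF \<rho>(2)] by (auto simp: bij_betw_def)
  have fg: "fg_module R ?U" "fg_module R ?V"
    using finitely_generated_surj_image[OF X \<rho>(3) \<rho>(1) im(1)]
      finitely_generated_surj_image[OF Y \<sigma>(3) \<sigma>(1) im(2)] assms(3,4) \<rho>(3) \<sigma>(3)
    by (auto simp: fg_module_def)
  let ?p = "\<lambda>u. \<sigma> (p (?\<rho>' u))"
  have p: "?p \<in> left_hom R ?U ?V"
    using left_hom_comp[OF left_hom_comp[OF \<rho>' assms(7)] \<sigma>(1)] .
  have "?p ` carrier ?U = \<sigma> ` p ` ?\<rho>' ` carrier ?U" by (simp add: image_image)
  then have p': "?p ` carrier ?U = carrier ?V" by (simp only: im assms(8))
  have h: "(\<lambda>x. \<sigma> (h x)) \<in> left_hom R P ?V"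
    using left_hom_comp[OF assms(9) \<sigma>(1)] .
  have "\<exists>k\<in>left_hom R P ?U. \<forall>x\<in>carrier P. ?p (k x) = \<sigma> (h x)"
    using assms(1)[unfolded projective_def] fg p p' h by blast
  then obtain k where k: "k \<in> left_hom R P ?U" "\<And>x. x \<in> carrier P \<Longrightarrow> ?p (k x) = \<sigma> (h x)"
    by blast
  have "p (?\<rho>' (k x)) = h x" if x: "x \<in> carrier P" for x
  proof (rule inj_onD[OF assms(6)])
    show "\<sigma> (p (?\<rho>' (k x))) = \<sigma> (h x)" using k(2)[OF x] .
    show "p (?\<rho>' (k x)) \<in> carrier Y"
      using left_homD(1)[OF assms(7)] left_homD(1)[OF \<rho>'] left_homD(1)[OF k(1)] x by metis
    show "h x \<in> carrier Y" using left_homD(1)[OF assms(9)] x by metis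
  qed
  then show ?thesis using left_hom_comp[OF k(1) \<rho>'] by (intro bexI[of _ "\<lambda>x. ?\<rho>' (k x)"]) auto
qed

definition free_module :: "'r ring \<Rightarrow> nat \<Rightarrow> ('r, nat \<Rightarrow> 'r) module"
  where "free_module R n =
    \<lparr>carrier = {f. (\<forall>i. f i \<in> carrier R) \<and> (\<forall>i\<ge>n. f i = \<zero>\<^bsub>R\<^esub>)}, mult = undefined, one = undefined,
     ring.zero = (\<lambda>i. \<zero>\<^bsub>R\<^esub>), ring.add = (\<lambda>f g i. f i \<oplus>\<^bsub>R\<^esub> g i), smult = (\<lambda>r f i. r \<otimes>\<^bsub>R\<^esub> f i)\<rparr>"

lemma free_module_left_module:
  assumes "ring R" shows "left_module R (free_module R n)"
proof -
  interpret ring R by fact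
  have "abelian_group (free_module R n)"
  proof (rule abelian_groupI)
    fix f assume "f \<in> carrier (free_module R n)"
    then show "\<exists>g\<in>carrier (free_module R n). g \<oplus>\<^bsub>free_module R n\<^esub> f = \<zero>\<^bsub>free_module R n\<^esub>"
      by (intro bexI[of _ "\<lambda>i. \<ominus>\<^bsub>R\<^esub> f i"]) (auto simp: free_module_def l_neg)
  qed (auto simp: free_module_def a_ac fun_eq_iff)
  then show ?thesis
    using assms by (auto simp: left_module_def left_module_axioms_def free_module_def l_distr r_distr m_assoc fun_eq_iff)
qed

lemma free_module_finitely_generated:
  assumes "ring R" shows "finitely_generated R (free_module R n)"
proof -
  interpret ring R by fact
  interpret F: left_module R "free_module R n" by (rule free_module_left_module[OF assms])
  let ?e = "\<lambda>k i. if i = k then \<one>\<^bsub>R\<^esub> else \<zero>\<^bsub>R\<^esub>"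
  have "U = carrier (free_module R n)"
    if U: "left_submodule R (free_module R n) U" "?e ` {..<n} \<subseteq> U" for U
  proof
    show "U \<subseteq> carrier (free_module R n)" using F.left_submoduleD(1)[OF U(1)] .
    have "f \<in> U" if "k \<le> n" "f \<in> carrier (free_module R n)" "\<And>i. i \<ge> k \<Longrightarrow> f i = \<zero>\<^bsub>R\<^esub>" for f k
      using that
    proof (induction k arbitrary: f)
      case 0
      then have "f = \<zero>\<^bsub>free_module R n\<^esub>" by (auto simp: free_module_def)
      then show ?case using F.left_submoduleD(2)[OF U(1)] by simp
    next
      case (Suc k)
      let ?g = "f(k := \<zero>\<^bsub>R\<^esub>)"
      have fk: "\<And>i. f i \<in> carrier R" using Suc.prems by (auto simp: free_module_def)
      have "?g \<in> U"
      proof (rule Suc.IH)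
        show "?g i = \<zero>\<^bsub>R\<^esub>" if "i \<ge> k" for i
          using that Suc.prems(3)[of i] by (cases "i = k") auto
      qed (use Suc.prems in \<open>auto simp: free_module_def\<close>)
      moreover have "f k \<odot>\<^bsub>free_module R n\<^esub> ?e k \<in> U"
        using U(2) Suc.prems fk by (intro F.left_submoduleD(5)[OF U(1)]) auto
      ultimately have "?g \<oplus>\<^bsub>free_module R n\<^esub> f k \<odot>\<^bsub>free_module R n\<^esub> ?e k \<in> U"
        by (rule F.left_submoduleD(4)[OF U(1)])
      also have "?g \<oplus>\<^bsub>free_module R n\<^esub> f k \<odot>\<^bsub>free_module R n\<^esub> ?e k = f"
        using fk by (auto simp: free_module_def)
      finally show ?case .
    qed
    then show "carrier (free_module R n) \<subseteq> U" by (auto simp: free_module_def)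
  qed
  moreover have "finite (?e ` {..<n})" "?e ` {..<n} \<subseteq> carrier (free_module R n)"
    by (auto simp: free_module_def)
  ultimately show ?thesis unfolding finitely_generated_iff[OF F.left_module_axioms] by metis
qed

lemma finitely_generated_sequence:
  fixes X (structure)
  assumes "left_module R X" "finitely_generated R X"
  shows "\<exists>(n :: nat) w. (\<forall>i<n. w i \<in> carrier X) \<and> (\<forall>x\<in>carrier X. \<exists>c.
    (\<forall>i<n. c i \<in> carrier R) \<and> x = (\<Oplus>i\<in>{..<n}. c i \<odot> w i))"
proof -
  interpret X: left_module R X by fact
  obtain S where S: "finite S" "S \<subseteq> carrier X"
    "\<And>x. x \<in> carrier X \<Longrightarrow> \<exists>c\<in>S \<rightarrow> carrier R. x = (\<Oplus>s\<in>S. c s \<odot> s)"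
    using assms(2) unfolding finitely_generated_def by metis
  obtain w where w: "bij_betw w {..<card S} S"
    using ex_bij_betw_nat_finite[OF S(1)] by (auto simp: atLeast0LessThan)
  then have wS: "w i \<in> S" if "i < card S" for i using that by (auto simp: bij_betw_def)
  have "\<exists>c'. (\<forall>i<card S. c' i \<in> carrier R) \<and> x = (\<Oplus>i\<in>{..<card S}. c' i \<odot> w i)"
    if x: "x \<in> carrier X" for x
  proof -
    obtain c where c: "c \<in> S \<rightarrow> carrier R" "x = (\<Oplus>s\<in>S. c s \<odot> s)" using S(3)[OF x] by metis
    have "x = (\<Oplus>i\<in>{..<card S}. c (w i) \<odot> w i)"
    proof -
      have im: "w ` {..<card S} = S" and inj: "inj_on w {..<card S}" using w by (auto simp: bij_betw_def)
      have "(\<lambda>s. c s \<odot> s) \<in> w ` {..<card S} \<rightarrow> carrier X"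
        unfolding im using c(1) S(2) by (auto intro!: X.lsmult_closed)
      from X.finsum_reindex[OF this inj] show ?thesis unfolding c(2) im .
    qed
    then show ?thesis using c(1) wS by (intro exI[of _ "\<lambda>i. c (w i)"]) auto
  qed
  with wS S(2) show ?thesis by (intro exI[of _ "card S"] exI[of _ w] conjI) auto
qed

text \<open>
  Lift the identity of \<open>P\<close> along an epimorphism from a free module \<open>R\<^sup>n\<close>; the components of the lift are
  the coordinate functionals. As a test module, \<open>P\<close> is represented by the fibres of the epimorphism,
  which are sets of functions.
\<close>

lemma projective_dual_basis:
  fixes P (structure)
  assumes "projective R P" "fg_module R P"
  obtains n w \<phi> where "dual_basis R P n w \<phi>"
proof -
  have P: "left_module R P" "finitely_generated R P" using assms(2) by (auto simp: fg_module_def)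
  interpret P: left_module R P by fact
  obtain n :: nat and w where w: "\<And>i. i < n \<Longrightarrow> w i \<in> carrier P"
    "\<And>x. x \<in> carrier P \<Longrightarrow> \<exists>c. (\<forall>i<n. c i \<in> carrier R) \<and> x = (\<Oplus>i\<in>{..<n}. c i \<odot> w i)"
    using finitely_generated_sequence[OF P] by metis
  let ?F = "free_module R n"
  note F = free_module_left_module[OF P.R.ring_axioms, of n]
  interpret F: left_module R ?F by (rule F)
  let ?p = "\<lambda>f. \<Oplus>i\<in>{..<n}. f i \<odot> w i"
  have ev: "(\<lambda>f. f i) \<in> left_hom R ?F (regular_bimodule R)" for i
    by (auto simp: left_hom_iff free_module_def)
  have p: "?p \<in> left_hom R ?F P"
    using functional_combination_hom[OF F P(1) ev w(1)] .
  have surj: "?p ` carrier ?F = carrier P"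
  proof
    show "?p ` carrier ?F \<subseteq> carrier P" using left_homD(1)[OF p] by auto
    show "carrier P \<subseteq> ?p ` carrier ?F"
    proof
      fix x assume "x \<in> carrier P"
      then obtain c where c: "\<forall>i<n. c i \<in> carrier R" "x = (\<Oplus>i\<in>{..<n}. c i \<odot> w i)"
        using w(2) by metis
      let ?f = "\<lambda>i. if i < n then c i else \<zero>\<^bsub>R\<^esub>"
      have "x = ?p ?f"
        unfolding c(2) using c(1) w(1) by (intro P.finsum_cong') (auto intro!: P.lsmult_closed)
      moreover have "?f \<in> carrier ?F" using c(1) by (auto simp: free_module_def)
      ultimately show "x \<in> ?p ` carrier ?F" by (rule image_eqI)
    qed
  qed
  \<comment> \<open>Nonempty fibres determine the point over which they lie.\<close>
  have inj: "inj_on (\<lambda>x. {f \<in> carrier ?F. ?p f = x}) (carrier P)"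
  proof (rule inj_onI)
    fix x y assume "x \<in> carrier P" and eq: "{f \<in> carrier ?F. ?p f = x} = {f \<in> carrier ?F. ?p f = y}"
    then have "x \<in> ?p ` carrier ?F" using surj by simp
    then obtain f where "x = ?p f" "f \<in> carrier ?F" by (rule imageE)
    then have "f \<in> {f \<in> carrier ?F. ?p f = x}" by simp
    then show "x = y" unfolding eq using \<open>x = ?p f\<close> by simp
  qed
  have "\<exists>k\<in>left_hom R P ?F. \<forall>x\<in>carrier P. ?p (k x) = x"
  proof (rule projective_lifting[OF assms(1) P(1) _ assms(2) _ inj p surj])
    show "fg_module R ?F"
      using F free_module_finitely_generated[OF P.R.ring_axioms] by (simp add: fg_module_def)
    show "inj_on (\<lambda>f. {f}) (carrier ?F)" by (simp add: inj_on_def)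
    show "(\<lambda>x. x) \<in> left_hom R P P" by (simp add: left_hom_iff)
  qed
  then obtain k where k: "k \<in> left_hom R P ?F" "\<And>x. x \<in> carrier P \<Longrightarrow> ?p (k x) = x" by blast
  have "(\<lambda>x. k x i) \<in> left_hom R P (regular_bimodule R)" for i
    using left_hom_comp[OF k(1) ev] .
  then have "dual_basis R P n w (\<lambda>i x. k x i)"
    using w(1) k(2) by (auto simp: dual_basis_def)
  then show ?thesis by (rule that)
qed

lemma indecomposable_projective_iff:
  "indecomposable_projective R P \<longleftrightarrow>
     left_module R P \<and> indecomposable R P \<and> (\<exists>n w \<phi>. dual_basis R P n w \<phi>)"
  unfolding indecomposable_projective_def fg_module_def
  using dual_basis_finitely_generated dual_basis_projective projective_dual_basis fg_module_def
  by metis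

section \<open>Artinian modules\<close>

text \<open>
  The descending chain condition for the submodules contained in \<open>W\<close>. The bound \<open>W\<close> is variable
  because finitely generated modules are treated by enlarging it one generator at a time.
\<close>

definition artinian_below :: "('r, 'k) ring_scheme \<Rightarrow> ('r, 'x, 'l) module_scheme \<Rightarrow> 'x set \<Rightarrow> bool"
  where "artinian_below R X W \<longleftrightarrow>
    wf {(U, V). left_submodule R X U \<and> left_submodule R X V \<and> U \<subset> V \<and> V \<subseteq> W}"

lemma artinian_below_minimal:
  assumes "artinian_below R X W" "left_submodule R X U" "U \<subseteq> W" "Q U"
  obtains V where "left_submodule R X V" "V \<subseteq> U" "Q V"
    and "\<And>V'. left_submodule R X V' \<Longrightarrow> V' \<subseteq> V \<Longrightarrow> Q V' \<Longrightarrow> V' = V"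
proof -
  let ?F = "{V. left_submodule R X V \<and> V \<subseteq> U \<and> Q V}"
  have "U \<in> ?F" using assms by simp
  with assms(1)[unfolded artinian_below_def] show thesis
  proof (rule wfE_min)
    fix V assume V: "V \<in> ?F" and min: "\<And>V'. (V', V) \<in> {(U, V). left_submodule R X U \<and>
      left_submodule R X V \<and> U \<subset> V \<and> V \<subseteq> W} \<Longrightarrow> V' \<notin> ?F"
    show thesis
    proof (rule that)
      show "left_submodule R X V" "V \<subseteq> U" "Q V" using V by auto
      fix V' assume "left_submodule R X V'" "V' \<subseteq> V" "Q V'"
      then show "V' = V" using V min[of V'] assms(3) by auto
    qed
  qed
qed

lemma artinian_ring_regular:
  assumes "artinian_cring R"
  shows "artinian_below R (regular_bimodule R) (carrier R)"
  unfolding artinian_below_def wf_iff_no_infinite_down_chain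
proof (rule notI, elim exE)
  fix I assume I: "\<forall>i. (I (Suc i), I i) \<in> {(U, V). left_submodule R (regular_bimodule R) U \<and>
    left_submodule R (regular_bimodule R) V \<and> U \<subset> V \<and> V \<subseteq> carrier R}"
  interpret cring R using assms by (simp add: artinian_cring_def)
  interpret reg: left_module R "regular_bimodule R" by (rule regular_module[OF ring_axioms])
  have "ideal (I n) R" for n
  proof (rule idealI)
    have sub: "left_submodule R (regular_bimodule R) (I n)" using I by auto
    note D = reg.left_submoduleD[OF sub]
    show sg: "subgroup (I n) (add_monoid R)"
    proof (rule add.subgroupI)
      fix a assume a: "a \<in> I n"
      then have "(\<ominus>\<^bsub>R\<^esub> \<one>\<^bsub>R\<^esub>) \<otimes>\<^bsub>R\<^esub> a \<in> I n" using D(5)[of "\<ominus>\<^bsub>R\<^esub> \<one>\<^bsub>R\<^esub>" a] by simp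
      then show "\<ominus>\<^bsub>R\<^esub> a \<in> I n" using D(3)[OF a] by (simp add: l_minus)
    qed (use D in auto)
    fix a x assume a: "a \<in> I n" and x: "x \<in> carrier R"
    show "x \<otimes>\<^bsub>R\<^esub> a \<in> I n" using sub a x by (auto simp: left_submodule_def)
    moreover have "a \<in> carrier R" using subgroup.subset[OF sg] a by auto
    ultimately show "a \<otimes>\<^bsub>R\<^esub> x \<in> I n" using x m_comm by metis
  qed (rule ring_axioms)
  moreover have "I (Suc n) \<subseteq> I n" for n using I by auto
  ultimately obtain n where "\<forall>k\<ge>n. I k = I n"
    using assms unfolding artinian_cring_def by metis
  then have "I (Suc n) = I n" using le_SucI[OF order_refl[of n]] by metis
  moreover have "I (Suc n) \<subset> I n" using I by auto
  ultimately show False by simp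
qed

text \<open>
  A submodule \<open>V\<close> of \<open>W + R y\<close> is governed by two invariants: the submodule \<open>V \<inter> W\<close> and the left ideal of
  all \<open>r\<close> with \<open>r y \<in> W + V\<close>. Both are monotone in \<open>V\<close>, and submodules \<open>U \<subseteq> V\<close> with the same invariants
  coincide. Hence strict inclusion is carried into a lexicographic product of two well-founded
  relations.
\<close>

lemma artinian_below_add_cyclic:
  fixes X (structure)
  assumes "left_module R X" "artinian_below R (regular_bimodule R) (carrier R)"
    and W: "left_submodule R X W" "artinian_below R X W" and y: "y \<in> carrier X"
  shows "artinian_below R X (W <+>\<^bsub>X\<^esub> cyclic R X y)"
proof -
  interpret X: left_module R X by fact
  let ?Y = "W <+>\<^bsub>X\<^esub> cyclic R X y"
  let ?I = "\<lambda>V. {r \<in> carrier (regular_bimodule R). r \<odot> y \<in> W <+>\<^bsub>X\<^esub> V}"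
  let ?r1 = "{(U, V). left_submodule R (regular_bimodule R) U \<and> left_submodule R (regular_bimodule R) V \<and>
      U \<subset> V \<and> V \<subseteq> carrier R}"
  let ?r2 = "{(U, V). left_submodule R X U \<and> left_submodule R X V \<and> U \<subset> V \<and> V \<subseteq> W}"
  note reg = regular_module[OF X.R.ring_axioms] and Wc = X.left_submoduleD[OF W(1)]
  have ev: "(\<lambda>r. r \<odot> y) \<in> left_hom R (regular_bimodule R) X"
    using y by (simp add: left_hom_iff X.lsmult_closed X.lsmult_l_distr X.lsmult_assoc)
  have I: "left_submodule R (regular_bimodule R) (?I V)" if V: "left_submodule R X V" for V
    by (rule left_hom_vimage_submodule[OF reg assms(1) ev X.sum_submodule[OF W(1) V]])
  have key: "U = V"
    if UV: "left_submodule R X U" "left_submodule R X V" "U \<subseteq> V" "V \<subseteq> ?Y"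
      and eqI: "?I U = ?I V" and eqW: "U \<inter> W = V \<inter> W" for U V
  proof
    note Uc = X.left_submoduleD[OF UV(1)] and Vc = X.left_submoduleD[OF UV(2)]
    show "V \<subseteq> U"
    proof
      fix v assume v: "v \<in> V"
      then have "v \<in> ?Y" using UV(4) by auto
      then obtain w r where r: "w \<in> W" "r \<in> carrier R" "v = w \<oplus> r \<odot> y"
        by (auto simp: X.mem_set_add)
      have ry: "r \<odot> y \<in> carrier X" using r y by (simp add: X.lsmult_closed)
      have "\<ominus> w \<in> W"
        using X.left_submodule_minus[OF W(1) Wc(2) r(1)] Wc(3)[OF r(1)] by (simp add: a_minus_def)
      moreover have "r \<odot> y = \<ominus> w \<oplus> v"
        unfolding r(3) using ry Wc(3)[OF r(1)] by (simp add: X.a_assoc[symmetric] X.l_neg)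
      ultimately have "r \<odot> y \<in> W <+>\<^bsub>X\<^esub> V" unfolding X.mem_set_add using v by metis
      then have "r \<in> ?I V" using r(2) by simp
      then have "r \<in> ?I U" using eqI by simp
      then obtain w' u where u: "w' \<in> W" "u \<in> U" "r \<odot> y = w' \<oplus> u" by (auto simp: X.mem_set_add)
      have uV: "u \<in> V" using u(2) UV(3) by auto
      have ww: "w \<oplus> w' \<in> W" by (rule Wc(4)[OF r(1) u(1)])
      have v_eq: "v = u \<oplus> (w \<oplus> w')"
        unfolding r(3) u(3) using Wc(3)[OF r(1)] Wc(3)[OF u(1)] Uc(3)[OF u(2)] by (simp add: X.a_ac)
      have "w \<oplus> w' \<in> V"
        using X.left_submodule_add_left[OF UV(2) uV Wc(3)[OF ww]] v v_eq by metis
      then have "w \<oplus> w' \<in> U" using ww eqW by blast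
      then show "v \<in> U" unfolding v_eq by (rule Uc(4)[OF u(2)])
    qed
  qed (use UV in auto)
  have mono: "W <+>\<^bsub>X\<^esub> U \<subseteq> W <+>\<^bsub>X\<^esub> V" if "U \<subseteq> V" for U V
    using that unfolding subset_iff X.mem_set_add by metis
  have neq: "?I U \<subset> ?I V \<or> ?I U = ?I V \<and> U \<inter> W \<subset> V \<inter> W"
    if "left_submodule R X U" "left_submodule R X V" "U \<subset> V" "V \<subseteq> ?Y" for U V
  proof -
    have sub: "U \<subseteq> V" using that(3) by (rule psubset_imp_subset)
    have "?I U \<subseteq> ?I V" "U \<inter> W \<subseteq> V \<inter> W" using sub mono[OF sub] by auto
    moreover have "\<not> (?I U = ?I V \<and> U \<inter> W = V \<inter> W)"
    proof (rule notI, elim conjE)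
      assume "?I U = ?I V" "U \<inter> W = V \<inter> W"
      from key[OF that(1,2) sub that(4) this] show False using that(3) by simp
    qed
    ultimately show ?thesis unfolding psubset_eq by meson
  qed
  have "wf (inv_image (?r1 <*lex*> ?r2) (\<lambda>V. (?I V, V \<inter> W)))"
    using assms(2) W(2) unfolding artinian_below_def by (intro wf_inv_image wf_lex_prod)
  then show ?thesis
    unfolding artinian_below_def
  proof (rule wf_subset, intro subrelI, unfold mem_Collect_eq case_prod_conv, elim conjE)
    fix U V
    assume UV: "left_submodule R X U" "left_submodule R X V" "V \<subseteq> ?Y" and "U \<subset> V"
    from neq[OF UV(1,2) \<open>U \<subset> V\<close> UV(3)]
    show "(U, V) \<in> inv_image (?r1 <*lex*> ?r2) (\<lambda>V. (?I V, V \<inter> W))"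
    proof (elim disjE conjE)
      assume "?I U \<subset> ?I V"
      then show ?thesis using I[OF UV(1)] I[OF UV(2)] by (auto simp: in_lex_prod in_inv_image)
    next
      assume "?I U = ?I V" "U \<inter> W \<subset> V \<inter> W"
      then show ?thesis
        using X.Int_submodule[OF UV(1) W(1)] X.Int_submodule[OF UV(2) W(1)]
        by (simp add: in_lex_prod in_inv_image)
    qed
  qed
qed

lemma finitely_generated_artinian:
  assumes X: "left_module R X" and R: "artinian_below R (regular_bimodule R) (carrier R)"
    and "finitely_generated R X"
  shows "artinian_below R X (carrier X)"
proof -
  interpret X: left_module R X by fact
  obtain S where S: "finite S" "S \<subseteq> carrier X"
    and gen: "\<And>U. left_submodule R X U \<Longrightarrow> S \<subseteq> U \<Longrightarrow> U = carrier X"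
    using assms(3) unfolding finitely_generated_iff[OF X] by metis
  from S have "\<exists>W. left_submodule R X W \<and> S \<subseteq> W \<and> artinian_below R X W"
  proof induction
    case empty
    have "\<not> (left_submodule R X U \<and> left_submodule R X V \<and> U \<subset> V \<and> V \<subseteq> {\<zero>\<^bsub>X\<^esub>})" for U V
      using X.left_submoduleD(2)[of U] by auto
    then have "{(U, V). left_submodule R X U \<and> left_submodule R X V \<and> U \<subset> V \<and> V \<subseteq> {\<zero>\<^bsub>X\<^esub>}} = {}"
      by simp
    then have "artinian_below R X {\<zero>\<^bsub>X\<^esub>}" unfolding artinian_below_def by (simp only: wf_on_bot)
    then show ?case using X.zero_submodule by (intro exI[of _ "{\<zero>\<^bsub>X\<^esub>}"]) auto
  next
    case (insert y S)
    then obtain W where W: "left_submodule R X W" "S \<subseteq> W" "artinian_below R X W" by auto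
    have y: "y \<in> carrier X" using insert by simp
    let ?W = "W <+>\<^bsub>X\<^esub> cyclic R X y"
    have "W \<subseteq> ?W" "y \<in> ?W" using X.subset_add_cyclic[OF W(1) y] by auto
    then show ?case
      using artinian_below_add_cyclic[OF X R W(1,3) y] X.sum_submodule[OF W(1) X.cyclic_submodule[OF y]] W(2)
      by (intro exI[of _ ?W]) auto
  qed
  then show ?thesis using gen by metis
qed

text \<open>
  Left ideals of \<open>L\<close> are \<open>R\<close>-submodules of \<open>L\<close>, and \<open>L\<close> is finitely generated over an artinian ring.
\<close>

lemma artin_algebra_artinian:
  fixes R :: "'r ring"
  assumes "artin_algebra R \<iota> L"
  shows "artinian_below L (regular_bimodule L) (carrier L)"
proof -
  let ?X = "ring.extend L (module.fields (\<lambda>r x. \<iota> r \<otimes>\<^bsub>L\<^esub> x))"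
  have R: "artinian_cring R" and \<iota>: "\<iota> \<in> ring_hom R L" and fg: "finitely_generated R ?X"
    using assms by (auto simp: artin_algebra_def)
  interpret L: ring L using assms by (simp add: artin_algebra_def)
  interpret R: cring R using R by (simp add: artinian_cring_def)
  have [simp]: "carrier ?X = carrier L" "ring.zero ?X = \<zero>\<^bsub>L\<^esub>" "ring.add ?X = (\<oplus>\<^bsub>L\<^esub>)"
    "smult ?X = (\<lambda>r x. \<iota> r \<otimes>\<^bsub>L\<^esub> x)"
    by (simp_all add: ring.defs module.defs)
  have "abelian_group ?X"
    by (rule abelian_groupI) (auto simp: L.a_ac intro: L.l_neg)
  moreover have "left_module_axioms R ?X"
    using ring_hom_memE[OF \<iota>] by unfold_locales (auto simp: L.l_distr L.r_distr L.m_assoc)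
  ultimately have X: "left_module R ?X" using R.ring_axioms by (simp add: left_module_def)
  interpret X: left_module R ?X by (rule X)
  interpret reg: left_module L "regular_bimodule L" by (rule regular_module[OF L.ring_axioms])
  have "left_submodule R ?X U" if "left_submodule L (regular_bimodule L) U" for U
    using reg.left_submoduleD[OF that] ring_hom_memE(1)[OF \<iota>] by (auto simp: X.left_submodule_iff)
  then have "{(U, V). left_submodule L (regular_bimodule L) U \<and> left_submodule L (regular_bimodule L) V \<and> U \<subset> V \<and> V \<subseteq> carrier L}
    \<subseteq> {(U, V). left_submodule R ?X U \<and> left_submodule R ?X V \<and> U \<subset> V \<and> V \<subseteq> carrier ?X}"
    by auto
  then show ?thesis
    using finitely_generated_artinian[OF X artinian_ring_regular[OF R] fg]
    unfolding artinian_below_def by (rule wf_subset[rotated])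
qed

section \<open>Indecomposable projective modules over artinian rings\<close>

text \<open>
  Split every basis vector as \<open>w i = u i + v i\<close> and use the two parts as new values. As the sum \<open>U + V\<close>
  may fail to be direct, \<open>f\<close> and \<open>e\<close> are in general not idempotent.
\<close>

lemma dual_basis_projections:
  fixes Z (structure)
  assumes "left_module L Z" "dual_basis L Z n w \<phi>"
    and U: "left_submodule L Z U" and V: "left_submodule L Z V" and UV: "U <+>\<^bsub>Z\<^esub> V = carrier Z"
  obtains f e where "f \<in> left_hom L Z Z" "e \<in> left_hom L Z Z"
    and "\<And>z. z \<in> carrier Z \<Longrightarrow> f z \<in> U" "\<And>z. z \<in> carrier Z \<Longrightarrow> e z \<in> V"
    and "\<And>z. z \<in> carrier Z \<Longrightarrow> z = f z \<oplus> e z"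
proof -
  interpret Z: left_module L Z by fact
  have w: "\<And>i. i < n \<Longrightarrow> w i \<in> carrier Z" "\<And>i. i < n \<Longrightarrow> \<phi> i \<in> left_hom L Z (regular_bimodule L)"
    and sum: "\<And>x. x \<in> carrier Z \<Longrightarrow> x = (\<Oplus>i\<in>{..<n}. \<phi> i x \<odot> w i)"
    using assms(2) unfolding dual_basis_def by blast+
  have "\<forall>i<n. \<exists>u v. u \<in> U \<and> v \<in> V \<and> w i = u \<oplus> v"
    using w(1) UV Z.mem_set_add by metis
  then obtain u v where uv: "\<And>i. i < n \<Longrightarrow> u i \<in> U" "\<And>i. i < n \<Longrightarrow> v i \<in> V"
    "\<And>i. i < n \<Longrightarrow> w i = u i \<oplus> v i" by metis
  have uvc: "\<And>i. i < n \<Longrightarrow> u i \<in> carrier Z" "\<And>i. i < n \<Longrightarrow> v i \<in> carrier Z"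
    using uv Z.left_submoduleD(3)[OF U] Z.left_submoduleD(3)[OF V] by auto
  let ?f = "\<lambda>z. \<Oplus>i\<in>{..<n}. \<phi> i z \<odot> u i" and ?e = "\<lambda>z. \<Oplus>i\<in>{..<n}. \<phi> i z \<odot> v i"
  note cl = functional_closed[OF w(2)]
  show thesis
  proof (rule that)
    show "?f \<in> left_hom L Z Z" "?e \<in> left_hom L Z Z"
      by (rule functional_combination_hom[OF assms(1,1) w(2)]; use uvc in auto)+
    fix z assume z: "z \<in> carrier Z"
    show "?f z \<in> U"
      using cl z uv by (intro Z.left_submodule_finsum[OF U] Z.left_submoduleD(5)[OF U]) auto
    show "?e z \<in> V"
      using cl z uv by (intro Z.left_submodule_finsum[OF V] Z.left_submoduleD(5)[OF V]) auto
    have "z = (\<Oplus>i\<in>{..<n}. \<phi> i z \<odot> w i)" by (rule sum[OF z])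
    also have "\<dots> = (\<Oplus>i\<in>{..<n}. \<phi> i z \<odot> u i \<oplus> \<phi> i z \<odot> v i)"
      using cl z uv uvc by (intro Z.finsum_cong') (auto simp: Z.lsmult_r_distr Z.lsmult_closed)
    also have "\<dots> = ?f z \<oplus> ?e z"
      using cl z uvc by (intro Z.finsum_addf) (auto simp: Z.lsmult_closed)
    finally show "z = ?f z \<oplus> ?e z" .
  qed
qed

text \<open>
  Since \<open>v = f v + e v\<close> for \<open>v \<in> V\<close>, also \<open>U + e(V)\<close> is everything, and minimality of \<open>V\<close> gives
  \<open>e(V) = V\<close>. Thus every \<open>e z\<close> is some \<open>e v\<close>, and \<open>z - v\<close> lies in the kernel of \<open>e\<close>. On this kernel
  \<open>z = f z \<in> U\<close>.
\<close>

lemma minimal_supplement: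
  fixes Z (structure)
  assumes "left_module L Z" "left_submodule L Z U" "left_submodule L Z V"
    and UV: "U <+>\<^bsub>Z\<^esub> V = carrier Z"
    and min: "\<And>W. left_submodule L Z W \<Longrightarrow> W \<subseteq> V \<Longrightarrow> U <+>\<^bsub>Z\<^esub> W = carrier Z \<Longrightarrow> W = V"
    and fe: "f \<in> left_hom L Z Z" "e \<in> left_hom L Z Z" "\<And>z. z \<in> carrier Z \<Longrightarrow> f z \<in> U"
      "\<And>z. z \<in> carrier Z \<Longrightarrow> e z \<in> V" "\<And>z. z \<in> carrier Z \<Longrightarrow> z = f z \<oplus> e z"
  shows "{z \<in> carrier Z. e z = \<zero>} \<subseteq> U"
    and "{z \<in> carrier Z. e z = \<zero>} <+>\<^bsub>Z\<^esub> V = carrier Z"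
proof -
  interpret Z: left_module L Z by fact
  note U = Z.left_submoduleD[OF assms(2)] and V = Z.left_submoduleD[OF assms(3)]
  note f = left_homD[OF fe(1)] and e = left_homD[OF fe(2)]
  have eV: "left_submodule L Z (e ` V)"
    by (rule left_hom_image_submodule[OF assms(1,1) fe(2) assms(3)])
  have "e ` V = V"
  proof (rule min[OF eV])
    show "e ` V \<subseteq> V" using V(3) fe(4) by auto
    show "U <+>\<^bsub>Z\<^esub> e ` V = carrier Z"
    proof
      show "U <+>\<^bsub>Z\<^esub> e ` V \<subseteq> carrier Z"
        using Z.left_submoduleD(1)[OF Z.sum_submodule[OF assms(2) eV]] .
      show "carrier Z \<subseteq> U <+>\<^bsub>Z\<^esub> e ` V"
      proof
        fix z assume "z \<in> carrier Z"
        then obtain u v where uv: "u \<in> U" "v \<in> V" "z = u \<oplus> v" using UV Z.mem_set_add by metis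
        have "z = u \<oplus> (f v \<oplus> e v)" using uv fe(5) V(3) by metis
        also have "\<dots> = (u \<oplus> f v) \<oplus> e v"
          using uv U(3) V(3) f(1) e(1) by (simp add: Z.a_assoc)
        finally show "z \<in> U <+>\<^bsub>Z\<^esub> e ` V"
          using uv U(4) fe(3) V(3) unfolding Z.mem_set_add by (metis imageI)
      qed
    qed
  qed
  show "{z \<in> carrier Z. e z = \<zero>} \<subseteq> U"
  proof safe
    fix z assume "z \<in> carrier Z" "e z = \<zero>"
    then have "z = f z \<oplus> \<zero>" "f z \<in> U" "f z \<in> carrier Z" using fe(3,5) f(1) by metis+
    then show "z \<in> U" by simp
  qed
  show "{z \<in> carrier Z. e z = \<zero>} <+>\<^bsub>Z\<^esub> V = carrier Z"
  proof
    show "{z \<in> carrier Z. e z = \<zero>} <+>\<^bsub>Z\<^esub> V \<subseteq> carrier Z"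
      using V(3) by (auto simp: Z.mem_set_add)
    show "carrier Z \<subseteq> {z \<in> carrier Z. e z = \<zero>} <+>\<^bsub>Z\<^esub> V"
    proof
      fix z assume z: "z \<in> carrier Z"
      then have "e z \<in> e ` V" using fe(4) \<open>e ` V = V\<close> by simp
      then obtain v where v: "e z = e v" "v \<in> V" by (rule imageE)
      have "e (z \<ominus> v) \<oplus> e v = e (z \<ominus> v \<oplus> v)"
        using z v V(3) by (subst e(2)) auto
      also have "z \<ominus> v \<oplus> v = z"
        using z v V(3) by (simp add: a_minus_def Z.a_assoc Z.l_neg)
      finally have "e (z \<ominus> v) = \<zero>"
        using z v V(3) e(1) by (simp add: Z.add.r_cancel_one)
      moreover have "z = (z \<ominus> v) \<oplus> v" "z \<ominus> v \<in> carrier Z"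
        using z v V(3) by (simp_all add: a_minus_def Z.a_assoc Z.l_neg)
      ultimately show "z \<in> {z \<in> carrier Z. e z = \<zero>} <+>\<^bsub>Z\<^esub> V"
        unfolding Z.mem_set_add using v(2) by (intro bexI[of _ "z \<ominus> v"] bexI[of _ v]) auto
    qed
  qed
qed

definition hollow :: "('r, 'k) ring_scheme \<Rightarrow> ('r, 'x, 'l) module_scheme \<Rightarrow> bool"
  where "hollow R X \<longleftrightarrow> carrier X \<noteq> {\<zero>\<^bsub>X\<^esub>} \<and>
    (\<forall>U V. left_submodule R X U \<longrightarrow> left_submodule R X V \<longrightarrow> U <+>\<^bsub>X\<^esub> V = carrier X \<longrightarrow>
      U = carrier X \<or> V = carrier X)"

lemma hollowD:
  assumes "hollow R X"
  shows "carrier X \<noteq> {\<zero>\<^bsub>X\<^esub>}"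
    and "\<lbrakk>left_submodule R X U; left_submodule R X V; U <+>\<^bsub>X\<^esub> V = carrier X\<rbrakk> \<Longrightarrow>
      U = carrier X \<or> V = carrier X"
  using assms unfolding hollow_def by blast+

text \<open>
  No proper submodules \<open>U\<close> and \<open>V\<close> can span \<open>Z\<close>. By the chain condition both can be shrunk until they are
  minimal with sum \<open>Z\<close>. For the two endomorphisms \<open>f\<close> and \<open>e\<close> adapted to the sum, minimality turns
  the kernel of \<open>e\<close> into \<open>U\<close> and the kernel of \<open>f\<close> into \<open>V\<close>. An element of both is
  \<open>z = f z + e z = 0\<close>, so the sum is direct and one summand vanishes. This takes the place of
  the Krull-Schmidt theorem.
\<close>

lemma indecomposable_projective_hollow:
  fixes Z (structure)
  assumes Z: "left_module L Z" and db: "dual_basis L Z n w \<phi>" and ind: "indecomposable L Z"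
    and art: "artinian_below L Z (carrier Z)"
  shows "hollow L Z"
  unfolding hollow_def
proof (intro conjI allI impI)
  show "carrier Z \<noteq> {\<zero>}" by (rule indecomposableD(1)[OF ind])
  fix U V
  assume U: "left_submodule L Z U" and V: "left_submodule L Z V" and UV: "U <+>\<^bsub>Z\<^esub> V = carrier Z"
  interpret Z: left_module L Z by fact
  note sum = Z.sum_submodule and sub = Z.left_submoduleD(1)
  have mono: "U <+>\<^bsub>Z\<^esub> W \<subseteq> U' <+>\<^bsub>Z\<^esub> W" if "U \<subseteq> U'" for U U' W
    using that unfolding subset_iff Z.mem_set_add by metis
  obtain V' where V': "left_submodule L Z V'" "V' \<subseteq> V" "U <+>\<^bsub>Z\<^esub> V' = carrier Z"
    and minV: "\<And>W. left_submodule L Z W \<Longrightarrow> W \<subseteq> V' \<Longrightarrow> U <+>\<^bsub>Z\<^esub> W = carrier Z \<Longrightarrow> W = V'"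
    using artinian_below_minimal[of L Z "carrier Z" V "\<lambda>W. U <+>\<^bsub>Z\<^esub> W = carrier Z", OF art V sub[OF V] UV]
    by metis
  obtain U' where U': "left_submodule L Z U'" "U' \<subseteq> U" "U' <+>\<^bsub>Z\<^esub> V' = carrier Z"
    and minU: "\<And>W. left_submodule L Z W \<Longrightarrow> W \<subseteq> U' \<Longrightarrow> W <+>\<^bsub>Z\<^esub> V' = carrier Z \<Longrightarrow> W = U'"
    using artinian_below_minimal[of L Z "carrier Z" U "\<lambda>W. W <+>\<^bsub>Z\<^esub> V' = carrier Z", OF art U sub[OF U] V'(3)]
    by metis
  have minV': "W = V'" if W: "left_submodule L Z W" "W \<subseteq> V'" "U' <+>\<^bsub>Z\<^esub> W = carrier Z" for W
  proof (rule minV[OF W(1,2)])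
    show "U <+>\<^bsub>Z\<^esub> W = carrier Z" using mono[OF U'(2), of W] W(3) sub[OF sum[OF U W(1)]] by auto
  qed
  have minU': "W = U'" if W: "left_submodule L Z W" "W \<subseteq> U'" "V' <+>\<^bsub>Z\<^esub> W = carrier Z" for W
    using minU[OF W(1,2)] W(3) Z.set_add_commute[OF sub[OF W(1)] sub[OF V'(1)]] by simp
  have VU: "V' <+>\<^bsub>Z\<^esub> U' = carrier Z"
    using U'(3) Z.set_add_commute[OF sub[OF U'(1)] sub[OF V'(1)]] by simp
  obtain f e where fe: "f \<in> left_hom L Z Z" "e \<in> left_hom L Z Z"
    "\<And>z. z \<in> carrier Z \<Longrightarrow> f z \<in> U'" "\<And>z. z \<in> carrier Z \<Longrightarrow> e z \<in> V'"
    and fe5: "\<And>z. z \<in> carrier Z \<Longrightarrow> z = f z \<oplus> e z"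
    using dual_basis_projections[OF Z db U'(1) V'(1) U'(3)] by metis
  have fe5': "z = e z \<oplus> f z" if "z \<in> carrier Z" for z
    using fe5[OF that] left_homD(1)[OF fe(1) that] left_homD(1)[OF fe(2) that] by (metis Z.a_comm)
  have kerE: "{z \<in> carrier Z. e z = \<zero>} = U'"
    by (rule minU[OF left_hom_kernel_submodule[OF Z Z fe(2)]
          minimal_supplement[OF Z U'(1) V'(1) U'(3) minV' fe fe5]])
  have kerF: "{z \<in> carrier Z. f z = \<zero>} = V'"
  proof (rule minV')
    note * = minimal_supplement[OF Z V'(1) U'(1) VU minU' fe(2,1) fe(4,3) fe5']
    show k: "left_submodule L Z {z \<in> carrier Z. f z = \<zero>}" by (rule left_hom_kernel_submodule[OF Z Z fe(1)])
    show "{z \<in> carrier Z. f z = \<zero>} \<subseteq> V'" by (rule *(1))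
    show "U' <+>\<^bsub>Z\<^esub> {z \<in> carrier Z. f z = \<zero>} = carrier Z"
      unfolding Z.set_add_commute[OF sub[OF U'(1)] sub[OF k]] by (rule *(2))
  qed
  have "z = \<zero>" if z: "z \<in> U'" "z \<in> V'" for z
  proof -
    have "e z = \<zero>" "f z = \<zero>" "z \<in> carrier Z"
      using z unfolding kerE[symmetric] kerF[symmetric] by auto
    then show ?thesis using fe5[of z] by simp
  qed
  then have "U' \<inter> V' = {\<zero>}"
    using Z.left_submoduleD(2)[OF U'(1)] Z.left_submoduleD(2)[OF V'(1)] by blast
  then have "U' = {\<zero>} \<or> V' = {\<zero>}"
    using ind U'(1,3) V'(1) unfolding indecomposable_def by metis
  then show "U = carrier Z \<or> V = carrier Z"
  proof
    assume "U' = {\<zero>}"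
    then have "carrier Z \<subseteq> V'" unfolding U'(3)[symmetric] using Z.left_submoduleD(3)[OF V'(1)] by (auto simp: Z.mem_set_add)
    then show ?thesis using V'(2) sub[OF V] by auto
  next
    assume "V' = {\<zero>}"
    then have "carrier Z \<subseteq> U'" unfolding U'(3)[symmetric] using Z.left_submoduleD(3)[OF U'(1)] by (auto simp: Z.mem_set_add)
    then show ?thesis using U'(2) sub[OF U] by auto
  qed
qed

text \<open>
  Adding generators one at a time, the span remains proper unless a single generator already spans
  the whole module, because a sum of two proper submodules is proper.
\<close>

lemma hollow_cyclic:
  fixes Z (structure)
  assumes Z: "left_module L Z" and fg: "finitely_generated L Z" and hollow: "hollow L Z"
  obtains z where "z \<in> carrier Z" "cyclic L Z z = carrier Z"
proof -
  interpret Z: left_module L Z by fact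
  obtain S where S: "finite S" "S \<subseteq> carrier Z"
    and gen: "\<And>U. left_submodule L Z U \<Longrightarrow> S \<subseteq> U \<Longrightarrow> U = carrier Z"
    using fg unfolding finitely_generated_iff[OF Z] by metis
  have "(\<exists>s\<in>S. cyclic L Z s = carrier Z) \<or>
    (\<exists>W. left_submodule L Z W \<and> S \<subseteq> W \<and> W \<noteq> carrier Z)"
    using S
  proof induction
    case empty
    then show ?case using Z.zero_submodule hollowD(1)[OF hollow] by blast
  next
    case (insert y S)
    show ?case
    proof (cases "\<exists>s\<in>insert y S. cyclic L Z s = carrier Z")
      case False
      then obtain W where W: "left_submodule L Z W" "S \<subseteq> W" "W \<noteq> carrier Z" using insert by auto
      have y: "y \<in> carrier Z" using insert by simp
      note cyc = Z.cyclic_submodule[OF y]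
      let ?W = "W <+>\<^bsub>Z\<^esub> cyclic L Z y"
      have "?W \<noteq> carrier Z" using hollowD(2)[OF hollow W(1) cyc] W(3) False by auto
      moreover have "W \<subseteq> ?W" "y \<in> ?W" using Z.subset_add_cyclic[OF W(1) y] by auto
      ultimately have "left_submodule L Z ?W \<and> insert y S \<subseteq> ?W \<and> ?W \<noteq> carrier Z"
        using Z.sum_submodule[OF W(1) cyc] W(2) by auto
      then show ?thesis by metis
    qed simp
  qed
  then show thesis using gen that S(2) by (metis subsetD)
qed

text \<open>
  The epimorphism \<open>r \<mapsto> r z\<close> from \<open>L\<close> to \<open>Z\<close> splits: if \<open>w i = c i z\<close>, then \<open>\<alpha> x\<close> is the sum of the
  \<open>\<phi> i x \<cdot> c i\<close>.
\<close>

lemma cyclic_projective_coordinate: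
  fixes Z (structure)
  assumes Z: "left_module L Z" and db: "dual_basis L Z n w \<phi>"
    and z: "z \<in> carrier Z" "cyclic L Z z = carrier Z"
  obtains \<alpha> where "\<alpha> \<in> left_hom L Z (regular_bimodule L)" "\<And>x. x \<in> carrier Z \<Longrightarrow> \<alpha> x \<odot> z = x"
proof -
  interpret Z: left_module L Z by fact
  note reg = regular_module[OF Z.R.ring_axioms]
  interpret reg: left_module L "regular_bimodule L" by (rule reg)
  have w: "\<And>i. i < n \<Longrightarrow> w i \<in> carrier Z" "\<And>i. i < n \<Longrightarrow> \<phi> i \<in> left_hom L Z (regular_bimodule L)"
    and sum: "\<And>x. x \<in> carrier Z \<Longrightarrow> x = (\<Oplus>i\<in>{..<n}. \<phi> i x \<odot> w i)"
    using db unfolding dual_basis_def by blast+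
  have "\<forall>i<n. \<exists>c. c \<in> carrier L \<and> w i = c \<odot> z" using w(1) z(2) by (metis imageE)
  then obtain c where c: "\<And>i. i < n \<Longrightarrow> c i \<in> carrier L" "\<And>i. i < n \<Longrightarrow> w i = c i \<odot> z" by metis
  let ?\<alpha> = "\<lambda>x. \<Oplus>\<^bsub>regular_bimodule L\<^esub>i\<in>{..<n}. \<phi> i x \<odot>\<^bsub>regular_bimodule L\<^esub> c i"
  note cl = functional_closed[OF w(2)]
  have "?\<alpha> \<in> left_hom L Z (regular_bimodule L)"
    using c(1) by (intro functional_combination_hom[OF Z reg w(2)]) auto
  moreover have "?\<alpha> x \<odot> z = x" if x: "x \<in> carrier Z" for x
  proof -
    have ev: "(\<lambda>r. r \<odot> z) \<in> left_hom L (regular_bimodule L) Z"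
      using z(1) by (auto simp: left_hom_iff Z.lsmult_closed Z.lsmult_l_distr Z.lsmult_assoc)
    have "?\<alpha> x \<odot> z = (\<Oplus>i\<in>{..<n}. (\<phi> i x \<otimes>\<^bsub>L\<^esub> c i) \<odot> z)"
      using left_hom_finsum[OF reg Z ev, of "{..<n}" "\<lambda>i. \<phi> i x \<otimes>\<^bsub>L\<^esub> c i"] cl x c(1) by simp
    also have "\<dots> = (\<Oplus>i\<in>{..<n}. \<phi> i x \<odot> w i)"
      using cl x c z(1) by (intro Z.finsum_cong') (auto simp: Z.lsmult_assoc Z.lsmult_closed)
    finally show ?thesis using sum[OF x] by simp
  qed
  ultimately show thesis by (rule that)
qed

section \<open>Corner rings and induced modules\<close>

text \<open>
  The map \<open>\<kappa>\<close> identifies \<open>A\<close> with the corner ring \<open>e L e\<close> of the idempotent \<open>e = \<kappa> \<one>\<close>; it need not preserve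
  the unit.
\<close>

locale corner =
  fixes A :: "'a ring" and L :: "'l ring" and \<kappa> :: "'a \<Rightarrow> 'l"
  assumes ring_A: "ring A" and ring_L: "ring L"
    and kappa_closed: "a \<in> carrier A \<Longrightarrow> \<kappa> a \<in> carrier L"
    and kappa_add: "\<lbrakk>a \<in> carrier A; b \<in> carrier A\<rbrakk> \<Longrightarrow> \<kappa> (a \<oplus>\<^bsub>A\<^esub> b) = \<kappa> a \<oplus>\<^bsub>L\<^esub> \<kappa> b"
    and kappa_mult: "\<lbrakk>a \<in> carrier A; b \<in> carrier A\<rbrakk> \<Longrightarrow> \<kappa> (a \<otimes>\<^bsub>A\<^esub> b) = \<kappa> a \<otimes>\<^bsub>L\<^esub> \<kappa> b"
    and kappa_inj: "inj_on \<kappa> (carrier A)"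
    and kappa_surj: "l \<in> carrier L \<Longrightarrow> \<kappa> \<one>\<^bsub>A\<^esub> \<otimes>\<^bsub>L\<^esub> l \<otimes>\<^bsub>L\<^esub> \<kappa> \<one>\<^bsub>A\<^esub> \<in> \<kappa> ` carrier A"
begin

text \<open>
  The elements with \<open>e z = z\<close> are those of \<open>e Z\<close>.
\<close>

definition corner_module :: "('l, 'z, 'k) module_scheme \<Rightarrow> ('a, 'z) module"
  where "corner_module Z = \<lparr>carrier = {z \<in> carrier Z. \<kappa> \<one>\<^bsub>A\<^esub> \<odot>\<^bsub>Z\<^esub> z = z}, mult = undefined, one = undefined,
    ring.zero = \<zero>\<^bsub>Z\<^esub>, ring.add = (\<oplus>\<^bsub>Z\<^esub>), smult = (\<lambda>a z. \<kappa> a \<odot>\<^bsub>Z\<^esub> z)\<rparr>"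

lemma corner_module_simps [simp]:
  "carrier (corner_module Z) = {z \<in> carrier Z. \<kappa> \<one>\<^bsub>A\<^esub> \<odot>\<^bsub>Z\<^esub> z = z}"
  "ring.zero (corner_module Z) = \<zero>\<^bsub>Z\<^esub>" "ring.add (corner_module Z) = (\<oplus>\<^bsub>Z\<^esub>)"
  "smult (corner_module Z) = (\<lambda>a z. \<kappa> a \<odot>\<^bsub>Z\<^esub> z)"
  by (simp_all add: corner_module_def)

lemma kappa_one_closed: "\<kappa> \<one>\<^bsub>A\<^esub> \<in> carrier L"
  using ring.ring_simprules(6)[OF ring_A] kappa_closed by simp

lemma kappa_one_mult:
  assumes "a \<in> carrier A"
  shows "\<kappa> \<one>\<^bsub>A\<^esub> \<otimes>\<^bsub>L\<^esub> \<kappa> a = \<kappa> a" "\<kappa> a \<otimes>\<^bsub>L\<^esub> \<kappa> \<one>\<^bsub>A\<^esub> = \<kappa> a"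
proof -
  interpret A: ring A by (rule ring_A)
  show "\<kappa> \<one>\<^bsub>A\<^esub> \<otimes>\<^bsub>L\<^esub> \<kappa> a = \<kappa> a" "\<kappa> a \<otimes>\<^bsub>L\<^esub> \<kappa> \<one>\<^bsub>A\<^esub> = \<kappa> a"
    using assms kappa_mult[of "\<one>\<^bsub>A\<^esub>" a] kappa_mult[of a "\<one>\<^bsub>A\<^esub>"] by auto
qed

lemma corner_module_left_module:
  fixes Z (structure)
  assumes "left_module L Z" shows "left_module A (corner_module Z)"
proof -
  interpret Z: left_module L Z by fact
  interpret A: ring A by (rule ring_A)
  note e = kappa_one_closed
  have "abelian_group (corner_module Z)"
  proof (rule abelian_groupI)
    fix x assume x: "x \<in> carrier (corner_module Z)"
    have "\<kappa> \<one>\<^bsub>A\<^esub> \<odot> (\<ominus> x) \<oplus> x = \<kappa> \<one>\<^bsub>A\<^esub> \<odot> (\<ominus> x) \<oplus> \<kappa> \<one>\<^bsub>A\<^esub> \<odot> x" using x by simp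
    also have "\<dots> = \<kappa> \<one>\<^bsub>A\<^esub> \<odot> (\<ominus> x \<oplus> x)"
      using x e Z.lsmult_r_distr[of "\<kappa> \<one>\<^bsub>A\<^esub>" "\<ominus> x" x] by simp
    also have "\<dots> = \<zero>" using x e by (simp add: Z.l_neg Z.smult_zero_right)
    finally have "\<kappa> \<one>\<^bsub>A\<^esub> \<odot> (\<ominus> x) = \<ominus> x"
      using x e Z.minus_equality[of "\<kappa> \<one>\<^bsub>A\<^esub> \<odot> (\<ominus> x)" x] by (simp add: Z.lsmult_closed)
    then have "\<ominus> x \<in> carrier (corner_module Z)" using x by simp
    moreover have "\<ominus> x \<oplus>\<^bsub>corner_module Z\<^esub> x = \<zero>\<^bsub>corner_module Z\<^esub>" using x by (simp add: Z.l_neg)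
    ultimately show "\<exists>y\<in>carrier (corner_module Z). y \<oplus>\<^bsub>corner_module Z\<^esub> x = \<zero>\<^bsub>corner_module Z\<^esub>" by metis
  qed (auto simp: Z.a_ac Z.lsmult_r_distr Z.smult_zero_right e)
  moreover have "left_module_axioms A (corner_module Z)"
  proof
    fix a x assume a: "a \<in> carrier A" and x: "x \<in> carrier (corner_module Z)"
    have "\<kappa> \<one>\<^bsub>A\<^esub> \<odot> (\<kappa> a \<odot> x) = \<kappa> a \<odot> x"
      using Z.lsmult_assoc[of "\<kappa> \<one>\<^bsub>A\<^esub>" "\<kappa> a" x] a x e kappa_closed kappa_one_mult by simp
    then show "a \<odot>\<^bsub>corner_module Z\<^esub> x \<in> carrier (corner_module Z)"
      using a x kappa_closed by (simp add: Z.lsmult_closed)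
  qed (auto simp: kappa_add kappa_mult kappa_closed Z.lsmult_l_distr Z.lsmult_r_distr Z.lsmult_assoc)
  ultimately show ?thesis using ring_A by (simp add: left_module_def)
qed

end

text \<open>
  The module \<open>T\<close> plays the role of \<open>L e \<otimes>\<^sub>A P\<close>: the map \<open>j\<close> identifies \<open>P\<close> with \<open>e T\<close>, this corner generates \<open>T\<close>,
  and functionals on \<open>P\<close> extend to \<open>T\<close>. The last condition is the universal property restricted to
  the target \<open>L\<close>. This part of it is enough to construct dual bases and to prove injectivity of maps
  into \<open>T\<close>, and it avoids quantifying over modules on arbitrary types.
\<close>

locale induced_module = corner A L \<kappa>
  for A :: "'a ring" and L :: "'l ring" and \<kappa> +
  fixes P :: "('a, 'x, 'k1) module_scheme" and T :: "('l, 't, 'k2) module_scheme" and j :: "'x \<Rightarrow> 't"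
  assumes module_P: "left_module A P" and module_T: "left_module L T"
    and j_closed: "x \<in> carrier P \<Longrightarrow> j x \<in> carrier T"
    and j_add: "\<lbrakk>x \<in> carrier P; y \<in> carrier P\<rbrakk> \<Longrightarrow> j (x \<oplus>\<^bsub>P\<^esub> y) = j x \<oplus>\<^bsub>T\<^esub> j y"
    and j_smult: "\<lbrakk>a \<in> carrier A; x \<in> carrier P\<rbrakk> \<Longrightarrow> j (a \<odot>\<^bsub>P\<^esub> x) = \<kappa> a \<odot>\<^bsub>T\<^esub> j x"
    and j_inj: "inj_on j (carrier P)"
    and j_surj: "t \<in> carrier T \<Longrightarrow> \<kappa> \<one>\<^bsub>A\<^esub> \<odot>\<^bsub>T\<^esub> t \<in> j ` carrier P"
    and generated: "\<lbrakk>left_submodule L T U; j ` carrier P \<subseteq> U\<rbrakk> \<Longrightarrow> U = carrier T"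
    and extension: "\<phi> \<in> left_hom A P (regular_bimodule A) \<Longrightarrow>
      \<exists>F\<in>left_hom L T (regular_bimodule L). \<forall>x\<in>carrier P. F (j x) = \<kappa> (\<phi> x)"
begin

lemma j_additive: "j \<in> hom (add_monoid P) (add_monoid T)"
  using j_closed j_add by (auto simp: hom_def)

lemma j_zero: "j \<zero>\<^bsub>P\<^esub> = \<zero>\<^bsub>T\<^esub>"
proof -
  interpret P: left_module A P by (rule module_P)
  interpret T: left_module L T by (rule module_T)
  show ?thesis by (rule additive_zero[OF P.abelian_group_axioms T.abelian_group_axioms j_additive])
qed

lemma kappa_one_j: "x \<in> carrier P \<Longrightarrow> \<kappa> \<one>\<^bsub>A\<^esub> \<odot>\<^bsub>T\<^esub> j x = j x"
proof -
  interpret P: left_module A P by (rule module_P)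
  show "x \<in> carrier P \<Longrightarrow> \<kappa> \<one>\<^bsub>A\<^esub> \<odot>\<^bsub>T\<^esub> j x = j x"
    using j_smult[of "\<one>\<^bsub>A\<^esub>" x] P.lsmult_one by simp
qed

text \<open>
  Extend the coordinate functionals to \<open>T\<close>. The expansion of \<open>t\<close> in the \<open>j (w i)\<close> then holds on the
  image of \<open>j\<close>, and the elements for which it holds form a submodule.
\<close>

lemma induced_dual_basis:
  assumes "dual_basis A P n w \<phi>"
  obtains F where "dual_basis L T n (\<lambda>i. j (w i)) F"
proof -
  interpret P: left_module A P by (rule module_P)
  interpret T: left_module L T by (rule module_T)
  have w: "\<And>i. i < n \<Longrightarrow> w i \<in> carrier P" "\<And>i. i < n \<Longrightarrow> \<phi> i \<in> left_hom A P (regular_bimodule A)"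
    and sum: "\<And>x. x \<in> carrier P \<Longrightarrow> x = (\<Oplus>\<^bsub>P\<^esub>i\<in>{..<n}. \<phi> i x \<odot>\<^bsub>P\<^esub> w i)"
    using assms unfolding dual_basis_def by blast+
  have "\<forall>i. \<exists>F. i < n \<longrightarrow> F \<in> left_hom L T (regular_bimodule L) \<and> (\<forall>x\<in>carrier P. F (j x) = \<kappa> (\<phi> i x))"
    using extension w(2) by metis
  then obtain F where F: "\<And>i. i < n \<Longrightarrow> F i \<in> left_hom L T (regular_bimodule L)"
    "\<And>i x. i < n \<Longrightarrow> x \<in> carrier P \<Longrightarrow> F i (j x) = \<kappa> (\<phi> i x)" by metis
  let ?G = "\<lambda>t. \<Oplus>\<^bsub>T\<^esub>i\<in>{..<n}. F i t \<odot>\<^bsub>T\<^esub> j (w i)"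
  have G: "?G \<in> left_hom L T T"
    using j_closed w(1) by (intro functional_combination_hom[OF module_T module_T F(1)]) auto
  have I: "(\<lambda>t. t) \<in> left_hom L T T" by (simp add: left_hom_iff)
  have "j x \<in> {t \<in> carrier T. t = ?G t}" if x: "x \<in> carrier P" for x
  proof -
    note cl = functional_closed[OF w(2) x]
    have "?G (j x) = (\<Oplus>\<^bsub>T\<^esub>i\<in>{..<n}. j (\<phi> i x \<odot>\<^bsub>P\<^esub> w i))"
      using F(2) x cl w(1) j_smult j_closed by (intro T.finsum_cong') (auto intro!: P.lsmult_closed T.lsmult_closed kappa_closed)
    also have "\<dots> = j (\<Oplus>\<^bsub>P\<^esub>i\<in>{..<n}. \<phi> i x \<odot>\<^bsub>P\<^esub> w i)"
      using cl w(1)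
      by (intro additive_finsum[OF P.abelian_group_axioms T.abelian_group_axioms j_additive, symmetric])
        (auto intro!: P.lsmult_closed)
    finally show ?thesis using sum[OF x] j_closed[OF x] by simp
  qed
  then have "j ` carrier P \<subseteq> {t \<in> carrier T. t = ?G t}" by (rule image_subsetI)
  then have all: "{t \<in> carrier T. t = ?G t} = carrier T"
    by (rule generated[OF left_hom_equaliser_submodule[OF module_T module_T I G]])
  have "dual_basis L T n (\<lambda>i. j (w i)) F"
    unfolding dual_basis_def
  proof (intro conjI allI impI ballI)
    fix t assume "t \<in> carrier T"
    then have "t \<in> {t \<in> carrier T. t = ?G t}" unfolding all .
    then show "t = ?G t" by (simp only: mem_Collect_eq)
  qed (use j_closed w(1) F(1) in auto)
  then show thesis by (rule that)
qed

text \<open>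
  If \<open>V\<close> meets the corner trivially, then \<open>e V = 0\<close>. Writing \<open>j x = u + v\<close> and multiplying by \<open>e\<close> leaves
  \<open>j x = e u \<in> U\<close>, so \<open>U\<close> contains a generating set.
\<close>

lemma induced_indecomposable_aux:
  assumes U: "left_submodule L T U" and V: "left_submodule L T V" and UV: "U <+>\<^bsub>T\<^esub> V = carrier T"
    and V0: "{x \<in> carrier P. j x \<in> V} = {\<zero>\<^bsub>P\<^esub>}"
  shows "U = carrier T"
proof (rule generated[OF U], rule image_subsetI)
  interpret P: left_module A P by (rule module_P)
  interpret T: left_module L T by (rule module_T)
  note Uc = T.left_submoduleD[OF U] and Vc = T.left_submoduleD[OF V] and e = kappa_one_closed
  fix x assume x: "x \<in> carrier P"
  then have "j x \<in> U <+>\<^bsub>T\<^esub> V" using j_closed UV by simp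
  then obtain u v where uv: "u \<in> U" "v \<in> V" "j x = u \<oplus>\<^bsub>T\<^esub> v" by (auto simp: T.mem_set_add)
  have "\<kappa> \<one>\<^bsub>A\<^esub> \<odot>\<^bsub>T\<^esub> v \<in> j ` carrier P" using j_surj Vc(3) uv by simp
  then obtain y where y: "\<kappa> \<one>\<^bsub>A\<^esub> \<odot>\<^bsub>T\<^esub> v = j y" "y \<in> carrier P" by (rule imageE)
  then have "j y \<in> V" using Vc(5)[OF e uv(2)] by simp
  then have "y = \<zero>\<^bsub>P\<^esub>" using V0 y by blast
  then have ev: "\<kappa> \<one>\<^bsub>A\<^esub> \<odot>\<^bsub>T\<^esub> v = \<zero>\<^bsub>T\<^esub>" using y j_zero by simp
  have "j x = \<kappa> \<one>\<^bsub>A\<^esub> \<odot>\<^bsub>T\<^esub> (u \<oplus>\<^bsub>T\<^esub> v)" using kappa_one_j[OF x] uv(3) by simp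
  also have "\<dots> = \<kappa> \<one>\<^bsub>A\<^esub> \<odot>\<^bsub>T\<^esub> u"
    using uv Uc(3) Vc(3) e by (simp add: T.lsmult_r_distr ev T.lsmult_closed)
  finally show "j x \<in> U" using Uc(5)[OF e uv(1)] by simp
qed

text \<open>
  A decomposition of \<open>T\<close> restricts to one of the corner \<open>e T\<close>, that is, of \<open>P\<close>. One of the summands
  therefore meets the corner trivially, and then the other is the whole of \<open>T\<close>.
\<close>

lemma induced_indecomposable:
  assumes ind: "indecomposable A P" shows "indecomposable L T"
proof -
  interpret P: left_module A P by (rule module_P)
  interpret T: left_module L T by (rule module_T)
  note e = kappa_one_closed
  have "carrier P \<noteq> {\<zero>\<^bsub>P\<^esub>}" using indecomposableD(1)[OF ind] by simp
  then obtain x where "x \<in> carrier P" "x \<noteq> \<zero>\<^bsub>P\<^esub>" using P.zero_closed by blast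
  then have "j x \<in> carrier T" "j x \<noteq> \<zero>\<^bsub>T\<^esub>"
    using j_closed inj_onD[OF j_inj, of x "\<zero>\<^bsub>P\<^esub>"] j_zero P.zero_closed by auto
  then have nz: "carrier T \<noteq> {\<zero>\<^bsub>T\<^esub>}" by blast
  have "U = {\<zero>\<^bsub>T\<^esub>} \<or> V = {\<zero>\<^bsub>T\<^esub>}"
    if U: "left_submodule L T U" and V: "left_submodule L T V" and UV: "U <+>\<^bsub>T\<^esub> V = carrier T"
      and cap: "U \<inter> V = {\<zero>\<^bsub>T\<^esub>}" for U V
  proof -
    note Uc = T.left_submoduleD[OF U] and Vc = T.left_submoduleD[OF V]
    let ?r = "\<lambda>W. {x \<in> carrier P. j x \<in> W}"
    have r: "left_submodule A P (?r W)" if W: "left_submodule L T W" for W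
      using T.left_submoduleD[OF W]
      by (auto simp: P.left_submodule_iff j_zero j_add j_smult kappa_closed P.lsmult_closed)
    have "x \<in> ?r U <+>\<^bsub>P\<^esub> ?r V" if x: "x \<in> carrier P" for x
    proof -
      have "j x \<in> U <+>\<^bsub>T\<^esub> V" using j_closed UV x by simp
      then obtain u v where uv: "u \<in> U" "v \<in> V" "j x = u \<oplus>\<^bsub>T\<^esub> v" by (auto simp: T.mem_set_add)
      have "\<kappa> \<one>\<^bsub>A\<^esub> \<odot>\<^bsub>T\<^esub> u \<in> j ` carrier P" "\<kappa> \<one>\<^bsub>A\<^esub> \<odot>\<^bsub>T\<^esub> v \<in> j ` carrier P"
        using j_surj Uc(3) Vc(3) uv by auto
      then obtain y z where y: "\<kappa> \<one>\<^bsub>A\<^esub> \<odot>\<^bsub>T\<^esub> u = j y" "y \<in> carrier P"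
        and z: "\<kappa> \<one>\<^bsub>A\<^esub> \<odot>\<^bsub>T\<^esub> v = j z" "z \<in> carrier P" by (metis imageE)
      have "j y \<in> U" "j z \<in> V" using y z Uc(5)[OF e uv(1)] Vc(5)[OF e uv(2)] by simp_all
      then have yz: "y \<in> ?r U" "z \<in> ?r V" using y z by auto
      have "j x = \<kappa> \<one>\<^bsub>A\<^esub> \<odot>\<^bsub>T\<^esub> (u \<oplus>\<^bsub>T\<^esub> v)" using kappa_one_j[OF x] uv(3) by simp
      also have "\<dots> = j (y \<oplus>\<^bsub>P\<^esub> z)"
        using uv Uc(3) Vc(3) e y z by (simp add: T.lsmult_r_distr j_add)
      finally have "x = y \<oplus>\<^bsub>P\<^esub> z" using x y z by (auto dest: inj_onD[OF j_inj])
      then show ?thesis unfolding P.mem_set_add by (intro bexI[OF _ yz(1)] bexI[OF _ yz(2)])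
    qed
    then have "?r U <+>\<^bsub>P\<^esub> ?r V = carrier P"
      using P.left_submoduleD(1)[OF P.sum_submodule[OF r[OF U] r[OF V]]] by (intro equalityI subsetI) auto
    moreover have "?r U \<inter> ?r V = {\<zero>\<^bsub>P\<^esub>}"
    proof (intro equalityI subsetI)
      fix x assume x: "x \<in> ?r U \<inter> ?r V"
      then have "j x \<in> U \<inter> V" by simp
      then have "j x = j \<zero>\<^bsub>P\<^esub>" unfolding cap j_zero by simp
      then show "x \<in> {\<zero>\<^bsub>P\<^esub>}" using x inj_onD[OF j_inj] by auto
    qed (use P.left_submoduleD(2)[OF r[OF U]] P.left_submoduleD(2)[OF r[OF V]] in auto)
    ultimately have "?r U = {\<zero>\<^bsub>P\<^esub>} \<or> ?r V = {\<zero>\<^bsub>P\<^esub>}"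
      by (rule indecomposableD(2)[OF ind r[OF U] r[OF V]])
    then show ?thesis
    proof
      assume "?r V = {\<zero>\<^bsub>P\<^esub>}"
      from induced_indecomposable_aux[OF U V UV this] show ?thesis using cap Vc(1) by auto
    next
      assume *: "?r U = {\<zero>\<^bsub>P\<^esub>}"
      have "V <+>\<^bsub>T\<^esub> U = carrier T" using UV T.set_add_commute[OF Uc(1) Vc(1)] by metis
      from induced_indecomposable_aux[OF V U this *] show ?thesis using cap Uc(1) by auto
    qed
  qed
  then show ?thesis using nz unfolding indecomposable_def by simp
qed

lemma induced_indecomposable_projective:
  assumes "indecomposable_projective A P" shows "indecomposable_projective L T"
  using assms induced_dual_basis induced_indecomposable module_T
  unfolding indecomposable_projective_iff by metis

end

context corner
begin

text \<open>
  The element of \<open>A\<close> that corresponds to \<open>e l e\<close>.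
\<close>

definition corner_part :: "'l \<Rightarrow> 'a"
  where "corner_part l = inv_into (carrier A) \<kappa> (\<kappa> \<one>\<^bsub>A\<^esub> \<otimes>\<^bsub>L\<^esub> l \<otimes>\<^bsub>L\<^esub> \<kappa> \<one>\<^bsub>A\<^esub>)"

lemma corner_part:
  assumes "l \<in> carrier L"
  shows "corner_part l \<in> carrier A" "\<kappa> (corner_part l) = \<kappa> \<one>\<^bsub>A\<^esub> \<otimes>\<^bsub>L\<^esub> l \<otimes>\<^bsub>L\<^esub> \<kappa> \<one>\<^bsub>A\<^esub>"
  using kappa_surj[OF assms] unfolding corner_part_def by (auto intro: inv_into_into f_inv_into_f)

lemma corner_part_eqI:
  assumes "l \<in> carrier L" "a \<in> carrier A" "\<kappa> a = \<kappa> \<one>\<^bsub>A\<^esub> \<otimes>\<^bsub>L\<^esub> l \<otimes>\<^bsub>L\<^esub> \<kappa> \<one>\<^bsub>A\<^esub>"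
  shows "corner_part l = a"
  using inj_onD[OF kappa_inj _ corner_part(1)[OF assms(1)] assms(2)] corner_part(2)[OF assms(1)] assms(3) by simp

text \<open>
  For \<open>x = e x\<close> also \<open>\<alpha> x = e \<cdot> \<alpha> x\<close>. Hence on a vector \<open>y = e y\<close> the element \<open>\<alpha> x\<close> acts as
  \<open>e \<cdot> \<alpha> x \<cdot> e\<close>, which belongs to the corner ring.
\<close>

lemma
  assumes Z: "left_module L Z" and \<alpha>: "\<alpha> \<in> left_hom L Z (regular_bimodule L)"
  shows corner_functional: "(\<lambda>x. corner_part (\<alpha> x)) \<in> left_hom A (corner_module Z) (regular_bimodule A)" (is ?hom)
    and corner_functional_smult: "\<And>X y x. \<lbrakk>left_module L X; y \<in> carrier X; \<kappa> \<one>\<^bsub>A\<^esub> \<odot>\<^bsub>X\<^esub> y = y;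
       x \<in> carrier (corner_module Z)\<rbrakk> \<Longrightarrow> \<kappa> (corner_part (\<alpha> x)) \<odot>\<^bsub>X\<^esub> y = \<alpha> x \<odot>\<^bsub>X\<^esub> y"
proof -
  interpret Z: left_module L Z by fact
  interpret A: ring A by (rule ring_A)
  note e = kappa_one_closed and \<alpha>c = functional_closed[OF \<alpha>]
  show ?hom
    unfolding left_hom_iff
  proof (intro conjI ballI)
    fix x assume "x \<in> carrier (corner_module Z)"
    then have x: "x \<in> carrier Z" by simp
    show "corner_part (\<alpha> x) \<in> carrier (regular_bimodule A)" using corner_part(1) \<alpha>c x by simp
    show "corner_part (\<alpha> (x \<oplus>\<^bsub>corner_module Z\<^esub> y)) =
        corner_part (\<alpha> x) \<oplus>\<^bsub>regular_bimodule A\<^esub> corner_part (\<alpha> y)" if "y \<in> carrier (corner_module Z)" for y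
    proof -
      from that have y: "y \<in> carrier Z" by simp
      have "corner_part (\<alpha> (x \<oplus>\<^bsub>Z\<^esub> y)) = corner_part (\<alpha> x) \<oplus>\<^bsub>A\<^esub> corner_part (\<alpha> y)"
      proof (rule corner_part_eqI)
        show "\<kappa> (corner_part (\<alpha> x) \<oplus>\<^bsub>A\<^esub> corner_part (\<alpha> y)) = \<kappa> \<one>\<^bsub>A\<^esub> \<otimes>\<^bsub>L\<^esub> \<alpha> (x \<oplus>\<^bsub>Z\<^esub> y) \<otimes>\<^bsub>L\<^esub> \<kappa> \<one>\<^bsub>A\<^esub>"
          using x y e \<alpha>c left_homD(2)[OF \<alpha> x y] corner_part
          by (simp add: kappa_add Z.R.l_distr Z.R.r_distr)
      qed (use x y \<alpha>c corner_part in auto)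
      then show ?thesis by simp
    qed
    show "corner_part (\<alpha> (a \<odot>\<^bsub>corner_module Z\<^esub> x)) = a \<odot>\<^bsub>regular_bimodule A\<^esub> corner_part (\<alpha> x)"
      if a: "a \<in> carrier A" for a
    proof -
      have ka: "\<kappa> a \<in> carrier L" using a kappa_closed by simp
      have "corner_part (\<alpha> (\<kappa> a \<odot>\<^bsub>Z\<^esub> x)) = a \<otimes>\<^bsub>A\<^esub> corner_part (\<alpha> x)"
      proof (rule corner_part_eqI)
        have "\<kappa> (a \<otimes>\<^bsub>A\<^esub> corner_part (\<alpha> x)) = (\<kappa> a \<otimes>\<^bsub>L\<^esub> \<kappa> \<one>\<^bsub>A\<^esub>) \<otimes>\<^bsub>L\<^esub> (\<alpha> x \<otimes>\<^bsub>L\<^esub> \<kappa> \<one>\<^bsub>A\<^esub>)"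
          using a x e \<alpha>c corner_part ka by (simp add: kappa_mult Z.R.m_assoc)
        also have "\<dots> = (\<kappa> \<one>\<^bsub>A\<^esub> \<otimes>\<^bsub>L\<^esub> \<kappa> a) \<otimes>\<^bsub>L\<^esub> (\<alpha> x \<otimes>\<^bsub>L\<^esub> \<kappa> \<one>\<^bsub>A\<^esub>)"
          using a by (simp only: kappa_one_mult)
        also have "\<dots> = \<kappa> \<one>\<^bsub>A\<^esub> \<otimes>\<^bsub>L\<^esub> \<alpha> (\<kappa> a \<odot>\<^bsub>Z\<^esub> x) \<otimes>\<^bsub>L\<^esub> \<kappa> \<one>\<^bsub>A\<^esub>"
          using x e \<alpha>c ka left_homD(3)[OF \<alpha> ka x] by (simp add: Z.R.m_assoc)
        finally show "\<kappa> (a \<otimes>\<^bsub>A\<^esub> corner_part (\<alpha> x)) = \<kappa> \<one>\<^bsub>A\<^esub> \<otimes>\<^bsub>L\<^esub> \<alpha> (\<kappa> a \<odot>\<^bsub>Z\<^esub> x) \<otimes>\<^bsub>L\<^esub> \<kappa> \<one>\<^bsub>A\<^esub>" .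
      qed (use x a \<alpha>c corner_part ka in \<open>auto simp: Z.lsmult_closed\<close>)
      then show ?thesis by simp
    qed
  qed
  fix X :: "('l, 'y, 'k') module_scheme" and y x
  assume X: "left_module L X" and y: "y \<in> carrier X" "\<kappa> \<one>\<^bsub>A\<^esub> \<odot>\<^bsub>X\<^esub> y = y" and "x \<in> carrier (corner_module Z)"
  then have x: "x \<in> carrier Z" "\<kappa> \<one>\<^bsub>A\<^esub> \<odot>\<^bsub>Z\<^esub> x = x" by auto
  interpret X: left_module L X by fact
  have "\<kappa> (corner_part (\<alpha> x)) \<odot>\<^bsub>X\<^esub> y = (\<kappa> \<one>\<^bsub>A\<^esub> \<otimes>\<^bsub>L\<^esub> \<alpha> x) \<odot>\<^bsub>X\<^esub> (\<kappa> \<one>\<^bsub>A\<^esub> \<odot>\<^bsub>X\<^esub> y)"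
    using \<alpha>c x(1) y(1) e by (simp only: corner_part X.lsmult_assoc Z.R.m_closed)
  also have "\<dots> = \<alpha> (\<kappa> \<one>\<^bsub>A\<^esub> \<odot>\<^bsub>Z\<^esub> x) \<odot>\<^bsub>X\<^esub> y"
    using left_homD(3)[OF \<alpha> e x(1)] y(2) by simp
  finally show "\<kappa> (corner_part (\<alpha> x)) \<odot>\<^bsub>X\<^esub> y = \<alpha> x \<odot>\<^bsub>X\<^esub> y" using x(2) by simp
qed

text \<open>
  The vector \<open>z\<close> alone is a dual basis of \<open>e Z\<close>. If \<open>e Z = U \<oplus> V\<close> and \<open>z = u + v\<close> accordingly, then
  \<open>Z = L u + L v\<close>, so one of the two, say \<open>L u\<close>, is all of \<open>Z\<close>. Then \<open>e Z = e L e u \<subseteq> U\<close>, which forces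
  \<open>V = 0\<close>.
\<close>

lemma corner_indecomposable_projective:
  fixes Z (structure)
  assumes Z: "left_module L Z" and hollow: "hollow L Z"
    and \<alpha>: "\<alpha> \<in> left_hom L Z (regular_bimodule L)" and z: "z \<in> carrier (corner_module Z)"
    and \<alpha>z: "\<And>x. x \<in> carrier Z \<Longrightarrow> \<alpha> x \<odot> z = x"
  shows "indecomposable_projective A (corner_module Z)"
proof -
  let ?P = "corner_module Z" and ?\<phi> = "\<lambda>x. corner_part (\<alpha> x)"
  have P: "left_module A ?P" by (rule corner_module_left_module[OF Z])
  interpret Z: left_module L Z by fact
  interpret P: left_module A ?P by fact
  note e = kappa_one_closed and \<alpha>c = functional_closed[OF \<alpha>] and \<phi> = corner_functional[OF Z \<alpha>]
  have zc: "z \<in> carrier Z" "\<kappa> \<one>\<^bsub>A\<^esub> \<odot> z = z" using z by auto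
  have \<phi>z: "?\<phi> x \<odot>\<^bsub>?P\<^esub> z = x" if x: "x \<in> carrier ?P" for x
    using corner_functional_smult[OF Z \<alpha> Z zc x] \<alpha>z[of x] x by simp
  have "dual_basis A ?P 1 (\<lambda>_. z) (\<lambda>_. ?\<phi>)"
    unfolding dual_basis_def
  proof (intro conjI allI impI ballI)
    fix x assume x: "x \<in> carrier ?P"
    have "(\<Oplus>\<^bsub>?P\<^esub>i\<in>{..<1::nat}. ?\<phi> x \<odot>\<^bsub>?P\<^esub> z) = (\<Oplus>\<^bsub>?P\<^esub>i\<in>{..<1::nat}. x)" by (simp only: \<phi>z[OF x])
    also have "\<dots> = x" using P.finsum_insert[of "{}" "0::nat" "\<lambda>_. x"] x by (simp add: lessThan_Suc)
    finally show "x = (\<Oplus>\<^bsub>?P\<^esub>i\<in>{..<1::nat}. ?\<phi> x \<odot>\<^bsub>?P\<^esub> z)" by (rule sym)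
  qed (use z \<phi> in auto)
  moreover have "indecomposable A ?P"
    unfolding indecomposable_def
  proof (intro conjI allI impI; (elim conjE)?)
    show "carrier ?P \<noteq> {\<zero>\<^bsub>?P\<^esub>}"
    proof
      assume "carrier ?P = {\<zero>\<^bsub>?P\<^esub>}"
      then have "z \<in> {\<zero>\<^bsub>?P\<^esub>}" using z by simp
      then have "z = \<zero>" by simp
      then have "x = \<zero>" if "x \<in> carrier Z" for x
        using \<alpha>z[OF that] \<alpha>c[OF that] by (simp add: Z.smult_zero_right)
      then have "carrier Z = {\<zero>}" using Z.zero_closed by blast
      then show False using hollowD(1)[OF hollow] by simp
    qed
    have full: "W = carrier ?P"
      if W: "left_submodule A ?P W" and y: "y \<in> W" and gen: "cyclic L Z y = carrier Z" for W y
    proof (intro equalityI subsetI)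
      note Wc = P.left_submoduleD[OF W]
      have yc: "y \<in> carrier Z" "\<kappa> \<one>\<^bsub>A\<^esub> \<odot> y = y" using Wc(3)[OF y] by auto
      show "x \<in> carrier ?P" if "x \<in> W" for x using Wc(3)[OF that] .
      fix x assume "x \<in> carrier ?P"
      then have x: "x \<in> cyclic L Z y" "\<kappa> \<one>\<^bsub>A\<^esub> \<odot> x = x" using gen by auto
      obtain l where l: "x = l \<odot> y" "l \<in> carrier L" using x(1) by (rule imageE)
      have "\<kappa> (corner_part l) \<odot> y = \<kappa> \<one>\<^bsub>A\<^esub> \<odot> (l \<odot> (\<kappa> \<one>\<^bsub>A\<^esub> \<odot> y))"
        using l(2) yc(1) e by (simp only: corner_part Z.lsmult_assoc Z.lsmult_closed Z.R.m_closed)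
      then have "x = corner_part l \<odot>\<^bsub>?P\<^esub> y" using x(2) l(1) yc(2) by simp
      then show "x \<in> W" using Wc(5)[OF corner_part(1)[OF l(2)] y] by metis
    qed
    fix U V
    assume U: "left_submodule A ?P U" and V: "left_submodule A ?P V"
      and UV: "U <+>\<^bsub>?P\<^esub> V = carrier ?P" and cap: "U \<inter> V = {\<zero>\<^bsub>?P\<^esub>}"
    note Uc = P.left_submoduleD[OF U] and Vc = P.left_submoduleD[OF V]
    obtain u v where uv: "u \<in> U" "v \<in> V" "z = u \<oplus>\<^bsub>?P\<^esub> v" using UV z P.mem_set_add by metis
    have c: "u \<in> carrier Z" "v \<in> carrier Z" using Uc(3)[OF uv(1)] Vc(3)[OF uv(2)] by auto
    have "x \<in> cyclic L Z z" if x: "x \<in> carrier Z" for x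
      using imageI[OF \<alpha>c[OF x], of "\<lambda>r. r \<odot> z"] \<alpha>z[OF x] by simp
    then have "cyclic L Z z = carrier Z"
      using Z.left_submoduleD(1)[OF Z.cyclic_submodule[OF zc(1)]] by (intro equalityI subsetI) auto
    then have "cyclic L Z (u \<oplus> v) = carrier Z" using uv(3) by simp
    from hollowD(2)[OF hollow Z.cyclic_submodule[OF c(1)] Z.cyclic_submodule[OF c(2)] Z.cyclic_add[OF c this]]
    have "U = carrier ?P \<or> V = carrier ?P" using full[OF U uv(1)] full[OF V uv(2)] by metis
    then show "U = {\<zero>\<^bsub>?P\<^esub>} \<or> V = {\<zero>\<^bsub>?P\<^esub>}" using cap Uc(1) Vc(1) by (metis Int_absorb1 Int_absorb2)
  qed
  ultimately show ?thesis using P unfolding indecomposable_projective_iff by metis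
qed

text \<open>
  The isomorphism is \<open>x \<mapsto> \<alpha> x \<cdot> j z\<close>. It restricts to \<open>j\<close> on the corner, so its image contains a
  generating set of \<open>T\<close>. Extend the functional of \<open>A\<close>-coordinates from \<open>e Z\<close> to \<open>F\<close> on \<open>T\<close>; then
  \<open>t \<mapsto> F t \<cdot> z\<close> is a left inverse.
\<close>

lemma isomorphic_induced_module:
  assumes Z: "left_module L Z" and ind: "induced_module A L \<kappa> (corner_module Z) T j"
    and \<alpha>: "\<alpha> \<in> left_hom L Z (regular_bimodule L)" and z: "z \<in> carrier (corner_module Z)"
    and \<alpha>z: "\<And>x. x \<in> carrier Z \<Longrightarrow> \<alpha> x \<odot>\<^bsub>Z\<^esub> z = x"
  shows "isomorphic_modules L Z T"
proof -
  interpret Z: left_module L Z by fact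
  interpret I: induced_module A L \<kappa> "corner_module Z" T j by fact
  interpret T: left_module L T by (rule I.module_T)
  let ?\<phi> = "\<lambda>x. corner_part (\<alpha> x)"
  note \<alpha>c = functional_closed[OF \<alpha>] and \<phi> = corner_functional[OF Z \<alpha>]
  have zc: "z \<in> carrier Z" "\<kappa> \<one>\<^bsub>A\<^esub> \<odot>\<^bsub>Z\<^esub> z = z" using z by auto
  have jz: "j z \<in> carrier T" using I.j_closed[OF z] .
  let ?\<theta> = "\<lambda>x. \<alpha> x \<odot>\<^bsub>T\<^esub> j z"
  have \<theta>: "?\<theta> \<in> left_hom L Z T"
    using \<alpha>c left_homD[OF \<alpha>] jz
    by (auto simp: left_hom_iff T.lsmult_closed T.lsmult_l_distr T.lsmult_assoc)
  obtain F where F: "F \<in> left_hom L T (regular_bimodule L)"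
    "\<And>x. x \<in> carrier (corner_module Z) \<Longrightarrow> F (j x) = \<kappa> (?\<phi> x)" using I.extension[OF \<phi>] by metis
  have "?\<theta> ` carrier Z = carrier T"
  proof (rule I.generated)
    show "left_submodule L T (?\<theta> ` carrier Z)"
      by (rule left_hom_image_submodule[OF Z T.left_module_axioms \<theta> Z.full_submodule])
    show "j ` carrier (corner_module Z) \<subseteq> ?\<theta> ` carrier Z"
    proof (rule image_subsetI)
      fix x assume x: "x \<in> carrier (corner_module Z)"
      have "?\<theta> x = \<kappa> (?\<phi> x) \<odot>\<^bsub>T\<^esub> j z"
        by (rule corner_functional_smult[OF Z \<alpha> T.left_module_axioms jz I.kappa_one_j[OF z] x, symmetric])
      also have "\<dots> = j (\<kappa> (?\<phi> x) \<odot>\<^bsub>Z\<^esub> z)"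
        using I.j_smult[OF _ z, of "?\<phi> x"] functional_closed[OF \<phi> x] by simp
      also have "\<kappa> (?\<phi> x) \<odot>\<^bsub>Z\<^esub> z = x"
        using corner_functional_smult[OF Z \<alpha> Z zc x] \<alpha>z x by simp
      finally show "j x \<in> ?\<theta> ` carrier Z" using x by (metis (no_types, lifting) imageI corner_module_simps(1) mem_Collect_eq)
    qed
  qed
  moreover have "inj_on ?\<theta> (carrier Z)"
  proof (rule inj_on_inverseI)
    fix x assume x: "x \<in> carrier Z"
    have k: "\<kappa> (?\<phi> z) \<in> carrier L" using functional_closed[OF \<phi> z] kappa_closed by simp
    have "F (?\<theta> x) \<odot>\<^bsub>Z\<^esub> z = \<alpha> x \<odot>\<^bsub>Z\<^esub> (\<kappa> (?\<phi> z) \<odot>\<^bsub>Z\<^esub> z)"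
      using left_homD(3)[OF F(1) \<alpha>c[OF x] jz] F(2)[OF z] \<alpha>c[OF x] k zc(1) by (simp add: Z.lsmult_assoc)
    also have "\<dots> = x"
      using corner_functional_smult[OF Z \<alpha> Z zc z] \<alpha>z[OF zc(1)] \<alpha>z[OF x] by simp
    finally show "F (?\<theta> x) \<odot>\<^bsub>Z\<^esub> z = x" .
  qed
  ultimately show ?thesis using \<theta> unfolding isomorphic_modules_def bij_betw_def by metis
qed

lemma corner_classification:
  fixes Z (structure)
  assumes Z: "left_module L Z" and hollow: "hollow L Z" and db: "dual_basis L Z n w \<phi>"
    and s: "s \<in> carrier Z" and gen: "(\<lambda>r. r \<odot> (\<kappa> \<one>\<^bsub>A\<^esub> \<odot> s)) ` carrier L = carrier Z"
    and T: "induced_module A L \<kappa> (corner_module Z) T j"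
  shows "indecomposable_projective A (corner_module Z)" "isomorphic_modules L Z T"
proof -
  interpret Z: left_module L Z by (rule Z)
  interpret A: ring A by (rule ring_A)
  have es: "\<kappa> \<one>\<^bsub>A\<^esub> \<odot> s \<in> carrier Z" using s kappa_one_closed by (simp add: Z.lsmult_closed)
  have "\<kappa> \<one>\<^bsub>A\<^esub> \<odot> (\<kappa> \<one>\<^bsub>A\<^esub> \<odot> s) = \<kappa> \<one>\<^bsub>A\<^esub> \<odot> s"
    using Z.lsmult_assoc[OF kappa_one_closed kappa_one_closed s] kappa_one_mult[of "\<one>\<^bsub>A\<^esub>"] by simp
  then have es': "\<kappa> \<one>\<^bsub>A\<^esub> \<odot> s \<in> carrier (corner_module Z)" using es by simp
  obtain \<alpha> where \<alpha>: "\<alpha> \<in> left_hom L Z (regular_bimodule L)"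
    "\<And>x. x \<in> carrier Z \<Longrightarrow> \<alpha> x \<odot> (\<kappa> \<one>\<^bsub>A\<^esub> \<odot> s) = x"
    using cyclic_projective_coordinate[OF Z db es gen] by metis
  show "indecomposable_projective A (corner_module Z)"
    by (rule corner_indecomposable_projective[OF Z hollow \<alpha>(1) es' \<alpha>(2)])
  show "isomorphic_modules L Z T" by (rule isomorphic_induced_module[OF Z T \<alpha>(1) es' \<alpha>(2)])
qed

end

lemma corner_transport:
  assumes "corner A L \<kappa>" and L': "ring L'" and \<sigma>: "\<sigma> \<in> ring_iso L' L"
    and \<kappa>': "\<And>a. a \<in> carrier A \<Longrightarrow> \<kappa>' a \<in> carrier L'" "\<And>a. a \<in> carrier A \<Longrightarrow> \<sigma> (\<kappa>' a) = \<kappa> a"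
  shows "corner A L' \<kappa>'"
proof -
  interpret corner A L \<kappa> by fact
  interpret A: ring A by (rule ring_A)
  interpret L': ring L' by (rule L')
  have h: "\<And>x y. x \<in> carrier L' \<Longrightarrow> y \<in> carrier L' \<Longrightarrow> \<sigma> (x \<otimes>\<^bsub>L'\<^esub> y) = \<sigma> x \<otimes>\<^bsub>L\<^esub> \<sigma> y"
    "\<And>x y. x \<in> carrier L' \<Longrightarrow> y \<in> carrier L' \<Longrightarrow> \<sigma> (x \<oplus>\<^bsub>L'\<^esub> y) = \<sigma> x \<oplus>\<^bsub>L\<^esub> \<sigma> y"
    "\<And>x. x \<in> carrier L' \<Longrightarrow> \<sigma> x \<in> carrier L" and inj: "inj_on \<sigma> (carrier L')"
    using \<sigma> by (auto simp: ring_iso_def ring_hom_def bij_betw_def)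
  note eqI = inj_onD[OF inj]
  show ?thesis
  proof (rule corner.intro[OF ring_A L' \<kappa>'(1)])
    fix a b assume ab: "a \<in> carrier A" "b \<in> carrier A"
    show "\<kappa>' (a \<oplus>\<^bsub>A\<^esub> b) = \<kappa>' a \<oplus>\<^bsub>L'\<^esub> \<kappa>' b" "\<kappa>' (a \<otimes>\<^bsub>A\<^esub> b) = \<kappa>' a \<otimes>\<^bsub>L'\<^esub> \<kappa>' b"
      using ab \<kappa>' by (auto intro!: eqI simp: h kappa_add kappa_mult)
  next
    show "inj_on \<kappa>' (carrier A)"
      using \<kappa>'(2) inj_onD[OF kappa_inj] by (intro inj_onI) metis
  next
    fix l assume l: "l \<in> carrier L'"
    obtain a where a: "a \<in> carrier A" "\<kappa> \<one>\<^bsub>A\<^esub> \<otimes>\<^bsub>L\<^esub> \<sigma> l \<otimes>\<^bsub>L\<^esub> \<kappa> \<one>\<^bsub>A\<^esub> = \<kappa> a"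
      using kappa_surj[OF h(3)[OF l]] by auto
    have "\<kappa>' \<one>\<^bsub>A\<^esub> \<otimes>\<^bsub>L'\<^esub> l \<otimes>\<^bsub>L'\<^esub> \<kappa>' \<one>\<^bsub>A\<^esub> = \<kappa>' a"
      using a l \<kappa>' by (intro eqI) (simp_all add: h)
    then show "\<kappa>' \<one>\<^bsub>A\<^esub> \<otimes>\<^bsub>L'\<^esub> l \<otimes>\<^bsub>L'\<^esub> \<kappa>' \<one>\<^bsub>A\<^esub> \<in> \<kappa>' ` carrier A" using a(1) by simp
  qed
qed

text \<open>
  Being induced from \<open>P\<close> is invariant under a ring isomorphism \<open>\<sigma>\<close> and a \<open>\<sigma>\<close>-semilinear bijection \<open>\<tau>\<close>.
  Interchanging the two rings of a Morita context is of this kind, and it turns \<open>T_B\<close> into \<open>T_A\<close>.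
\<close>

lemma induced_module_transport:
  assumes ind: "induced_module A L \<kappa> P T j" and L': "ring L'" and T': "left_module L' T'"
    and \<sigma>: "\<sigma> \<in> ring_iso L' L"
    and \<kappa>': "\<And>a. a \<in> carrier A \<Longrightarrow> \<kappa>' a \<in> carrier L'" "\<And>a. a \<in> carrier A \<Longrightarrow> \<sigma> (\<kappa>' a) = \<kappa> a"
    and \<tau>: "bij_betw \<tau> (carrier T') (carrier T)"
      "\<And>t u. \<lbrakk>t \<in> carrier T'; u \<in> carrier T'\<rbrakk> \<Longrightarrow> \<tau> (t \<oplus>\<^bsub>T'\<^esub> u) = \<tau> t \<oplus>\<^bsub>T\<^esub> \<tau> u"
      "\<And>l t. \<lbrakk>l \<in> carrier L'; t \<in> carrier T'\<rbrakk> \<Longrightarrow> \<tau> (l \<odot>\<^bsub>T'\<^esub> t) = \<sigma> l \<odot>\<^bsub>T\<^esub> \<tau> t"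
    and j': "\<And>x. x \<in> carrier P \<Longrightarrow> j' x \<in> carrier T'" "\<And>x. x \<in> carrier P \<Longrightarrow> \<tau> (j' x) = j x"
  shows "induced_module A L' \<kappa>' P T' j'"
proof -
  interpret induced_module A L \<kappa> P T j by fact
  interpret P: left_module A P by (rule module_P)
  interpret T: left_module L T by (rule module_T)
  interpret T': left_module L' T' by (rule T')
  have C: "corner A L' \<kappa>'" by (rule corner_transport[OF corner_axioms L' \<sigma> \<kappa>'])
  have s: "\<And>x y. x \<in> carrier L' \<Longrightarrow> y \<in> carrier L' \<Longrightarrow> \<sigma> (x \<otimes>\<^bsub>L'\<^esub> y) = \<sigma> x \<otimes>\<^bsub>L\<^esub> \<sigma> y"
    "\<And>x y. x \<in> carrier L' \<Longrightarrow> y \<in> carrier L' \<Longrightarrow> \<sigma> (x \<oplus>\<^bsub>L'\<^esub> y) = \<sigma> x \<oplus>\<^bsub>L\<^esub> \<sigma> y"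
    "\<And>x. x \<in> carrier L' \<Longrightarrow> \<sigma> x \<in> carrier L" and \<sigma>_bij: "bij_betw \<sigma> (carrier L') (carrier L)"
    using \<sigma> by (auto simp: ring_iso_def ring_hom_def)
  let ?\<rho> = "inv_into (carrier L') \<sigma>"
  have \<rho>: "?\<rho> l \<in> carrier L'" "\<sigma> (?\<rho> l) = l" if "l \<in> carrier L" for l
    using that \<sigma>_bij by (auto simp: bij_betw_def inv_into_into f_inv_into_f)
  have \<rho>\<sigma>: "?\<rho> (\<sigma> l) = l" if "l \<in> carrier L'" for l
    using that \<sigma>_bij by (auto simp: bij_betw_def)
  have \<tau>c: "\<tau> t \<in> carrier T" if "t \<in> carrier T'" for t using that \<tau>(1) by (auto simp: bij_betw_def)
  note eqI = inj_onD[OF bij_betw_imp_inj_on[OF \<tau>(1)]]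
  have o: "\<one>\<^bsub>A\<^esub> \<in> carrier A" by simp
  show ?thesis
  proof (intro induced_module.intro induced_module_axioms.intro C module_P T' j'(1))
    fix x y assume "x \<in> carrier P" "y \<in> carrier P"
    then show "j' (x \<oplus>\<^bsub>P\<^esub> y) = j' x \<oplus>\<^bsub>T'\<^esub> j' y"
      using j' by (intro eqI) (simp_all add: \<tau>(2) j_add)
  next
    fix a x assume "a \<in> carrier A" "x \<in> carrier P"
    then show "j' (a \<odot>\<^bsub>P\<^esub> x) = \<kappa>' a \<odot>\<^bsub>T'\<^esub> j' x"
      using j' \<kappa>' by (intro eqI) (simp_all add: \<tau>(3) j_smult T'.lsmult_closed P.lsmult_closed)
  next
    show "inj_on j' (carrier P)" using j'(2) inj_onD[OF j_inj] by (intro inj_onI) metis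
  next
    fix t assume t: "t \<in> carrier T'"
    obtain x where x: "\<kappa> \<one>\<^bsub>A\<^esub> \<odot>\<^bsub>T\<^esub> \<tau> t = j x" "x \<in> carrier P" using j_surj[OF \<tau>c[OF t]] by (rule imageE)
    have "\<kappa>' \<one>\<^bsub>A\<^esub> \<odot>\<^bsub>T'\<^esub> t = j' x"
      using t x j' \<kappa>'[OF o] by (intro eqI) (simp_all add: \<tau>(3) T'.lsmult_closed)
    then show "\<kappa>' \<one>\<^bsub>A\<^esub> \<odot>\<^bsub>T'\<^esub> t \<in> j' ` carrier P" using x(2) by simp
  next
    fix U assume U: "left_submodule L' T' U" and jU: "j' ` carrier P \<subseteq> U"
    note Uc = T'.left_submoduleD[OF U]
    have "\<tau> \<zero>\<^bsub>T'\<^esub> = \<zero>\<^bsub>T\<^esub>"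
      using \<tau>(2) \<tau>c
      by (intro additive_zero[OF T'.abelian_group_axioms T.abelian_group_axioms]) (auto simp: hom_def)
    then have "\<zero>\<^bsub>T\<^esub> \<in> \<tau> ` U" using Uc(2) by (metis imageI)
    moreover have "u \<oplus>\<^bsub>T\<^esub> v \<in> \<tau> ` U" if uv: "u \<in> \<tau> ` U" "v \<in> \<tau> ` U" for u v
    proof -
      obtain x where x: "u = \<tau> x" "x \<in> U" using uv(1) by (rule imageE)
      obtain y where y: "v = \<tau> y" "y \<in> U" using uv(2) by (rule imageE)
      have "u \<oplus>\<^bsub>T\<^esub> v = \<tau> (x \<oplus>\<^bsub>T'\<^esub> y)" using x y Uc(3) \<tau>(2) by simp
      then show ?thesis using Uc(4)[OF x(2) y(2)] by simp
    qed
    moreover have "l \<odot>\<^bsub>T\<^esub> u \<in> \<tau> ` U" if l: "l \<in> carrier L" and u: "u \<in> \<tau> ` U" for l u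
    proof -
      obtain x where x: "u = \<tau> x" "x \<in> U" using u by (rule imageE)
      have "l \<odot>\<^bsub>T\<^esub> u = \<tau> (?\<rho> l \<odot>\<^bsub>T'\<^esub> x)" using x Uc(3) \<rho>[OF l] \<tau>(3) by simp
      then show ?thesis using Uc(5)[OF \<rho>(1)[OF l] x(2)] by simp
    qed
    moreover have "\<tau> ` U \<subseteq> carrier T" using Uc(3) \<tau>c by auto
    ultimately have "left_submodule L T (\<tau> ` U)" unfolding T.left_submodule_iff by simp
    moreover have "j ` carrier P \<subseteq> \<tau> ` U"
    proof (rule image_subsetI)
      fix x assume x: "x \<in> carrier P"
      then have "j' x \<in> U" using jU by auto
      then show "j x \<in> \<tau> ` U" using j'(2)[OF x] by (metis imageI)
    qed
    ultimately have im: "\<tau> ` U = carrier T" by (rule generated)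
    have "t \<in> U" if t: "t \<in> carrier T'" for t
    proof -
      have "\<tau> t \<in> \<tau> ` U" unfolding im by (rule \<tau>c[OF t])
      then obtain u where u: "\<tau> t = \<tau> u" "u \<in> U" by (rule imageE)
      then show ?thesis using eqI[OF u(1) t Uc(3)[OF u(2)]] by simp
    qed
    then show "U = carrier T'" using Uc(1) by (intro equalityI subsetI) auto
  next
    fix \<chi> assume "\<chi> \<in> left_hom A P (regular_bimodule A)"
    then obtain F where F: "F \<in> left_hom L T (regular_bimodule L)" "\<And>x. x \<in> carrier P \<Longrightarrow> F (j x) = \<kappa> (\<chi> x)"
      and \<chi>c: "\<And>x. x \<in> carrier P \<Longrightarrow> \<chi> x \<in> carrier A"
      using extension functional_closed by metis
    note Fc = functional_closed[OF F(1)] and Fh = left_homD(2,3)[OF F(1), simplified regular_simps]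
    let ?F = "\<lambda>t. ?\<rho> (F (\<tau> t))"
    have "?F \<in> left_hom L' T' (regular_bimodule L')"
      unfolding left_hom_iff regular_simps
    proof (intro conjI ballI)
      fix t assume t: "t \<in> carrier T'"
      note ft = Fc[OF \<tau>c[OF t]]
      show "?F t \<in> carrier L'" by (rule \<rho>(1)[OF ft])
      show "?F (t \<oplus>\<^bsub>T'\<^esub> u) = ?F t \<oplus>\<^bsub>L'\<^esub> ?F u" if u: "u \<in> carrier T'" for u
      proof -
        note fu = Fc[OF \<tau>c[OF u]]
        have "F (\<tau> (t \<oplus>\<^bsub>T'\<^esub> u)) = \<sigma> (?F t \<oplus>\<^bsub>L'\<^esub> ?F u)"
          by (simp add: \<tau>(2)[OF t u] Fh(1)[OF \<tau>c[OF t] \<tau>c[OF u]] s(2)[OF \<rho>(1)[OF ft] \<rho>(1)[OF fu]] \<rho>(2) ft fu)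
        then show ?thesis using \<rho>\<sigma> \<rho>(1)[OF ft] \<rho>(1)[OF fu] by simp
      qed
      show "?F (l \<odot>\<^bsub>T'\<^esub> t) = l \<otimes>\<^bsub>L'\<^esub> ?F t" if l: "l \<in> carrier L'" for l
      proof -
        have "F (\<tau> (l \<odot>\<^bsub>T'\<^esub> t)) = \<sigma> (l \<otimes>\<^bsub>L'\<^esub> ?F t)"
          by (simp add: \<tau>(3)[OF l t] Fh(2)[OF s(3)[OF l] \<tau>c[OF t]] s(1)[OF l \<rho>(1)[OF ft]] \<rho>(2) ft)
        then show ?thesis using \<rho>\<sigma> \<rho>(1)[OF ft] l by simp
      qed
    qed
    moreover have "?F (j' x) = \<kappa>' (\<chi> x)" if x: "x \<in> carrier P" for x
      using \<rho>\<sigma>[OF \<kappa>'(1)[OF \<chi>c[OF x]]] by (simp add: j'(2)[OF x] F(2)[OF x] \<kappa>'(2)[OF \<chi>c[OF x]])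
    ultimately show "\<exists>F\<in>left_hom L' T' (regular_bimodule L'). \<forall>x\<in>carrier P. F (j' x) = \<kappa>' (\<chi> x)"
      by (intro bexI[of _ ?F]) simp_all
  qed
qed

section \<open>Tensor products\<close>

locale tensor_product =
  fixes A :: "'a ring" and M :: "('b, 'a, 'm, 'l1) bimodule_scheme" and X :: "('a, 'x, 'l2) module_scheme"
  assumes right_M: "right_module A M" and left_X: "left_module A X"
begin

abbreviation TG where "TG \<equiv> tensor_group A M X"
abbreviation te where "te \<equiv> tensor_elem A M X"

definition coset :: "('m \<times> 'x \<Rightarrow>\<^sub>0 int) \<Rightarrow> ('m, 'x) tensor"
  where "coset c = tensor_kernel A M X #>\<^bsub>tensor_free M X\<^esub> c"

lemma tensor_free_simps [simp]:
  "c \<in> carrier (tensor_free M X) \<longleftrightarrow> Poly_Mapping.keys c \<subseteq> carrier M \<times> carrier X"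
  "a \<otimes>\<^bsub>tensor_free M X\<^esub> b = a + b" "\<one>\<^bsub>tensor_free M X\<^esub> = 0"
  by (simp_all add: tensor_free_def)

lemma tensor_free_group: "comm_group (tensor_free M X)"
  by (simp add: tensor_free_def abelian_free_Abelian_group)

lemma keys_add_closed:
  "Poly_Mapping.keys a \<subseteq> S \<Longrightarrow> Poly_Mapping.keys b \<subseteq> S \<Longrightarrow> Poly_Mapping.keys (a + b) \<subseteq> S"
  for a b :: "'k \<Rightarrow>\<^sub>0 int"
  using Poly_Mapping.keys_add[of a b] by blast

lemma keys_diff_closed:
  "Poly_Mapping.keys a \<subseteq> S \<Longrightarrow> Poly_Mapping.keys b \<subseteq> S \<Longrightarrow> Poly_Mapping.keys (a - b) \<subseteq> S"
  for a b :: "'k \<Rightarrow>\<^sub>0 int"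
  using keys_diff[of a b] by blast

lemma free_add_closed:
  "a \<in> carrier (tensor_free M X) \<Longrightarrow> b \<in> carrier (tensor_free M X) \<Longrightarrow> a + b \<in> carrier (tensor_free M X)"
  unfolding tensor_free_simps(1) by (rule keys_add_closed)

lemma free_diff_closed:
  "a \<in> carrier (tensor_free M X) \<Longrightarrow> b \<in> carrier (tensor_free M X) \<Longrightarrow> a - b \<in> carrier (tensor_free M X)"
  unfolding tensor_free_simps(1) by (rule keys_diff_closed)

lemma relations_closed: "tensor_relations A M X \<subseteq> carrier (tensor_free M X)"
proof -
  interpret M: right_module A M by (rule right_M)
  interpret X: left_module A X by (rule left_X)
  have "Poly_Mapping.keys r \<subseteq> carrier M \<times> carrier X" if "r \<in> tensor_relations A M X" for r
    using that unfolding tensor_relations_def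
    by (elim UnE CollectE exE conjE; hypsubst; intro keys_diff_closed)
      (simp_all add: M.rsmult_closed X.lsmult_closed)
  then show ?thesis unfolding subset_iff[of "tensor_relations A M X"] tensor_free_simps(1) by metis
qed

lemma kernel_normal: "normal (tensor_kernel A M X) (tensor_free M X)"
  unfolding tensor_kernel_def
  by (intro comm_group.subgroup_imp_normal[OF tensor_free_group]
      group.generate_is_subgroup[OF comm_group.axioms(2)[OF tensor_free_group] relations_closed])

lemma coset_add:
  assumes "a \<in> carrier (tensor_free M X)" "b \<in> carrier (tensor_free M X)"
  shows "coset a \<oplus>\<^bsub>TG\<^esub> coset b = coset (a + b)"
  using normal.rcos_sum[OF kernel_normal assms]
  by (simp add: coset_def tensor_group_def Let_def FactGroup_def)

lemma coset_eqI:
  assumes "a \<in> carrier (tensor_free M X)" "b \<in> carrier (tensor_free M X)" "a - b \<in> tensor_kernel A M X"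
  shows "coset a = coset b"
proof -
  interpret normal "tensor_kernel A M X" "tensor_free M X" by (rule kernel_normal)
  have "a = (a - b) \<otimes>\<^bsub>tensor_free M X\<^esub> b" by simp
  then have "a \<in> coset b" unfolding coset_def r_coset_def using assms(3) by blast
  then show ?thesis
    unfolding coset_def using repr_independence assms(2) is_subgroup by metis
qed

lemma zero_tensor: "\<zero>\<^bsub>TG\<^esub> = coset 0"
proof -
  interpret normal "tensor_kernel A M X" "tensor_free M X" by (rule kernel_normal)
  have "tensor_kernel A M X #>\<^bsub>tensor_free M X\<^esub> \<one>\<^bsub>tensor_free M X\<^esub> = tensor_kernel A M X"
    using coset_mult_one subset by blast
  then show ?thesis by (simp add: coset_def tensor_group_def Let_def FactGroup_def)
qed

lemma carrier_tensor_group: "carrier TG = coset ` carrier (tensor_free M X)"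
  by (auto simp: tensor_group_def Let_def FactGroup_def RCOSETS_def coset_def)

lemma tensor_group_abelian: "abelian_group TG"
proof (rule abelian_groupI)
  note cl = free_add_closed
  show "\<zero>\<^bsub>TG\<^esub> \<in> carrier TG" unfolding carrier_tensor_group zero_tensor by (rule imageI) simp
  fix x assume "x \<in> carrier TG"
  then obtain a where a: "x = coset a" "a \<in> carrier (tensor_free M X)"
    unfolding carrier_tensor_group by (rule imageE)
  have z: "0 \<in> carrier (tensor_free M X)" and m: "- a \<in> carrier (tensor_free M X)" using a by auto
  show "\<zero>\<^bsub>TG\<^esub> \<oplus>\<^bsub>TG\<^esub> x = x" unfolding zero_tensor a(1) coset_add[OF z a(2)] by simp
  have "coset (- a) \<oplus>\<^bsub>TG\<^esub> x = \<zero>\<^bsub>TG\<^esub>" unfolding zero_tensor a(1) coset_add[OF m a(2)] by simp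
  moreover have "coset (- a) \<in> carrier TG" unfolding carrier_tensor_group using m by (rule imageI)
  ultimately show "\<exists>y\<in>carrier TG. y \<oplus>\<^bsub>TG\<^esub> x = \<zero>\<^bsub>TG\<^esub>" by metis
  fix y assume "y \<in> carrier TG"
  then obtain b where b: "y = coset b" "b \<in> carrier (tensor_free M X)"
    unfolding carrier_tensor_group by (rule imageE)
  show "x \<oplus>\<^bsub>TG\<^esub> y \<in> carrier TG"
    unfolding a(1) b(1) coset_add[OF a(2) b(2)] carrier_tensor_group using cl[OF a(2) b(2)] by (rule imageI)
  show "x \<oplus>\<^bsub>TG\<^esub> y = y \<oplus>\<^bsub>TG\<^esub> x"
    unfolding a(1) b(1) coset_add[OF a(2) b(2)] coset_add[OF b(2) a(2)] by (simp add: add.commute)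
  fix z assume "z \<in> carrier TG"
  then obtain d where d: "z = coset d" "d \<in> carrier (tensor_free M X)"
    unfolding carrier_tensor_group by (rule imageE)
  show "x \<oplus>\<^bsub>TG\<^esub> y \<oplus>\<^bsub>TG\<^esub> z = x \<oplus>\<^bsub>TG\<^esub> (y \<oplus>\<^bsub>TG\<^esub> z)"
    unfolding a(1) b(1) d(1) coset_add[OF a(2) b(2)] coset_add[OF b(2) d(2)]
      coset_add[OF cl[OF a(2) b(2)] d(2)] coset_add[OF a(2) cl[OF b(2) d(2)]]
    by (simp add: add.assoc)
qed

lemma te_coset: "te m x = coset (frag_of (m, x))"
  by (simp add: tensor_elem_def coset_def)

lemma te_closed: "m \<in> carrier M \<Longrightarrow> x \<in> carrier X \<Longrightarrow> te m x \<in> carrier TG"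
  unfolding te_coset carrier_tensor_group by (rule imageI) simp

lemma relation_in_kernel: "r \<in> tensor_relations A M X \<Longrightarrow> r \<in> tensor_kernel A M X"
  unfolding tensor_kernel_def by (rule generate.incl)

lemma te_add_left:
  assumes "m \<in> carrier M" "m' \<in> carrier M" "x \<in> carrier X"
  shows "te (m \<oplus>\<^bsub>M\<^esub> m') x = te m x \<oplus>\<^bsub>TG\<^esub> te m' x"
proof -
  interpret M: right_module A M by (rule right_M)
  have c: "frag_of (m, x) \<in> carrier (tensor_free M X)" "frag_of (m', x) \<in> carrier (tensor_free M X)"
    "frag_of (m \<oplus>\<^bsub>M\<^esub> m', x) \<in> carrier (tensor_free M X)" using assms by simp_all
  have "frag_of (m \<oplus>\<^bsub>M\<^esub> m', x) - frag_of (m, x) - frag_of (m', x) \<in> tensor_relations A M X"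
    unfolding tensor_relations_def using assms by blast
  from relation_in_kernel[OF this]
  have "frag_of (m \<oplus>\<^bsub>M\<^esub> m', x) - (frag_of (m, x) + frag_of (m', x)) \<in> tensor_kernel A M X"
    by (simp add: diff_diff_eq)
  moreover have "frag_of (m, x) + frag_of (m', x) \<in> carrier (tensor_free M X)" 
    by (rule free_add_closed[OF c(1,2)])
  ultimately show ?thesis
    unfolding te_coset coset_add[OF c(1,2)] by (intro coset_eqI c(3))
qed

lemma te_add_right:
  assumes "m \<in> carrier M" "x \<in> carrier X" "x' \<in> carrier X"
  shows "te m (x \<oplus>\<^bsub>X\<^esub> x') = te m x \<oplus>\<^bsub>TG\<^esub> te m x'"
proof -
  interpret X: left_module A X by (rule left_X)
  have c: "frag_of (m, x) \<in> carrier (tensor_free M X)" "frag_of (m, x') \<in> carrier (tensor_free M X)"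
    "frag_of (m, x \<oplus>\<^bsub>X\<^esub> x') \<in> carrier (tensor_free M X)" using assms by simp_all
  have "frag_of (m, x \<oplus>\<^bsub>X\<^esub> x') - frag_of (m, x) - frag_of (m, x') \<in> tensor_relations A M X"
    unfolding tensor_relations_def using assms by blast
  from relation_in_kernel[OF this]
  have "frag_of (m, x \<oplus>\<^bsub>X\<^esub> x') - (frag_of (m, x) + frag_of (m, x')) \<in> tensor_kernel A M X"
    by (simp add: diff_diff_eq)
  moreover have "frag_of (m, x) + frag_of (m, x') \<in> carrier (tensor_free M X)" 
    by (rule free_add_closed[OF c(1,2)])
  ultimately show ?thesis
    unfolding te_coset coset_add[OF c(1,2)] by (intro coset_eqI c(3))
qed

lemma te_balanced:
  assumes "m \<in> carrier M" "a \<in> carrier A" "x \<in> carrier X"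
  shows "te (m \<lhd>\<^bsub>M\<^esub> a) x = te m (a \<odot>\<^bsub>X\<^esub> x)"
proof -
  interpret M: right_module A M by (rule right_M)
  interpret X: left_module A X by (rule left_X)
  have "frag_of (m \<lhd>\<^bsub>M\<^esub> a, x) - frag_of (m, a \<odot>\<^bsub>X\<^esub> x) \<in> tensor_relations A M X"
    unfolding tensor_relations_def using assms by blast
  then show ?thesis
    unfolding te_coset using assms
    by (intro coset_eqI relation_in_kernel) (simp_all add: M.rsmult_closed X.lsmult_closed)
qed

lemma te_zero_left: "x \<in> carrier X \<Longrightarrow> te \<zero>\<^bsub>M\<^esub> x = \<zero>\<^bsub>TG\<^esub>"
proof -
  assume x: "x \<in> carrier X"
  interpret M: right_module A M by (rule right_M)
  interpret T: abelian_group TG by (rule tensor_group_abelian)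
  have "te \<zero>\<^bsub>M\<^esub> x \<oplus>\<^bsub>TG\<^esub> te \<zero>\<^bsub>M\<^esub> x = te \<zero>\<^bsub>M\<^esub> x" using te_add_left[of "\<zero>\<^bsub>M\<^esub>" "\<zero>\<^bsub>M\<^esub>" x] x by simp
  then show ?thesis using te_closed[of "\<zero>\<^bsub>M\<^esub>" x] x by (simp add: T.add.l_cancel_one)
qed

lemma te_zero_right: "m \<in> carrier M \<Longrightarrow> te m \<zero>\<^bsub>X\<^esub> = \<zero>\<^bsub>TG\<^esub>"
proof -
  assume m: "m \<in> carrier M"
  interpret X: left_module A X by (rule left_X)
  interpret T: abelian_group TG by (rule tensor_group_abelian)
  have "te m \<zero>\<^bsub>X\<^esub> \<oplus>\<^bsub>TG\<^esub> te m \<zero>\<^bsub>X\<^esub> = te m \<zero>\<^bsub>X\<^esub>" using te_add_right[of m "\<zero>\<^bsub>X\<^esub>" "\<zero>\<^bsub>X\<^esub>"] m by simp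
  then show ?thesis using te_closed[of m "\<zero>\<^bsub>X\<^esub>"] m by (simp add: T.add.l_cancel_one)
qed

lemma te_minus: "m \<in> carrier M \<Longrightarrow> x \<in> carrier X \<Longrightarrow> coset (- frag_of (m, x)) = te (\<ominus>\<^bsub>M\<^esub> m) x"
proof -
  assume m: "m \<in> carrier M" and x: "x \<in> carrier X"
  interpret M: right_module A M by (rule right_M)
  interpret T: abelian_group TG by (rule tensor_group_abelian)
  have c: "- frag_of (m, x) \<in> carrier (tensor_free M X)" "frag_of (m, x) \<in> carrier (tensor_free M X)"
    using m x by simp_all
  have "coset (- frag_of (m, x)) \<oplus>\<^bsub>TG\<^esub> te m x = \<zero>\<^bsub>TG\<^esub>"
    unfolding te_coset coset_add[OF c] zero_tensor by simp
  moreover have "te (\<ominus>\<^bsub>M\<^esub> m) x \<oplus>\<^bsub>TG\<^esub> te m x = \<zero>\<^bsub>TG\<^esub>"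
    using te_add_left[of "\<ominus>\<^bsub>M\<^esub> m" m x] m x te_zero_left[OF x] by (simp add: M.l_neg)
  moreover have "coset (- frag_of (m, x)) \<in> carrier TG"
    unfolding carrier_tensor_group using c(1) by (rule imageI)
  ultimately show ?thesis
    using te_closed[OF m x] te_closed[OF M.a_inv_closed[OF m] x] T.minus_equality by metis
qed

text \<open>
  Pure tensors generate the tensor product already under addition, as \<open>- (m \<otimes> x) = (- m) \<otimes> x\<close>.
\<close>

lemma tensor_induct [consumes 1, case_names zero elem add]:
  assumes t: "t \<in> carrier TG" and zero: "Q \<zero>\<^bsub>TG\<^esub>"
    and elem: "\<And>m x. m \<in> carrier M \<Longrightarrow> x \<in> carrier X \<Longrightarrow> Q (te m x)"
    and add: "\<And>t u. t \<in> carrier TG \<Longrightarrow> u \<in> carrier TG \<Longrightarrow> Q t \<Longrightarrow> Q u \<Longrightarrow> Q (t \<oplus>\<^bsub>TG\<^esub> u)"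
  shows "Q t"
proof -
  interpret M: right_module A M by (rule right_M)
  obtain c where c: "t = coset c" "c \<in> carrier (tensor_free M X)"
    using t unfolding carrier_tensor_group by (rule imageE)
  have "Poly_Mapping.keys c \<subseteq> carrier M \<times> carrier X" using c(2) by simp
  then have "Q (coset c) \<and> Q (coset (- c))"
  proof (induction c rule: free_Abelian_group_induct[consumes 1, case_names zero diff elem])
    case zero
    then show ?case using assms(2) by (simp add: zero_tensor)
  next
    case (diff a b)
    then have ab: "a \<in> carrier (tensor_free M X)" "b \<in> carrier (tensor_free M X)"
      "- a \<in> carrier (tensor_free M X)" "- b \<in> carrier (tensor_free M X)" by simp_all
    then have cab: "coset a \<in> carrier TG" "coset b \<in> carrier TG"
      "coset (- a) \<in> carrier TG" "coset (- b) \<in> carrier TG"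
      unfolding carrier_tensor_group using imageI by metis+
    have "coset (a - b) = coset a \<oplus>\<^bsub>TG\<^esub> coset (- b)" unfolding coset_add[OF ab(1,4)] by simp
    moreover have "coset (- (a - b)) = coset (- a) \<oplus>\<^bsub>TG\<^esub> coset b" unfolding coset_add[OF ab(3,2)] by simp
    ultimately show ?case using diff add[OF cab(1,4)] add[OF cab(3,2)] by simp
  next
    case (elem p)
    then obtain m x where "p = (m, x)" "m \<in> carrier M" "x \<in> carrier X" by auto
    then show ?case using assms(3)[of m x] assms(3)[of "\<ominus>\<^bsub>M\<^esub> m" x] te_minus[of m x] by (simp add: te_coset)
  qed
  then show ?thesis using c(1) by simp
qed

definition balanced :: "('y, 'k) ring_scheme \<Rightarrow> ('m \<Rightarrow> 'x \<Rightarrow> 'y) \<Rightarrow> bool"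
  where "balanced Y \<beta> \<longleftrightarrow>
    (\<forall>m\<in>carrier M. \<forall>x\<in>carrier X. \<beta> m x \<in> carrier Y) \<and>
    (\<forall>m\<in>carrier M. \<forall>m'\<in>carrier M. \<forall>x\<in>carrier X. \<beta> (m \<oplus>\<^bsub>M\<^esub> m') x = \<beta> m x \<oplus>\<^bsub>Y\<^esub> \<beta> m' x) \<and>
    (\<forall>m\<in>carrier M. \<forall>x\<in>carrier X. \<forall>x'\<in>carrier X. \<beta> m (x \<oplus>\<^bsub>X\<^esub> x') = \<beta> m x \<oplus>\<^bsub>Y\<^esub> \<beta> m x') \<and>
    (\<forall>m\<in>carrier M. \<forall>a\<in>carrier A. \<forall>x\<in>carrier X. \<beta> (m \<lhd>\<^bsub>M\<^esub> a) x = \<beta> m (a \<odot>\<^bsub>X\<^esub> x))"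

text \<open>
  The value of \<open>tensor_lift Y \<beta>\<close> on a tensor, computed from a representative \<open>c\<close>.
\<close>

definition free_lift :: "('y, 'k) ring_scheme \<Rightarrow> ('m \<Rightarrow> 'x \<Rightarrow> 'y) \<Rightarrow> ('m \<times> 'x \<Rightarrow>\<^sub>0 int) \<Rightarrow> 'y"
  where "free_lift Y \<beta> c = (\<Oplus>\<^bsub>Y\<^esub>p\<in>Poly_Mapping.keys c. [Poly_Mapping.lookup c p] \<cdot>\<^bsub>Y\<^esub> \<beta> (fst p) (snd p))"

lemma free_lift_superset:
  fixes Y (structure)
  assumes Y: "abelian_group Y" and bal: "balanced Y \<beta>"
    and "finite I" "Poly_Mapping.keys c \<subseteq> I" "I \<subseteq> carrier M \<times> carrier X"
  shows "free_lift Y \<beta> c = (\<Oplus>p\<in>I. [Poly_Mapping.lookup c p] \<cdot> \<beta> (fst p) (snd p))"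
proof -
  interpret Y: abelian_group Y by fact
  have \<beta>: "\<And>m x. m \<in> carrier M \<Longrightarrow> x \<in> carrier X \<Longrightarrow> \<beta> m x \<in> carrier Y"
    using bal by (simp add: balanced_def)
  show ?thesis
    unfolding free_lift_def
  proof (rule Y.add.finprod_mono_neutral_cong_left)
    show "\<And>p. p \<in> I - Poly_Mapping.keys c \<Longrightarrow> [Poly_Mapping.lookup c p] \<cdot> \<beta> (fst p) (snd p) = \<zero>"
      by (simp add: in_keys_iff add_pow_def)
    show "(\<lambda>p. [Poly_Mapping.lookup c p] \<cdot> \<beta> (fst p) (snd p)) \<in> I \<rightarrow> carrier Y"
      using assms(5) \<beta> by (auto intro!: Y.add.int_pow_closed)
  qed (use assms in auto)
qed

lemma free_lift_hom:
  fixes Y (structure)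
  assumes Y: "abelian_group Y" and bal: "balanced Y \<beta>"
  shows "free_lift Y \<beta> \<in> hom (tensor_free M X) (add_monoid Y)"
    and "\<And>m x. m \<in> carrier M \<Longrightarrow> x \<in> carrier X \<Longrightarrow> free_lift Y \<beta> (frag_of (m, x)) = \<beta> m x"
proof -
  interpret Y: abelian_group Y by fact
  have \<beta>: "\<And>m x. m \<in> carrier M \<Longrightarrow> x \<in> carrier X \<Longrightarrow> \<beta> m x \<in> carrier Y"
    using bal by (simp add: balanced_def)
  have cl: "(\<lambda>p. [Poly_Mapping.lookup c p] \<cdot> \<beta> (fst p) (snd p)) \<in> I \<rightarrow> carrier Y"
    if "I \<subseteq> carrier M \<times> carrier X" for I and c :: "'m \<times> 'x \<Rightarrow>\<^sub>0 int"
    using that \<beta> by (auto intro!: Y.add.int_pow_closed)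
  show "free_lift Y \<beta> \<in> hom (tensor_free M X) (add_monoid Y)"
  proof (rule homI)
    fix c assume c: "c \<in> carrier (tensor_free M X)"
    then show "free_lift Y \<beta> c \<in> carrier (add_monoid Y)"
      using Y.finsum_closed[OF cl] by (simp add: free_lift_def)
    fix d assume d: "d \<in> carrier (tensor_free M X)"
    let ?I = "Poly_Mapping.keys c \<union> Poly_Mapping.keys d"
    have I: "finite ?I" "?I \<subseteq> carrier M \<times> carrier X" using c d by auto
    have sum: "free_lift Y \<beta> (c + d) = (\<Oplus>p\<in>?I. [Poly_Mapping.lookup (c + d) p] \<cdot> \<beta> (fst p) (snd p))"
      "free_lift Y \<beta> c = (\<Oplus>p\<in>?I. [Poly_Mapping.lookup c p] \<cdot> \<beta> (fst p) (snd p))"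
      "free_lift Y \<beta> d = (\<Oplus>p\<in>?I. [Poly_Mapping.lookup d p] \<cdot> \<beta> (fst p) (snd p))"
      using Poly_Mapping.keys_add[of c d] by (intro free_lift_superset[OF Y bal I(1) _ I(2)]; auto)+
    have "free_lift Y \<beta> (c + d) = (\<Oplus>p\<in>?I. [Poly_Mapping.lookup c p] \<cdot> \<beta> (fst p) (snd p)
        \<oplus> [Poly_Mapping.lookup d p] \<cdot> \<beta> (fst p) (snd p))"
      unfolding sum(1)
    proof (rule Y.finsum_cong')
      fix p assume "p \<in> ?I"
      then have "\<beta> (fst p) (snd p) \<in> carrier Y" using I(2) \<beta> by auto
      then show "[Poly_Mapping.lookup (c + d) p] \<cdot> \<beta> (fst p) (snd p) =
        [Poly_Mapping.lookup c p] \<cdot> \<beta> (fst p) (snd p) \<oplus> [Poly_Mapping.lookup d p] \<cdot> \<beta> (fst p) (snd p)"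
        by (simp add: lookup_add Y.add.int_pow_mult)
    qed (use cl[OF I(2)] in \<open>auto intro!: Y.a_closed simp: Pi_iff\<close>)
    also have "\<dots> = free_lift Y \<beta> c \<oplus> free_lift Y \<beta> d"
      unfolding sum(2,3) by (rule Y.finsum_addf[OF cl[OF I(2)] cl[OF I(2)]])
    finally show "free_lift Y \<beta> (c \<otimes>\<^bsub>tensor_free M X\<^esub> d) =
        free_lift Y \<beta> c \<otimes>\<^bsub>add_monoid Y\<^esub> free_lift Y \<beta> d" by simp
  qed
  show "free_lift Y \<beta> (frag_of (m, x)) = \<beta> m x" if "m \<in> carrier M" "x \<in> carrier X" for m x
    using that \<beta> Y.finsum_insert[of "{}" "(m, x)"]
    by (simp add: free_lift_def Y.add.int_pow_1)
qed

text \<open>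
  On formal sums the lift is a homomorphism that kills the defining relations, so it is constant on
  every coset of the subgroup they generate.
\<close>

lemma tensor_lift_coset:
  fixes Y (structure)
  assumes Y: "abelian_group Y" and \<beta>: "balanced Y \<beta>" and c: "c \<in> carrier (tensor_free M X)"
  shows "tensor_lift Y \<beta> (coset c) = free_lift Y \<beta> c"
proof -
  interpret Y: abelian_group Y by fact
  interpret M: right_module A M by (rule right_M)
  interpret X: left_module A X by (rule left_X)
  interpret F: comm_group "tensor_free M X" by (rule tensor_free_group)
  have bc: "\<And>m x. m \<in> carrier M \<Longrightarrow> x \<in> carrier X \<Longrightarrow> \<beta> m x \<in> carrier Y"
    using \<beta> by (simp add: balanced_def)
  interpret h: group_hom "tensor_free M X" "add_monoid Y" "free_lift Y \<beta>"
    using free_lift_hom(1)[OF Y \<beta>] F.group_axioms Y.a_group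
    by (simp add: group_hom_def group_hom_axioms_def)
  note elem = free_lift_hom(2)[OF Y \<beta>]
  have diff: "free_lift Y \<beta> (a - b) = free_lift Y \<beta> a \<ominus> free_lift Y \<beta> b"
    and dc: "a - b \<in> carrier (tensor_free M X)"
    if "a \<in> carrier (tensor_free M X)" "b \<in> carrier (tensor_free M X)" for a b
  proof -
    have m: "- b \<in> carrier (tensor_free M X)" "inv\<^bsub>tensor_free M X\<^esub> b = - b"
      using that by (simp_all add: tensor_free_def)
    show "free_lift Y \<beta> (a - b) = free_lift Y \<beta> a \<ominus> free_lift Y \<beta> b"
      using h.hom_mult[OF that(1) m(1)] h.hom_inv[OF that(2)] unfolding m(2)
      by (simp add: a_minus_def a_inv_def)
    show "a - b \<in> carrier (tensor_free M X)" by (rule free_diff_closed[OF that])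
  qed
  have fr: "frag_of (m, x) \<in> carrier (tensor_free M X)" if "m \<in> carrier M" "x \<in> carrier X" for m x
    using that by simp
  have sub: "(y \<oplus> z) \<ominus> y \<ominus> z = \<zero>" "y \<ominus> y = \<zero>"
    if "y \<in> carrier Y" "z \<in> carrier Y" for y z
  proof -
    show "y \<ominus> y = \<zero>" using that by (simp add: a_minus_def Y.r_neg)
    have "(y \<oplus> z) \<ominus> y \<ominus> z = (y \<oplus> \<ominus> y) \<oplus> (z \<oplus> \<ominus> z)"
      using that by (simp add: a_minus_def Y.a_ac del: Y.r_neg Y.l_neg Y.add.r_inv Y.add.l_inv)
    then show "(y \<oplus> z) \<ominus> y \<ominus> z = \<zero>" using that by (simp add: Y.r_neg)
  qed
  have "tensor_relations A M X \<subseteq> kernel (tensor_free M X) (add_monoid Y) (free_lift Y \<beta>)"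
  proof
    fix r assume r: "r \<in> tensor_relations A M X"
    have "free_lift Y \<beta> r = \<zero>"
      using r unfolding tensor_relations_def
    proof (elim UnE CollectE exE conjE)
      fix m m' x
      assume *: "r = frag_of (m \<oplus>\<^bsub>M\<^esub> m', x) - frag_of (m, x) - frag_of (m', x)"
        "m \<in> carrier M" "m' \<in> carrier M" "x \<in> carrier X"
      then have "\<beta> (m \<oplus>\<^bsub>M\<^esub> m') x = \<beta> m x \<oplus> \<beta> m' x" using \<beta> unfolding balanced_def by blast
      then show ?thesis
        using * sub(1)[OF bc[of m x] bc[of m' x]] by (simp only: diff dc fr elem M.a_closed)
    next
      fix m x x'
      assume *: "r = frag_of (m, x \<oplus>\<^bsub>X\<^esub> x') - frag_of (m, x) - frag_of (m, x')"
        "m \<in> carrier M" "x \<in> carrier X" "x' \<in> carrier X"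
      then have "\<beta> m (x \<oplus>\<^bsub>X\<^esub> x') = \<beta> m x \<oplus> \<beta> m x'" using \<beta> unfolding balanced_def by blast
      then show ?thesis
        using * sub(1)[OF bc[of m x] bc[of m x']] by (simp only: diff dc fr elem X.a_closed)
    next
      fix m a x
      assume *: "r = frag_of (m \<lhd>\<^bsub>M\<^esub> a, x) - frag_of (m, a \<odot>\<^bsub>X\<^esub> x)"
        "m \<in> carrier M" "a \<in> carrier A" "x \<in> carrier X"
      then have "\<beta> (m \<lhd>\<^bsub>M\<^esub> a) x = \<beta> m (a \<odot>\<^bsub>X\<^esub> x)" using \<beta> unfolding balanced_def by blast
      then show ?thesis
        using * sub(2)[OF bc[of m "a \<odot>\<^bsub>X\<^esub> x"] bc[of m "a \<odot>\<^bsub>X\<^esub> x"]]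
        by (simp only: diff dc fr elem M.rsmult_closed X.lsmult_closed)
    qed
    then show "r \<in> kernel (tensor_free M X) (add_monoid Y) (free_lift Y \<beta>)"
      using subsetD[OF relations_closed r] by (simp add: kernel_def)
  qed
  from F.generate_subgroup_incl[OF this h.subgroup_kernel]
  have K: "tensor_kernel A M X \<subseteq> kernel (tensor_free M X) (add_monoid Y) (free_lift Y \<beta>)"
    unfolding tensor_kernel_def .
  have im: "free_lift Y \<beta> ` coset c = {free_lift Y \<beta> c}"
  proof (intro equalityI subsetI)
    fix y assume "y \<in> free_lift Y \<beta> ` coset c"
    then obtain k where k: "k \<in> tensor_kernel A M X" "y = free_lift Y \<beta> (k + c)"
      by (auto simp: coset_def r_coset_def)
    then have "free_lift Y \<beta> k = \<zero>" "k \<in> carrier (tensor_free M X)" using K by (auto simp: kernel_def)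
    then have "y = \<zero> \<oplus> free_lift Y \<beta> c" using h.hom_mult[of k c] c k(2) by simp
    moreover have "free_lift Y \<beta> c \<in> carrier Y" using h.hom_closed[OF c] by simp
    ultimately show "y \<in> {free_lift Y \<beta> c}" by simp
  next
    fix y assume y: "y \<in> {free_lift Y \<beta> c}"
    have "c \<in> coset c"
      using F.rcos_self[OF c normal.axioms(1)[OF kernel_normal]] by (simp add: coset_def)
    then show "y \<in> free_lift Y \<beta> ` coset c" using y by simp
  qed
  then show ?thesis
    unfolding tensor_lift_def free_lift_def[abs_def] by simp
qed

lemma tensor_lift_hom:
  fixes Y (structure)
  assumes Y: "abelian_group Y" and \<beta>: "balanced Y \<beta>"
  shows "t \<in> carrier TG \<Longrightarrow> tensor_lift Y \<beta> t \<in> carrier Y"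
    and "\<lbrakk>t \<in> carrier TG; u \<in> carrier TG\<rbrakk> \<Longrightarrow>
      tensor_lift Y \<beta> (t \<oplus>\<^bsub>TG\<^esub> u) = tensor_lift Y \<beta> t \<oplus> tensor_lift Y \<beta> u"
    and "\<lbrakk>m \<in> carrier M; x \<in> carrier X\<rbrakk> \<Longrightarrow> tensor_lift Y \<beta> (te m x) = \<beta> m x"
    and "tensor_lift Y \<beta> \<zero>\<^bsub>TG\<^esub> = \<zero>"
proof -
  interpret Y: abelian_group Y by fact
  interpret T: abelian_group TG by (rule tensor_group_abelian)
  have bc: "\<And>m x. m \<in> carrier M \<Longrightarrow> x \<in> carrier X \<Longrightarrow> \<beta> m x \<in> carrier Y"
    using \<beta> by (simp add: balanced_def)
  note h = free_lift_hom[OF Y \<beta>] and l = tensor_lift_coset[OF Y \<beta>]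
  show closed: "tensor_lift Y \<beta> t \<in> carrier Y" if t: "t \<in> carrier TG" for t
  proof -
    obtain c where c: "t = coset c" "c \<in> carrier (tensor_free M X)"
      using t unfolding carrier_tensor_group by (rule imageE)
    show ?thesis unfolding c(1) l[OF c(2)] using hom_in_carrier[OF h(1) c(2)] by simp
  qed
  show add: "tensor_lift Y \<beta> (t \<oplus>\<^bsub>TG\<^esub> u) = tensor_lift Y \<beta> t \<oplus> tensor_lift Y \<beta> u"
    if t: "t \<in> carrier TG" and u: "u \<in> carrier TG" for t u
  proof -
    obtain c where c: "t = coset c" "c \<in> carrier (tensor_free M X)"
      using t unfolding carrier_tensor_group by (rule imageE)
    obtain d where d: "u = coset d" "d \<in> carrier (tensor_free M X)"
      using u unfolding carrier_tensor_group by (rule imageE)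
    have cd: "c + d \<in> carrier (tensor_free M X)" by (rule free_add_closed[OF c(2) d(2)])
    show ?thesis
      unfolding c(1) d(1) coset_add[OF c(2) d(2)] l[OF c(2)] l[OF d(2)] l[OF cd]
      using hom_mult[OF h(1) c(2) d(2)] by simp
  qed
  show "tensor_lift Y \<beta> (te m x) = \<beta> m x" if "m \<in> carrier M" "x \<in> carrier X" for m x
  proof -
    have "frag_of (m, x) \<in> carrier (tensor_free M X)" using that by simp
    then show ?thesis unfolding te_coset using l h(2)[OF that] by metis
  qed
  have "tensor_lift Y \<beta> \<in> hom (add_monoid TG) (add_monoid Y)"
    using closed add by (simp add: hom_def Pi_iff)
  then show "tensor_lift Y \<beta> \<zero>\<^bsub>TG\<^esub> = \<zero>" by (rule additive_zero[OF tensor_group_abelian Y])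
qed

lemma tensor_simps [simp]:
  "carrier (tensor A M X) = carrier TG" "ring.zero (tensor A M X) = \<zero>\<^bsub>TG\<^esub>"
  "ring.add (tensor A M X) = (\<oplus>\<^bsub>TG\<^esub>)"
  "smult (tensor A M X) = (\<lambda>b. tensor_lift TG (\<lambda>m x. te (b \<odot>\<^bsub>M\<^esub> m) x))"
  by (simp_all add: tensor_def ring.defs module.defs)

end

locale bimodule_tensor_product =
  fixes B :: "'b ring" and A :: "'a ring" and M :: "('b, 'a, 'm, 'l1) bimodule_scheme"
    and X :: "('a, 'x, 'l2) module_scheme"
  assumes bimodule_M: "bimodule B A M" and X: "left_module A X"

sublocale bimodule_tensor_product \<subseteq> tensor_product A M X
  using bimodule_M X by (simp add: tensor_product_def bimodule_def)

context bimodule_tensor_product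
begin

lemma left_M: "left_module B M"
  using bimodule_M by (simp add: bimodule_def)

lemma balanced_smult: "b \<in> carrier B \<Longrightarrow> balanced TG (\<lambda>m x. te (b \<odot>\<^bsub>M\<^esub> m) x)"
proof -
  assume b: "b \<in> carrier B"
  interpret M: left_module B M by (rule left_M)
  interpret rM: right_module A M by (rule right_M)
  interpret X: left_module A X by (rule left_X)
  show ?thesis
    unfolding balanced_def
  proof (intro conjI ballI)
    fix m a x assume *: "m \<in> carrier M" "a \<in> carrier A" "x \<in> carrier X"
    then have "b \<odot>\<^bsub>M\<^esub> (m \<lhd>\<^bsub>M\<^esub> a) = (b \<odot>\<^bsub>M\<^esub> m) \<lhd>\<^bsub>M\<^esub> a" using bimodule.assoc[OF bimodule_M b] by simp
    then show "te (b \<odot>\<^bsub>M\<^esub> (m \<lhd>\<^bsub>M\<^esub> a)) x = te (b \<odot>\<^bsub>M\<^esub> m) (a \<odot>\<^bsub>X\<^esub> x)"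
      using te_balanced[OF M.lsmult_closed[OF b *(1)] *(2,3)] by simp
  qed (use b in \<open>simp_all add: te_closed te_add_left te_add_right M.lsmult_closed M.lsmult_r_distr\<close>)
qed

lemma smult_elem:
  assumes "b \<in> carrier B" "m \<in> carrier M" "x \<in> carrier X"
  shows "b \<odot>\<^bsub>tensor A M X\<^esub> te m x = te (b \<odot>\<^bsub>M\<^esub> m) x"
  using tensor_lift_hom(3)[OF tensor_group_abelian balanced_smult[OF assms(1)] assms(2,3)] by simp

lemma tensor_left_module: "left_module B (tensor A M X)"
proof -
  interpret M: left_module B M by (rule left_M)
  interpret X: left_module A X by (rule left_X)
  interpret T: abelian_group TG by (rule tensor_group_abelian)
  note s = tensor_lift_hom[OF tensor_group_abelian balanced_smult]
  have "abelian_group (tensor A M X)"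
  proof (rule abelian_groupI)
    fix t assume "t \<in> carrier (tensor A M X)"
    then show "\<exists>u\<in>carrier (tensor A M X). u \<oplus>\<^bsub>tensor A M X\<^esub> t = \<zero>\<^bsub>tensor A M X\<^esub>"
      by (intro bexI[of _ "\<ominus>\<^bsub>TG\<^esub> t"]) (simp_all add: T.l_neg)
  qed (simp_all add: T.a_ac)
  moreover have "left_module_axioms B (tensor A M X)"
  proof
    fix a b t assume a: "a \<in> carrier B" and b: "b \<in> carrier B" and "t \<in> carrier (tensor A M X)"
    then have t: "t \<in> carrier TG" by simp
    have ab: "a \<oplus>\<^bsub>B\<^esub> b \<in> carrier B" "a \<otimes>\<^bsub>B\<^esub> b \<in> carrier B" using a b by auto
    from t show "(a \<oplus>\<^bsub>B\<^esub> b) \<odot>\<^bsub>tensor A M X\<^esub> t = a \<odot>\<^bsub>tensor A M X\<^esub> t \<oplus>\<^bsub>tensor A M X\<^esub> b \<odot>\<^bsub>tensor A M X\<^esub> t"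
    proof (induction rule: tensor_induct)
      case zero
      then show ?case using s(4)[OF a] s(4)[OF b] s(4)[OF ab(1)] by simp
    next
      case (elem m x)
      then show ?case unfolding tensor_simps(3)
        by (simp only: smult_elem[OF a] smult_elem[OF b] smult_elem[OF ab(1)] M.lsmult_l_distr[OF a b]
            te_add_left M.lsmult_closed[OF a] M.lsmult_closed[OF b])
    next
      case (add t u)
      then show ?case
        using s(1)[OF a] s(1)[OF b] by (simp add: s(2)[OF a] s(2)[OF b] s(2)[OF ab(1)] T.a_ac)
    qed
    from t show "(a \<otimes>\<^bsub>B\<^esub> b) \<odot>\<^bsub>tensor A M X\<^esub> t = a \<odot>\<^bsub>tensor A M X\<^esub> (b \<odot>\<^bsub>tensor A M X\<^esub> t)"
    proof (induction rule: tensor_induct)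
      case zero
      then show ?case using s(4)[OF a] s(4)[OF b] s(4)[OF ab(2)] by simp
    next
      case (elem m x)
      then show ?case
        by (simp only: smult_elem[OF a] smult_elem[OF b] smult_elem[OF ab(2)] M.lsmult_assoc[OF a b]
            M.lsmult_closed[OF b])
    next
      case (add t u)
      then show ?case
        using s(1)[OF a] s(1)[OF b] by (simp add: s(2)[OF a] s(2)[OF b] s(2)[OF ab(2)])
    qed
  next
    fix b t assume b: "b \<in> carrier B" and "t \<in> carrier (tensor A M X)"
    then show "b \<odot>\<^bsub>tensor A M X\<^esub> t \<in> carrier (tensor A M X)" using s(1)[OF b] by simp
  next
    fix b t u assume b: "b \<in> carrier B" and "t \<in> carrier (tensor A M X)" "u \<in> carrier (tensor A M X)"
    then show "b \<odot>\<^bsub>tensor A M X\<^esub> (t \<oplus>\<^bsub>tensor A M X\<^esub> u) =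
        b \<odot>\<^bsub>tensor A M X\<^esub> t \<oplus>\<^bsub>tensor A M X\<^esub> b \<odot>\<^bsub>tensor A M X\<^esub> u" using s(2)[OF b] by simp
  next
    fix t assume "t \<in> carrier (tensor A M X)"
    then have t: "t \<in> carrier TG" by simp
    have o: "\<one>\<^bsub>B\<^esub> \<in> carrier B" by simp
    from t show "\<one>\<^bsub>B\<^esub> \<odot>\<^bsub>tensor A M X\<^esub> t = t"
    proof (induction rule: tensor_induct)
      case zero
      then show ?case using s(4)[OF o] by simp
    next
      case (elem m x)
      then show ?case by (simp only: smult_elem[OF o] M.lsmult_one)
    next
      case (add t u)
      then show ?case by (simp add: s(2)[OF o])
    qed
  qed
  ultimately show ?thesis using M.R.ring_axioms by (simp add: left_module_def)
qed

lemma tensor_module_induct [consumes 1, case_names zero elem add]: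
  assumes "t \<in> carrier (tensor A M X)" and "Q \<zero>\<^bsub>tensor A M X\<^esub>"
    and "\<And>m x. m \<in> carrier M \<Longrightarrow> x \<in> carrier X \<Longrightarrow> Q (te m x)"
    and "\<And>t u. t \<in> carrier (tensor A M X) \<Longrightarrow> u \<in> carrier (tensor A M X) \<Longrightarrow> Q t \<Longrightarrow> Q u \<Longrightarrow>
      Q (t \<oplus>\<^bsub>tensor A M X\<^esub> u)"
  shows "Q t"
  using tensor_induct[of t Q] assms by simp

text \<open>
  On pure tensors a linear map \<open>f\<close> becomes a balanced pairing. Computations with tuples use the
  structure maps only through these rules.
\<close>

lemma left_hom_elem:
  fixes Y (structure)
  assumes Y: "left_module B Y" and f: "f \<in> left_hom B (tensor A M X) Y"
  shows "\<lbrakk>m \<in> carrier M; x \<in> carrier X\<rbrakk> \<Longrightarrow> f (te m x) \<in> carrier Y"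
    and "\<lbrakk>m \<in> carrier M; m' \<in> carrier M; x \<in> carrier X\<rbrakk> \<Longrightarrow>
      f (te (m \<oplus>\<^bsub>M\<^esub> m') x) = f (te m x) \<oplus> f (te m' x)"
    and "\<lbrakk>m \<in> carrier M; x \<in> carrier X; x' \<in> carrier X\<rbrakk> \<Longrightarrow>
      f (te m (x \<oplus>\<^bsub>X\<^esub> x')) = f (te m x) \<oplus> f (te m x')"
    and "\<lbrakk>m \<in> carrier M; a \<in> carrier A; x \<in> carrier X\<rbrakk> \<Longrightarrow> f (te (m \<lhd>\<^bsub>M\<^esub> a) x) = f (te m (a \<odot>\<^bsub>X\<^esub> x))"
    and "\<lbrakk>b \<in> carrier B; m \<in> carrier M; x \<in> carrier X\<rbrakk> \<Longrightarrow> f (te (b \<odot>\<^bsub>M\<^esub> m) x) = b \<odot> f (te m x)"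
    and "x \<in> carrier X \<Longrightarrow> f (te \<zero>\<^bsub>M\<^esub> x) = \<zero>"
    and "m \<in> carrier M \<Longrightarrow> f (te m \<zero>\<^bsub>X\<^esub>) = \<zero>"
proof -
  note h = left_homD[OF f]
  have z: "f \<zero>\<^bsub>TG\<^esub> = \<zero>" using left_hom_zero[OF tensor_left_module Y f] by simp
  show "\<lbrakk>m \<in> carrier M; x \<in> carrier X\<rbrakk> \<Longrightarrow> f (te m x) \<in> carrier Y" using h(1) te_closed by simp
  show "\<lbrakk>m \<in> carrier M; m' \<in> carrier M; x \<in> carrier X\<rbrakk> \<Longrightarrow>
      f (te (m \<oplus>\<^bsub>M\<^esub> m') x) = f (te m x) \<oplus> f (te m' x)" using h(2) te_closed te_add_left by simp
  show "\<lbrakk>m \<in> carrier M; x \<in> carrier X; x' \<in> carrier X\<rbrakk> \<Longrightarrow>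
      f (te m (x \<oplus>\<^bsub>X\<^esub> x')) = f (te m x) \<oplus> f (te m x')" using h(2) te_closed te_add_right by simp
  show "\<lbrakk>m \<in> carrier M; a \<in> carrier A; x \<in> carrier X\<rbrakk> \<Longrightarrow> f (te (m \<lhd>\<^bsub>M\<^esub> a) x) = f (te m (a \<odot>\<^bsub>X\<^esub> x))"
    by (simp only: te_balanced)
  show "\<lbrakk>b \<in> carrier B; m \<in> carrier M; x \<in> carrier X\<rbrakk> \<Longrightarrow> f (te (b \<odot>\<^bsub>M\<^esub> m) x) = b \<odot> f (te m x)"
    using h(3)[of b "te m x"] te_closed[of m x] smult_elem[of b m x] by simp
  show "x \<in> carrier X \<Longrightarrow> f (te \<zero>\<^bsub>M\<^esub> x) = \<zero>" by (simp only: te_zero_left z)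
  show "m \<in> carrier M \<Longrightarrow> f (te m \<zero>\<^bsub>X\<^esub>) = \<zero>" by (simp only: te_zero_right z)
qed

lemma tensor_lift_left_hom:
  fixes Y (structure)
  assumes Y: "left_module B Y" and \<beta>: "balanced Y \<beta>"
    and lin: "\<And>b m x. \<lbrakk>b \<in> carrier B; m \<in> carrier M; x \<in> carrier X\<rbrakk> \<Longrightarrow> \<beta> (b \<odot>\<^bsub>M\<^esub> m) x = b \<odot> \<beta> m x"
  shows "tensor_lift Y \<beta> \<in> left_hom B (tensor A M X) Y"
proof -
  interpret M: left_module B M by (rule left_M)
  interpret Y: left_module B Y by (rule Y)
  interpret T: left_module B "tensor A M X" by (rule tensor_left_module)
  note h = tensor_lift_hom[OF Y.abelian_group_axioms \<beta>]
  have "tensor_lift Y \<beta> (b \<odot>\<^bsub>tensor A M X\<^esub> t) = b \<odot> tensor_lift Y \<beta> t"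
    if b: "b \<in> carrier B" and t: "t \<in> carrier TG" for b t
    using t
  proof (induction rule: tensor_induct)
    case zero
    then show ?case using T.smult_zero_right[OF b] Y.smult_zero_right[OF b] h(4) by simp
  next
    case (elem m x)
    then show ?case by (simp only: smult_elem[OF b] h(3) M.lsmult_closed[OF b] lin[OF b])
  next
    case (add t u)
    have "b \<odot>\<^bsub>tensor A M X\<^esub> t \<in> carrier TG" "b \<odot>\<^bsub>tensor A M X\<^esub> u \<in> carrier TG"
      using T.lsmult_closed[OF b] add by auto
    then show ?case
      using T.lsmult_r_distr[OF b, of t u] add h(1) by (simp add: h(2) Y.lsmult_r_distr[OF b] del: tensor_simps(4))
  qed
  then show ?thesis using h(1,2) by (simp add: left_hom_iff)
qed

end

section \<open>Morita rings\<close>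

context morita_context
begin

text \<open>
  The hypotheses on a Morita context are symmetric in the two rings, so each fact about \<open>\<psi>\<close> has a
  counterpart for \<open>\<phi>\<close>.
\<close>

lemma swap: "morita_context B A M N \<psi> \<phi>"
  using ring_A ring_B bimodule_M bimodule_N phi_hom psi_hom phi_psi psi_phi
  by (simp add: morita_context_def)

lemma modules:
  "left_module A N" "right_module B N" "left_module B M" "right_module A M"
  using bimodule_M bimodule_N by (auto simp: bimodule_def)

lemma NM: "bimodule_tensor_product A B N M"
  using bimodule_N modules by (simp add: bimodule_tensor_product_def)

lemma psi_left_hom: "\<psi> \<in> left_hom A (tensor B N M) (regular_bimodule A)"
  using psi_hom by (simp add: bimodule_hom_def left_hom_iff bitensor_def module.defs)

lemmas psi_elem = bimodule_tensor_product.left_hom_elem[OF NM regular_module[OF ring_A] psi_left_hom,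
    simplified regular_simps]

lemma psi_right:
  assumes n: "n \<in> carrier N" and m: "m \<in> carrier M" and a: "a \<in> carrier A"
  shows "\<psi> (tensor_elem B N M n (m \<lhd>\<^bsub>M\<^esub> a)) = \<psi> (tensor_elem B N M n m) \<otimes>\<^bsub>A\<^esub> a"
proof -
  interpret NM: bimodule_tensor_product A B N M by (rule NM)
  interpret M: right_module A M by (rule modules)
  interpret lM: left_module B M by (rule modules)
  have bal: "NM.balanced NM.TG (\<lambda>n m. NM.te n (m \<lhd>\<^bsub>M\<^esub> a))"
    unfolding NM.balanced_def
  proof (intro conjI ballI)
    fix n b m assume "n \<in> carrier N" "b \<in> carrier B" "m \<in> carrier M"
    then show "NM.te (n \<lhd>\<^bsub>N\<^esub> b) (m \<lhd>\<^bsub>M\<^esub> a) = NM.te n ((b \<odot>\<^bsub>M\<^esub> m) \<lhd>\<^bsub>M\<^esub> a)"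
      using a bimodule.assoc[OF bimodule_M] by (simp add: NM.te_balanced M.rsmult_closed)
  qed (use a in \<open>simp_all add: NM.te_closed NM.te_add_left NM.te_add_right M.rsmult_closed M.rsmult_l_distr\<close>)
  have "NM.te n m \<lhd>\<^bsub>bitensor B N M\<^esub> a = NM.te n (m \<lhd>\<^bsub>M\<^esub> a)"
    using NM.tensor_lift_hom(3)[OF NM.tensor_group_abelian bal n m]
    by (simp add: bitensor_def module.defs bimodule.defs)
  moreover have "\<psi> (NM.te n m \<lhd>\<^bsub>bitensor B N M\<^esub> a) = \<psi> (NM.te n m) \<otimes>\<^bsub>A\<^esub> a"
    using psi_hom NM.te_closed[OF n m] a by (simp add: bimodule_hom_def bitensor_def module.defs)
  ultimately show ?thesis by simp
qed

lemmas phi_elem = morita_context.psi_elem[OF swap]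

abbreviation \<Lambda> where "\<Lambda> \<equiv> morita_ring A B N M \<phi> \<psi>"

lemma morita_ring_simps [simp]:
  "carrier \<Lambda> = carrier A \<times> carrier N \<times> carrier M \<times> carrier B"
  "(a, n, m, b) \<otimes>\<^bsub>\<Lambda>\<^esub> (a', n', m', b') =
       (a \<otimes>\<^bsub>A\<^esub> a' \<oplus>\<^bsub>A\<^esub> \<psi> (tensor_elem B N M n m'),
        a \<odot>\<^bsub>N\<^esub> n' \<oplus>\<^bsub>N\<^esub> n \<lhd>\<^bsub>N\<^esub> b',
        m \<lhd>\<^bsub>M\<^esub> a' \<oplus>\<^bsub>M\<^esub> b \<odot>\<^bsub>M\<^esub> m',
        b \<otimes>\<^bsub>B\<^esub> b' \<oplus>\<^bsub>B\<^esub> \<phi> (tensor_elem A M N m n'))"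
  "\<one>\<^bsub>\<Lambda>\<^esub> = (\<one>\<^bsub>A\<^esub>, \<zero>\<^bsub>N\<^esub>, \<zero>\<^bsub>M\<^esub>, \<one>\<^bsub>B\<^esub>)"
  "\<zero>\<^bsub>\<Lambda>\<^esub> = (\<zero>\<^bsub>A\<^esub>, \<zero>\<^bsub>N\<^esub>, \<zero>\<^bsub>M\<^esub>, \<zero>\<^bsub>B\<^esub>)"
  "(a, n, m, b) \<oplus>\<^bsub>\<Lambda>\<^esub> (a', n', m', b') =
       (a \<oplus>\<^bsub>A\<^esub> a', n \<oplus>\<^bsub>N\<^esub> n', m \<oplus>\<^bsub>M\<^esub> m', b \<oplus>\<^bsub>B\<^esub> b')"
  by (simp_all add: morita_ring_def)

end

lemma tuple_module_simps [simp]: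
  "carrier (tuple_module A B N M (X, Y, f, g)) = carrier X \<times> carrier Y"
  "ring.zero (tuple_module A B N M (X, Y, f, g)) = (\<zero>\<^bsub>X\<^esub>, \<zero>\<^bsub>Y\<^esub>)"
  "(x, y) \<oplus>\<^bsub>tuple_module A B N M (X, Y, f, g)\<^esub> (x', y') = (x \<oplus>\<^bsub>X\<^esub> x', y \<oplus>\<^bsub>Y\<^esub> y')"
  "(a, n, m, b) \<odot>\<^bsub>tuple_module A B N M (X, Y, f, g)\<^esub> (x, y) =
       (a \<odot>\<^bsub>X\<^esub> x \<oplus>\<^bsub>X\<^esub> g (tensor_elem B N Y n y), b \<odot>\<^bsub>Y\<^esub> y \<oplus>\<^bsub>Y\<^esub> f (tensor_elem A M X m x))"
  by simp_all

declare tuple_module.simps [simp del]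

context morita_context
begin

text \<open>
  In the associativity of the action, products \<open>\<psi> (n \<otimes> m')\<close> and \<open>\<phi> (m \<otimes> n')\<close> of off-diagonal entries on one
  side face composites of \<open>f\<close> and \<open>g\<close> on the other; the two compatibility conditions equate them.
\<close>

lemma tuple_module_left_module:
  assumes L: "ring \<Lambda>"
    and X: "left_module A X" and Y: "left_module B Y"
    and f: "f \<in> left_hom B (tensor A M X) Y" and g: "g \<in> left_hom A (tensor B N Y) X"
    and gf: "\<And>n m x. \<lbrakk>n \<in> carrier N; m \<in> carrier M; x \<in> carrier X\<rbrakk> \<Longrightarrow>
      g (tensor_elem B N Y n (f (tensor_elem A M X m x))) = \<psi> (tensor_elem B N M n m) \<odot>\<^bsub>X\<^esub> x"
    and fg: "\<And>m n y. \<lbrakk>m \<in> carrier M; n \<in> carrier N; y \<in> carrier Y\<rbrakk> \<Longrightarrow>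
      f (tensor_elem A M X m (g (tensor_elem B N Y n y))) = \<phi> (tensor_elem A M N m n) \<odot>\<^bsub>Y\<^esub> y"
  shows "left_module \<Lambda> (tuple_module A B N M (X, Y, f, g))" (is "left_module ?L ?Z")
proof -
  interpret X: left_module A X by (rule X)
  interpret Y: left_module B Y by (rule Y)
  interpret N: left_module A N by (rule modules)
  interpret M: left_module B M by (rule modules)
  interpret rN: right_module B N by (rule modules)
  interpret rM: right_module A M by (rule modules)
  have MX: "bimodule_tensor_product B A M X" and NY: "bimodule_tensor_product A B N Y"
    using bimodule_M bimodule_N X Y by (simp_all add: bimodule_tensor_product_def)
  note f' = bimodule_tensor_product.left_hom_elem[OF MX Y f]
  note g' = bimodule_tensor_product.left_hom_elem[OF NY X g]
  have "abelian_group ?Z"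
  proof (rule abelian_groupI)
    fix z assume "z \<in> carrier ?Z"
    then obtain x y where z: "z = (x, y)" "x \<in> carrier X" "y \<in> carrier Y" by auto
    then have "(\<ominus>\<^bsub>X\<^esub> x, \<ominus>\<^bsub>Y\<^esub> y) \<oplus>\<^bsub>?Z\<^esub> z = \<zero>\<^bsub>?Z\<^esub>" by (simp add: X.l_neg Y.l_neg)
    moreover have "(\<ominus>\<^bsub>X\<^esub> x, \<ominus>\<^bsub>Y\<^esub> y) \<in> carrier ?Z" using z by simp
    ultimately show "\<exists>u\<in>carrier ?Z. u \<oplus>\<^bsub>?Z\<^esub> z = \<zero>\<^bsub>?Z\<^esub>" by metis
  qed (auto simp: X.a_ac Y.a_ac)
  moreover have "left_module_axioms ?L ?Z"
  proof
    fix l z assume "l \<in> carrier ?L" "z \<in> carrier ?Z"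
    then show "l \<odot>\<^bsub>?Z\<^esub> z \<in> carrier ?Z"
      by (auto simp: X.lsmult_closed Y.lsmult_closed f'(1) g'(1))
  next
    fix l k z assume "l \<in> carrier ?L" "k \<in> carrier ?L" "z \<in> carrier ?Z"
    then obtain a n m b a' n' m' b' x y where
      l: "l = (a, n, m, b)" "a \<in> carrier A" "n \<in> carrier N" "m \<in> carrier M" "b \<in> carrier B"
      and k: "k = (a', n', m', b')" "a' \<in> carrier A" "n' \<in> carrier N" "m' \<in> carrier M" "b' \<in> carrier B"
      and z: "z = (x, y)" "x \<in> carrier X" "y \<in> carrier Y" by auto
    show "(l \<oplus>\<^bsub>?L\<^esub> k) \<odot>\<^bsub>?Z\<^esub> z = l \<odot>\<^bsub>?Z\<^esub> z \<oplus>\<^bsub>?Z\<^esub> k \<odot>\<^bsub>?Z\<^esub> z"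
      using l k z
      by (simp add: X.lsmult_closed Y.lsmult_closed f'(1,2) g'(1,2) X.lsmult_l_distr Y.lsmult_l_distr X.a_ac Y.a_ac)
    have "(a \<otimes>\<^bsub>A\<^esub> a' \<oplus>\<^bsub>A\<^esub> \<psi> (tensor_elem B N M n m')) \<odot>\<^bsub>X\<^esub> x \<oplus>\<^bsub>X\<^esub>
        g (tensor_elem B N Y (a \<odot>\<^bsub>N\<^esub> n' \<oplus>\<^bsub>N\<^esub> n \<lhd>\<^bsub>N\<^esub> b') y) =
      a \<odot>\<^bsub>X\<^esub> (a' \<odot>\<^bsub>X\<^esub> x \<oplus>\<^bsub>X\<^esub> g (tensor_elem B N Y n' y)) \<oplus>\<^bsub>X\<^esub>
        g (tensor_elem B N Y n (b' \<odot>\<^bsub>Y\<^esub> y \<oplus>\<^bsub>Y\<^esub> f (tensor_elem A M X m' x)))"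
      using l k z psi_elem(1)[of n m']
      by (simp add: X.lsmult_closed Y.lsmult_closed N.lsmult_closed rN.rsmult_closed f'(1) g' gf
          X.lsmult_l_distr X.lsmult_r_distr X.lsmult_assoc X.a_ac)
    moreover have "(b \<otimes>\<^bsub>B\<^esub> b' \<oplus>\<^bsub>B\<^esub> \<phi> (tensor_elem A M N m n')) \<odot>\<^bsub>Y\<^esub> y \<oplus>\<^bsub>Y\<^esub>
        f (tensor_elem A M X (m \<lhd>\<^bsub>M\<^esub> a' \<oplus>\<^bsub>M\<^esub> b \<odot>\<^bsub>M\<^esub> m') x) =
      b \<odot>\<^bsub>Y\<^esub> (b' \<odot>\<^bsub>Y\<^esub> y \<oplus>\<^bsub>Y\<^esub> f (tensor_elem A M X m' x)) \<oplus>\<^bsub>Y\<^esub>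
        f (tensor_elem A M X m (a' \<odot>\<^bsub>X\<^esub> x \<oplus>\<^bsub>X\<^esub> g (tensor_elem B N Y n' y)))"
      using l k z phi_elem(1)[of m n']
      by (simp add: X.lsmult_closed Y.lsmult_closed M.lsmult_closed rM.rsmult_closed g'(1) f' fg
          Y.lsmult_l_distr Y.lsmult_r_distr Y.lsmult_assoc Y.a_ac)
    ultimately show "(l \<otimes>\<^bsub>?L\<^esub> k) \<odot>\<^bsub>?Z\<^esub> z = l \<odot>\<^bsub>?Z\<^esub> (k \<odot>\<^bsub>?Z\<^esub> z)"
      by (simp add: l(1) k(1) z(1))
  next
    fix l z w assume "l \<in> carrier ?L" "z \<in> carrier ?Z" "w \<in> carrier ?Z"
    then obtain a n m b x y x' y' where
      l: "l = (a, n, m, b)" "a \<in> carrier A" "n \<in> carrier N" "m \<in> carrier M" "b \<in> carrier B"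
      and z: "z = (x, y)" "x \<in> carrier X" "y \<in> carrier Y"
      and w: "w = (x', y')" "x' \<in> carrier X" "y' \<in> carrier Y" by auto
    show "l \<odot>\<^bsub>?Z\<^esub> (z \<oplus>\<^bsub>?Z\<^esub> w) = l \<odot>\<^bsub>?Z\<^esub> z \<oplus>\<^bsub>?Z\<^esub> l \<odot>\<^bsub>?Z\<^esub> w"
      using l z w
      by (simp add: X.lsmult_closed Y.lsmult_closed f'(1,3) g'(1,3) X.lsmult_r_distr Y.lsmult_r_distr X.a_ac Y.a_ac)
  next
    fix z assume "z \<in> carrier ?Z"
    then show "\<one>\<^bsub>?L\<^esub> \<odot>\<^bsub>?Z\<^esub> z = z" by (auto simp: X.lsmult_one Y.lsmult_one f'(6) g'(6))
  qed
  ultimately show ?thesis using L by (simp add: left_module_def)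
qed

end

locale morita_module = morita_context A B N M \<phi> \<psi>
  for A :: "'a ring" and B :: "'b ring"
    and N :: "('a, 'b, 'n) bimodule" and M :: "('b, 'a, 'm) bimodule"
    and \<phi> :: "('m, 'n) tensor \<Rightarrow> 'b" and \<psi> :: "('n, 'm) tensor \<Rightarrow> 'a" +
  fixes P :: "('a, 'x) module"
  assumes module_P: "left_module A P"

sublocale morita_module \<subseteq> MP: bimodule_tensor_product B A M P
  using bimodule_M module_P by (simp add: bimodule_tensor_product_def)

sublocale morita_module \<subseteq> NMP: bimodule_tensor_product A B N "tensor A M P"
  using bimodule_N MP.tensor_left_module by (simp add: bimodule_tensor_product_def)

context morita_module
begin

text \<open>
  \<open>Psi_map\<close> is a lift of a lift. That the outer map is balanced is a property of the inner lifts, which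
  are maps on \<open>M \<otimes> P\<close>; it is verified by induction on tensors.
\<close>

lemma
  shows Psi_elem: "\<lbrakk>n \<in> carrier N; m \<in> carrier M; x \<in> carrier P\<rbrakk> \<Longrightarrow>
      Psi_map B N M \<psi> P (NMP.te n (MP.te m x)) = \<psi> (tensor_elem B N M n m) \<odot>\<^bsub>P\<^esub> x"
    and Psi_left_hom: "Psi_map B N M \<psi> P \<in> left_hom A (tensor B N (tensor A M P)) P"
proof -
  interpret P: left_module A P by (rule module_P)
  interpret N: left_module A N by (rule modules)
  interpret M: left_module B M by (rule modules)
  interpret rN: right_module B N by (rule modules)
  interpret rM: right_module A M by (rule modules)
  interpret T: left_module B "tensor A M P" by (rule MP.tensor_left_module)
  let ?\<beta> = "\<lambda>n m x. \<psi> (tensor_elem B N M n m) \<odot>\<^bsub>P\<^esub> x"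
  let ?i = "\<lambda>n. tensor_lift P (?\<beta> n)"
  have bal: "MP.balanced P (?\<beta> n)" if n: "n \<in> carrier N" for n
    unfolding MP.balanced_def using n
    by (simp add: psi_elem psi_right P.lsmult_closed P.lsmult_l_distr P.lsmult_r_distr P.lsmult_assoc)
  note i = MP.tensor_lift_hom[OF P.abelian_group_axioms bal]
  have ilin: "?i (a \<odot>\<^bsub>N\<^esub> n) t = a \<odot>\<^bsub>P\<^esub> ?i n t"
    if a: "a \<in> carrier A" and n: "n \<in> carrier N" and t: "t \<in> carrier MP.TG" for a n t
  proof -
    have an: "a \<odot>\<^bsub>N\<^esub> n \<in> carrier N" by (rule N.lsmult_closed[OF a n])
    show ?thesis
      using t
    proof (induction rule: MP.tensor_induct)
      case zero
      then show ?case by (simp only: i(4)[OF n] i(4)[OF an] P.smult_zero_right[OF a])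
    next
      case (elem m x)
      then show ?case using a n by (simp add: i(3)[OF n] i(3)[OF an] psi_elem P.lsmult_assoc)
    next
      case (add t u)
      then show ?case
        by (simp only: i(2)[OF n] i(2)[OF an] P.lsmult_r_distr[OF a i(1)[OF n] i(1)[OF n]])
    qed
  qed
  have iadd: "?i (n \<oplus>\<^bsub>N\<^esub> n') t = ?i n t \<oplus>\<^bsub>P\<^esub> ?i n' t"
    if n: "n \<in> carrier N" and n': "n' \<in> carrier N" and t: "t \<in> carrier MP.TG" for n n' t
  proof -
    have nn: "n \<oplus>\<^bsub>N\<^esub> n' \<in> carrier N" using n n' by simp
    show ?thesis
      using t
    proof (induction rule: MP.tensor_induct)
      case zero
      then show ?case by (simp add: i(4)[OF n] i(4)[OF n'] i(4)[OF nn])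
    next
      case (elem m x)
      then show ?case
        using n n' by (simp add: i(3)[OF n] i(3)[OF n'] i(3)[OF nn] psi_elem P.lsmult_l_distr)
    next
      case (add t u)
      then show ?case
        using i(1)[OF n] i(1)[OF n'] by (simp add: i(2)[OF n] i(2)[OF n'] i(2)[OF nn] P.a_ac)
    qed
  qed
  have ibal: "?i (n \<lhd>\<^bsub>N\<^esub> b) t = ?i n (b \<odot>\<^bsub>tensor A M P\<^esub> t)"
    if b: "b \<in> carrier B" and n: "n \<in> carrier N" and t: "t \<in> carrier MP.TG" for b n t
  proof -
    have nb: "n \<lhd>\<^bsub>N\<^esub> b \<in> carrier N" by (rule rN.rsmult_closed[OF n b])
    have bt: "b \<odot>\<^bsub>tensor A M P\<^esub> t \<in> carrier MP.TG" if "t \<in> carrier MP.TG" for t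
      using T.lsmult_closed[OF b, of t] that by simp
    show ?thesis
      using t
    proof (induction rule: MP.tensor_induct)
      case zero
      then show ?case using T.smult_zero_right[OF b] by (simp add: i(4)[OF n] i(4)[OF nb] del: MP.tensor_simps(4))
    next
      case (elem m x)
      then show ?case
        unfolding MP.smult_elem[OF b elem]
        using b n by (simp add: i(3)[OF n] i(3)[OF nb] psi_elem M.lsmult_closed)
    next
      case (add t u)
      then have "b \<odot>\<^bsub>tensor A M P\<^esub> (t \<oplus>\<^bsub>MP.TG\<^esub> u) = b \<odot>\<^bsub>tensor A M P\<^esub> t \<oplus>\<^bsub>MP.TG\<^esub> b \<odot>\<^bsub>tensor A M P\<^esub> u"
        using T.lsmult_r_distr[OF b, of t u] by (simp del: MP.tensor_simps(4))
      then show ?case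
        using add bt by (simp only: i(2)[OF n] i(2)[OF nb])
    qed
  qed
  have Bal: "NMP.balanced P ?i"
    unfolding NMP.balanced_def
    using i(1,2) iadd ibal by (simp del: MP.tensor_simps(4))
  show "Psi_map B N M \<psi> P (NMP.te n (MP.te m x)) = \<psi> (tensor_elem B N M n m) \<odot>\<^bsub>P\<^esub> x"
    if "n \<in> carrier N" "m \<in> carrier M" "x \<in> carrier P"
    using NMP.tensor_lift_hom(3)[OF P.abelian_group_axioms Bal that(1), of "MP.te m x"]
      MP.te_closed[OF that(2,3)] i(3)[OF that] by (simp add: Psi_map_def)
  show "Psi_map B N M \<psi> P \<in> left_hom A (tensor B N (tensor A M P)) P"
    unfolding Psi_map_def
  proof (rule NMP.tensor_lift_left_hom[OF module_P Bal])
    fix a n t assume "a \<in> carrier A" "n \<in> carrier N" "t \<in> carrier (tensor A M P)"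
    then show "?i (a \<odot>\<^bsub>N\<^esub> n) t = a \<odot>\<^bsub>P\<^esub> ?i n t" using ilin by simp
  qed
qed

text \<open>
  The second compatibility condition for \<open>T_A\<close>. On pure tensors \<open>t = m' \<otimes> x\<close> both sides are
  \<open>m \<psi>(n \<otimes> m') \<otimes> x = \<phi>(m \<otimes> n) m' \<otimes> x\<close>.
\<close>

lemma te_Psi:
  assumes m: "m \<in> carrier M" and n: "n \<in> carrier N" and t: "t \<in> carrier (tensor A M P)"
  shows "MP.te m (Psi_map B N M \<psi> P (NMP.te n t)) = \<phi> (tensor_elem A M N m n) \<odot>\<^bsub>tensor A M P\<^esub> t"
proof -
  interpret T: left_module B "tensor A M P" by (rule MP.tensor_left_module)
  note h = NMP.left_hom_elem[OF module_P Psi_left_hom]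
  have \<phi>: "\<phi> (tensor_elem A M N m n) \<in> carrier B" by (rule phi_elem(1)[OF m n])
  have "t \<in> carrier MP.TG" using t by simp
  then show ?thesis
  proof (induction rule: MP.tensor_induct)
    case zero
    then show ?case
      using h(7)[OF n] MP.te_zero_right[OF m] T.smult_zero_right[OF \<phi>] by simp
  next
    case (elem m' x)
    then show ?case
      unfolding Psi_elem[OF n elem] MP.smult_elem[OF \<phi> elem] phi_psi[OF m n elem(1)]
      using MP.te_balanced[OF m psi_elem(1)[OF n elem(1)] elem(2)] by simp
  next
    case (add t u)
    then show ?case
      using h(3)[OF n, of t u] h(1)[OF n] MP.te_add_right[OF m] T.lsmult_r_distr[OF \<phi>, of t u]
      by (simp del: MP.tensor_simps(4))
  qed
qed

text \<open>
  The pair \<open>(\<chi>, \<Theta>)\<close> is a morphism of tuples from \<open>T_A(P)\<close> to \<open>(A, M)\<close>, the first column of the Morita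
  ring; here \<open>\<Theta>\<close> is \<open>m \<otimes> x \<mapsto> m \<chi>(x)\<close>.
\<close>

lemma functional_extension:
  assumes \<chi>: "\<chi> \<in> left_hom A P (regular_bimodule A)"
  obtains \<Theta> where "\<Theta> \<in> left_hom B (tensor A M P) M"
    and "\<And>m x. \<lbrakk>m \<in> carrier M; x \<in> carrier P\<rbrakk> \<Longrightarrow> \<Theta> (MP.te m x) = m \<lhd>\<^bsub>M\<^esub> \<chi> x"
    and "\<And>n t. \<lbrakk>n \<in> carrier N; t \<in> carrier (tensor A M P)\<rbrakk> \<Longrightarrow>
      \<chi> (Psi_map B N M \<psi> P (NMP.te n t)) = \<psi> (tensor_elem B N M n (\<Theta> t))"
proof -
  interpret P: left_module A P by (rule module_P)
  interpret M: left_module B M by (rule modules)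
  interpret rM: right_module A M by (rule modules)
  note \<chi>c = functional_closed[OF \<chi>] and \<chi>h = left_homD(2,3)[OF \<chi>, simplified regular_simps]
  let ?\<Theta> = "tensor_lift M (\<lambda>m x. m \<lhd>\<^bsub>M\<^esub> \<chi> x)"
  have bal: "MP.balanced M (\<lambda>m x. m \<lhd>\<^bsub>M\<^esub> \<chi> x)"
    unfolding MP.balanced_def
    by (simp add: \<chi>c \<chi>h rM.rsmult_closed rM.rsmult_l_distr rM.rsmult_r_distr rM.rsmult_assoc)
  note l = MP.tensor_lift_hom[OF M.abelian_group_axioms bal]
  have hom: "?\<Theta> \<in> left_hom B (tensor A M P) M"
    using bimodule.assoc[OF bimodule_M] \<chi>c
    by (intro MP.tensor_lift_left_hom[OF M.left_module_axioms bal]) simp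
  note h = NMP.left_hom_elem[OF module_P Psi_left_hom]
  have "\<chi> (Psi_map B N M \<psi> P (NMP.te n t)) = \<psi> (tensor_elem B N M n (?\<Theta> t))"
    if n: "n \<in> carrier N" and t: "t \<in> carrier MP.TG" for n t
    using t
  proof (induction rule: MP.tensor_induct)
    case zero
    then show ?case
      using h(7)[OF n] left_hom_zero[OF module_P regular_module[OF ring_A] \<chi>] l(4) psi_elem(7)[OF n] by simp
  next
    case (elem m x)
    then show ?case
      unfolding Psi_elem[OF n elem] l(3)[OF elem]
      using \<chi>h(2)[OF psi_elem(1)[OF n elem(1)] elem(2)] psi_right[OF n elem(1) \<chi>c[OF elem(2)]] by simp
  next
    case (add t u)
    then show ?case
      using h(3)[OF n, of t u] h(1)[OF n, of t] h(1)[OF n, of u]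
      by (simp add: \<chi>h l(1,2) psi_elem(3)[OF n])
  qed
  then show thesis using hom l(3) by (intro that[of ?\<Theta>]) auto
qed

end

context morita_context
begin

lemma corner_A:
  assumes "ring \<Lambda>"
  shows "corner A \<Lambda> (\<lambda>a. (a, \<zero>\<^bsub>N\<^esub>, \<zero>\<^bsub>M\<^esub>, \<zero>\<^bsub>B\<^esub>))"
proof -
  interpret A: ring A by (rule ring_A)
  interpret B: ring B by (rule ring_B)
  interpret N: left_module A N by (rule modules)
  interpret M: left_module B M by (rule modules)
  interpret rN: right_module B N by (rule modules)
  interpret rM: right_module A M by (rule modules)
  have zN: "n \<lhd>\<^bsub>N\<^esub> \<zero>\<^bsub>B\<^esub> = \<zero>\<^bsub>N\<^esub>" if "n \<in> carrier N" for n
    using rN.rsmult_r_distr[OF that B.zero_closed B.zero_closed] rN.rsmult_closed[OF that B.zero_closed]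
    by simp
  have zM: "\<zero>\<^bsub>M\<^esub> \<lhd>\<^bsub>M\<^esub> a = \<zero>\<^bsub>M\<^esub>" if "a \<in> carrier A" for a
    using rM.rsmult_l_distr[OF M.zero_closed M.zero_closed that] rM.rsmult_closed[OF M.zero_closed that]
    by simp
  note s = psi_elem(6,7) phi_elem(6,7) zN zM N.smult_zero_left N.smult_zero_right M.smult_zero_left
    M.smult_zero_right rM.rsmult_closed rN.rsmult_closed N.lsmult_closed M.lsmult_closed
  show ?thesis
  proof (rule corner.intro)
    show "ring A" by (rule ring_A)
    show "ring \<Lambda>" by fact
    fix l assume "l \<in> carrier \<Lambda>"
    then obtain a n m b where l: "l = (a, n, m, b)" "a \<in> carrier A" "n \<in> carrier N" "m \<in> carrier M" "b \<in> carrier B"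
      by auto
    then show "(\<one>\<^bsub>A\<^esub>, \<zero>\<^bsub>N\<^esub>, \<zero>\<^bsub>M\<^esub>, \<zero>\<^bsub>B\<^esub>) \<otimes>\<^bsub>\<Lambda>\<^esub> l \<otimes>\<^bsub>\<Lambda>\<^esub>
        (\<one>\<^bsub>A\<^esub>, \<zero>\<^bsub>N\<^esub>, \<zero>\<^bsub>M\<^esub>, \<zero>\<^bsub>B\<^esub>) \<in> (\<lambda>a. (a, \<zero>\<^bsub>N\<^esub>, \<zero>\<^bsub>M\<^esub>, \<zero>\<^bsub>B\<^esub>)) ` carrier A"
      by (intro image_eqI[of _ _ a]) (simp_all add: s)
  qed (simp_all add: s inj_on_def)
qed

text \<open>
  The upper left corner of \<open>T_A(P)\<close> is \<open>P\<close>, and a matrix with the single entry \<open>m\<close> maps \<open>x\<close> to \<open>m \<otimes> x\<close>, so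
  \<open>P\<close> generates. A functional on \<open>P\<close> extends with values in the first column of the Morita ring.
\<close>

lemma T_A_induced:
  assumes L: "ring \<Lambda>" and P: "left_module A P"
  shows "induced_module A \<Lambda> (\<lambda>a. (a, \<zero>\<^bsub>N\<^esub>, \<zero>\<^bsub>M\<^esub>, \<zero>\<^bsub>B\<^esub>)) P
    (tuple_module A B N M (T_A A B N M \<psi> P)) (\<lambda>x. (x, \<zero>\<^bsub>tensor A M P\<^esub>))"
    (is "induced_module A ?L ?\<kappa> P ?T ?j")
proof -
  interpret morita_module A B N M \<phi> \<psi> P
    using P by (simp add: morita_module_def morita_module_axioms_def morita_context_axioms)
  interpret P: left_module A P by (rule P)
  interpret N: left_module A N by (rule modules)
  interpret M: left_module B M by (rule modules)
  interpret T: left_module B "tensor A M P" by (rule MP.tensor_left_module)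
  have id_hom: "id \<in> left_hom B (tensor A M P) (tensor A M P)" by (simp add: left_hom_iff)
  have tuple: "T_A A B N M \<psi> P = (P, tensor A M P, id, Psi_map B N M \<psi> P)" by (simp add: T_A_def)
  note Psi = NMP.left_hom_elem[OF P Psi_left_hom]
  have T: "left_module ?L ?T"
    unfolding tuple
    by (rule tuple_module_left_module[OF L P MP.tensor_left_module id_hom Psi_left_hom])
      (simp_all only: id_apply Psi_elem te_Psi)
  interpret TT: left_module ?L ?T by (rule T)
  have te: "\<And>m x. \<lbrakk>m \<in> carrier M; x \<in> carrier P\<rbrakk> \<Longrightarrow> MP.te m x \<in> carrier (tensor A M P)"
    "\<And>x. x \<in> carrier P \<Longrightarrow> MP.te \<zero>\<^bsub>M\<^esub> x = \<zero>\<^bsub>tensor A M P\<^esub>"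
    by (simp_all add: MP.te_closed MP.te_zero_left)
  note [simp del] = MP.tensor_simps
  show ?thesis
  proof (intro induced_module.intro induced_module_axioms.intro corner_A[OF L] P T)
    show "inj_on ?j (carrier P)" by (simp add: inj_on_def)
  next
    fix x assume "x \<in> carrier P"
    then show "?j x \<in> carrier ?T" by (simp add: tuple)
  next
    fix x y assume "x \<in> carrier P" "y \<in> carrier P"
    then show "?j (x \<oplus>\<^bsub>P\<^esub> y) = ?j x \<oplus>\<^bsub>?T\<^esub> ?j y" by (simp add: tuple)
  next
    fix a x assume "a \<in> carrier A" "x \<in> carrier P"
    then show "?j (a \<odot>\<^bsub>P\<^esub> x) = ?\<kappa> a \<odot>\<^bsub>?T\<^esub> ?j x"
      by (simp add: tuple te Psi(6) P.lsmult_closed T.smult_zero_left)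
  next
    fix t assume "t \<in> carrier ?T"
    then obtain x u where t: "t = (x, u)" "x \<in> carrier P" "u \<in> carrier (tensor A M P)" by (auto simp: tuple)
    have "?\<kappa> \<one>\<^bsub>A\<^esub> \<odot>\<^bsub>?T\<^esub> t = ?j x"
      using t by (simp add: tuple te Psi(6) T.smult_zero_left P.lsmult_one)
    then show "?\<kappa> \<one>\<^bsub>A\<^esub> \<odot>\<^bsub>?T\<^esub> t \<in> ?j ` carrier P" using t(2) by (metis imageI)
  next
    fix U assume U: "left_submodule ?L ?T U" and jU: "?j ` carrier P \<subseteq> U"
    note Uc = TT.left_submoduleD[OF U]
    have in_U: "(\<zero>\<^bsub>P\<^esub>, t) \<in> U" if "t \<in> carrier (tensor A M P)" for t
      using that
    proof (induction rule: MP.tensor_module_induct)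
      case zero
      then show ?case using Uc(2) by (simp add: tuple)
    next
      case (elem m x)
      have "?j x \<in> U" using jU elem(2) by auto
      then have "(\<zero>\<^bsub>A\<^esub>, \<zero>\<^bsub>N\<^esub>, m, \<zero>\<^bsub>B\<^esub>) \<odot>\<^bsub>?T\<^esub> ?j x \<in> U" using Uc(5)[of "(\<zero>\<^bsub>A\<^esub>, \<zero>\<^bsub>N\<^esub>, m, \<zero>\<^bsub>B\<^esub>)" "?j x"] elem(1) by simp
      also have "(\<zero>\<^bsub>A\<^esub>, \<zero>\<^bsub>N\<^esub>, m, \<zero>\<^bsub>B\<^esub>) \<odot>\<^bsub>?T\<^esub> ?j x = (\<zero>\<^bsub>P\<^esub>, MP.te m x)"
        using elem by (simp add: tuple te Psi(6) P.smult_zero_left T.smult_zero_left)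
      finally show ?case .
    next
      case (add t u)
      then show ?case using Uc(4)[OF add(3,4)] by (simp add: tuple)
    qed
    have "z \<in> U" if z: "z \<in> carrier ?T" for z
    proof -
      obtain x t where t: "z = (x, t)" "x \<in> carrier P" "t \<in> carrier (tensor A M P)" using z by (auto simp: tuple)
      have "?j x \<oplus>\<^bsub>?T\<^esub> (\<zero>\<^bsub>P\<^esub>, t) \<in> U" using jU t in_U[of t] by (intro Uc(4)) auto
      also have "?j x \<oplus>\<^bsub>?T\<^esub> (\<zero>\<^bsub>P\<^esub>, t) = z"
        using t by (simp add: tuple)
      finally show ?thesis .
    qed
    then show "U = carrier ?T" using Uc(1) by (intro equalityI subsetI) auto
  next
    fix \<chi> assume \<chi>: "\<chi> \<in> left_hom A P (regular_bimodule A)"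
    obtain \<Theta> where \<Theta>: "\<Theta> \<in> left_hom B (tensor A M P) M"
      "\<And>m x. \<lbrakk>m \<in> carrier M; x \<in> carrier P\<rbrakk> \<Longrightarrow> \<Theta> (MP.te m x) = m \<lhd>\<^bsub>M\<^esub> \<chi> x"
      "\<And>n t. \<lbrakk>n \<in> carrier N; t \<in> carrier (tensor A M P)\<rbrakk> \<Longrightarrow>
        \<chi> (Psi_map B N M \<psi> P (NMP.te n t)) = \<psi> (tensor_elem B N M n (\<Theta> t))"
      using functional_extension[OF \<chi>] by metis
    note \<chi>c = functional_closed[OF \<chi>] and \<chi>h = left_homD(2,3)[OF \<chi>, simplified regular_simps]
    note \<Theta>h = left_homD[OF \<Theta>(1)]
    interpret rN: right_module B N by (rule modules)
    interpret rM: right_module A M by (rule modules)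
    have z: "n \<lhd>\<^bsub>N\<^esub> \<zero>\<^bsub>B\<^esub> = \<zero>\<^bsub>N\<^esub>" if "n \<in> carrier N" for n
      using rN.rsmult_r_distr[OF that M.R.zero_closed M.R.zero_closed] rN.rsmult_closed[OF that M.R.zero_closed]
      by simp
    let ?F = "\<lambda>(x, t). (\<chi> x, \<zero>\<^bsub>N\<^esub>, \<Theta> t, \<zero>\<^bsub>B\<^esub>)"
    have "?F \<in> left_hom ?L ?T (regular_bimodule ?L)"
      unfolding left_hom_iff
    proof (intro conjI ballI)
      fix z assume "z \<in> carrier ?T"
      then obtain x t where t: "z = (x, t)" "x \<in> carrier P" "t \<in> carrier (tensor A M P)" by (auto simp: tuple)
      then show "?F z \<in> carrier (regular_bimodule ?L)" using \<chi>c \<Theta>h(1) by simp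
      show "?F (z \<oplus>\<^bsub>?T\<^esub> w) = ?F z \<oplus>\<^bsub>regular_bimodule ?L\<^esub> ?F w" if w: "w \<in> carrier ?T" for w
      proof -
        obtain y u where "w = (y, u)" "y \<in> carrier P" "u \<in> carrier (tensor A M P)" using w by (auto simp: tuple)
        then show ?thesis using t by (simp add: tuple \<chi>h(1) \<Theta>h(2))
      qed
      show "?F (l \<odot>\<^bsub>?T\<^esub> z) = l \<odot>\<^bsub>regular_bimodule ?L\<^esub> ?F z" if l: "l \<in> carrier ?L" for l
      proof -
        obtain a n m b where l: "l = (a, n, m, b)" "a \<in> carrier A" "n \<in> carrier N" "m \<in> carrier M" "b \<in> carrier B"
          using l by auto
        have bt: "b \<odot>\<^bsub>tensor A M P\<^esub> t \<in> carrier (tensor A M P)" by (rule T.lsmult_closed[OF l(5) t(3)])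
        have "\<chi> (a \<odot>\<^bsub>P\<^esub> x \<oplus>\<^bsub>P\<^esub> Psi_map B N M \<psi> P (NMP.te n t)) = a \<otimes>\<^bsub>A\<^esub> \<chi> x \<oplus>\<^bsub>A\<^esub> \<psi> (tensor_elem B N M n (\<Theta> t))"
          using l t by (simp only: \<chi>h Psi(1) P.lsmult_closed \<Theta>(3))
        moreover have "\<Theta> (b \<odot>\<^bsub>tensor A M P\<^esub> t \<oplus>\<^bsub>tensor A M P\<^esub> MP.te m x) = m \<lhd>\<^bsub>M\<^esub> \<chi> x \<oplus>\<^bsub>M\<^esub> b \<odot>\<^bsub>M\<^esub> \<Theta> t"
          using l t te(1)[OF l(4) t(2)] bt \<chi>c[OF t(2)] \<Theta>h(1)[OF t(3)]
          by (simp only: \<Theta>h(2,3) \<Theta>(2)) (simp add: M.a_comm rM.rsmult_closed M.lsmult_closed)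
        ultimately show ?thesis
          using l t phi_elem(7)[OF l(4)] by (simp add: tuple z N.smult_zero_right)
      qed
    qed
    moreover have "?F (?j x) = ?\<kappa> (\<chi> x)" for x
      using left_hom_zero[OF MP.tensor_left_module M.left_module_axioms \<Theta>(1)] by simp
    ultimately show "\<exists>F\<in>left_hom ?L ?T (regular_bimodule ?L). \<forall>x\<in>carrier P. F (?j x) = ?\<kappa> (\<chi> x)"
      by (intro bexI[of _ ?F]) simp_all
  qed
qed

lemma swap_ring_iso:
  "(\<lambda>(a, n, m, b). (b, m, n, a)) \<in> ring_iso \<Lambda> (morita_ring B A M N \<psi> \<phi>)"
proof -
  interpret S: morita_context B A M N \<psi> \<phi> by (rule swap)
  interpret N: left_module A N by (rule modules)
  interpret M: left_module B M by (rule modules)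
  interpret rN: right_module B N by (rule modules)
  interpret rM: right_module A M by (rule modules)
  show ?thesis
  proof (rule ring_iso_memI)
    show "bij_betw (\<lambda>(a, n, m, b). (b, m, n, a)) (carrier \<Lambda>) (carrier (morita_ring B A M N \<psi> \<phi>))"
      by (rule bij_betw_byWitness[of _ "\<lambda>(b, m, n, a). (a, n, m, b)"]) auto
  qed (auto simp: N.lsmult_closed M.lsmult_closed rN.rsmult_closed rM.rsmult_closed
      intro!: N.a_comm M.a_comm)
qed

lemma swap_ring: "ring \<Lambda> \<Longrightarrow> ring (morita_ring B A M N \<psi> \<phi>)"
  using ring.ring_iso_imp_img_ring[OF _ swap_ring_iso] by (simp add: morita_context.morita_ring_simps[OF swap] morita_ring_def)

lemma corner_B:
  assumes L: "ring \<Lambda>"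
  shows "corner B \<Lambda> (\<lambda>b. (\<zero>\<^bsub>A\<^esub>, \<zero>\<^bsub>N\<^esub>, \<zero>\<^bsub>M\<^esub>, b))"
proof -
  interpret A: ring A by (rule ring_A)
  interpret N: left_module A N by (rule modules)
  interpret M: left_module B M by (rule modules)
  show ?thesis
    by (rule corner_transport[OF morita_context.corner_A[OF swap swap_ring[OF L]] L swap_ring_iso]) simp_all
qed

lemma T_B_induced:
  assumes L: "ring \<Lambda>" and Q: "left_module B Q"
  shows "induced_module B \<Lambda> (\<lambda>b. (\<zero>\<^bsub>A\<^esub>, \<zero>\<^bsub>N\<^esub>, \<zero>\<^bsub>M\<^esub>, b)) Q
    (tuple_module A B N M (T_B A B N M \<phi> Q)) (\<lambda>y. (\<zero>\<^bsub>tensor B N Q\<^esub>, y))"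
proof -
  interpret S: morita_module B A M N \<psi> \<phi> Q
    using swap Q by (simp add: morita_module_def morita_module_axioms_def)
  interpret A: ring A by (rule ring_A)
  interpret N: left_module A N by (rule modules)
  interpret M: left_module B M by (rule modules)
  interpret Q: left_module B Q by (rule Q)
  note [simp del] = S.MP.tensor_simps S.NMP.tensor_simps
  interpret TQ: left_module A "tensor B N Q" by (rule S.MP.tensor_left_module)
  have id_hom: "id \<in> left_hom A (tensor B N Q) (tensor B N Q)" by (simp add: left_hom_iff)
  have "Phi_map A N M \<phi> Q = Psi_map A M N \<phi> Q" by (simp add: Phi_map_def Psi_map_def)
  then have tuple: "T_B A B N M \<phi> Q = (tensor B N Q, Q, Psi_map A M N \<phi> Q, id)" by (simp add: T_B_def)
  have tuple': "T_A B A M N \<phi> Q = (Q, tensor B N Q, id, Psi_map A M N \<phi> Q)" by (simp add: T_A_def)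
  have T: "left_module \<Lambda> (tuple_module A B N M (T_B A B N M \<phi> Q))"
    unfolding tuple
    by (rule tuple_module_left_module[OF L S.MP.tensor_left_module Q S.Psi_left_hom id_hom])
      (simp_all only: id_apply S.Psi_elem S.te_Psi)
  note Psi = S.NMP.left_hom_elem[OF Q S.Psi_left_hom]
  show ?thesis
  proof (rule induced_module_transport[OF S.T_A_induced[OF swap_ring[OF L] Q] L T swap_ring_iso])
    show "bij_betw (\<lambda>(x, y). (y, x)) (carrier (tuple_module A B N M (T_B A B N M \<phi> Q)))
        (carrier (tuple_module B A M N (T_A B A M N \<phi> Q)))"
      unfolding tuple tuple' by (rule bij_betw_byWitness[of _ "\<lambda>(y, x). (x, y)"]) auto
  qed (auto simp: tuple tuple')
qed

end

theorem proposition3p1: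
  fixes A :: "'a ring" and B :: "'b ring"
    and N :: "('a, 'b, 'n) bimodule" and M :: "('b, 'a, 'm) bimodule"
    and \<phi> :: "('m, 'n) tensor \<Rightarrow> 'b" and \<psi> :: "('n, 'm) tensor \<Rightarrow> 'a"
    and R :: "'r ring" and \<iota> :: "'r \<Rightarrow> 'a \<times> 'n \<times> 'm \<times> 'b"
    and \<Lambda> :: "('a \<times> 'n \<times> 'm \<times> 'b) ring"
  assumes "morita_context A B N M \<phi> \<psi>"
    and "\<Lambda> = morita_ring A B N M \<phi> \<psi>"
    and "artin_algebra R \<iota> \<Lambda>"
  shows "(\<forall>P :: ('a, 'p) module. indecomposable_projective A P \<longrightarrow>
            indecomposable_projective \<Lambda> (tuple_module A B N M (T_A A B N M \<psi> P))) \<and>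
         (\<forall>Q :: ('b, 'q) module. indecomposable_projective B Q \<longrightarrow>
            indecomposable_projective \<Lambda> (tuple_module A B N M (T_B A B N M \<phi> Q))) \<and>
         (\<forall>Z :: ('a \<times> 'n \<times> 'm \<times> 'b, 'z) module. indecomposable_projective \<Lambda> Z \<longrightarrow>
            (\<exists>P :: ('a, 'z) module. indecomposable_projective A P \<and>
               isomorphic_modules \<Lambda> Z (tuple_module A B N M (T_A A B N M \<psi> P))) \<or>
            (\<exists>Q :: ('b, 'z) module. indecomposable_projective B Q \<and>
               isomorphic_modules \<Lambda> Z (tuple_module A B N M (T_B A B N M \<phi> Q))))"
proof -
  interpret mc: morita_context A B N M \<phi> \<psi> by fact
  have L: "ring \<Lambda>" using assms(3) by (simp add: artin_algebra_def)
  note L' = L[unfolded assms(2)]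
  interpret CA: corner A \<Lambda> "\<lambda>a. (a, \<zero>\<^bsub>N\<^esub>, \<zero>\<^bsub>M\<^esub>, \<zero>\<^bsub>B\<^esub>)" unfolding assms(2) by (rule mc.corner_A[OF L'])
  interpret CB: corner B \<Lambda> "\<lambda>b. (\<zero>\<^bsub>A\<^esub>, \<zero>\<^bsub>N\<^esub>, \<zero>\<^bsub>M\<^esub>, b)" unfolding assms(2) by (rule mc.corner_B[OF L'])
  note TA = mc.T_A_induced[OF L', folded assms(2)] and TB = mc.T_B_induced[OF L', folded assms(2)]
  show ?thesis
  proof (intro conjI allI impI)
    fix P :: "('a, 'p) module" assume P: "indecomposable_projective A P"
    then have "left_module A P" by (simp add: indecomposable_projective_def fg_module_def)
    from induced_module.induced_indecomposable_projective[OF TA[OF this] P]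
    show "indecomposable_projective \<Lambda> (tuple_module A B N M (T_A A B N M \<psi> P))" .
  next
    fix Q :: "('b, 'q) module" assume Q: "indecomposable_projective B Q"
    then have "left_module B Q" by (simp add: indecomposable_projective_def fg_module_def)
    from induced_module.induced_indecomposable_projective[OF TB[OF this] Q]
    show "indecomposable_projective \<Lambda> (tuple_module A B N M (T_B A B N M \<phi> Q))" .
  next
    fix Z :: "('a \<times> 'n \<times> 'm \<times> 'b, 'z) module" assume "indecomposable_projective \<Lambda> Z"
    then obtain n w F where Z: "left_module \<Lambda> Z" and ind: "indecomposable \<Lambda> Z" and db: "dual_basis \<Lambda> Z n w F"
      unfolding indecomposable_projective_iff by metis
    interpret Z: left_module \<Lambda> Z by (rule Z)
    have fg: "finitely_generated \<Lambda> Z" by (rule dual_basis_finitely_generated[OF Z db])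
    note hollow = indecomposable_projective_hollow[OF Z db ind
        finitely_generated_artinian[OF Z artin_algebra_artinian[OF assms(3)] fg]]
    \<comment> \<open>If \<open>s\<close> generates \<open>Z\<close>, so does \<open>e s\<close> or \<open>e' s\<close>, as \<open>Z\<close> is hollow.\<close>
    obtain s where s: "s \<in> carrier Z" "cyclic \<Lambda> Z s = carrier Z"
      using hollow_cyclic[OF Z fg hollow] by metis
    let ?e = "(\<one>\<^bsub>A\<^esub>, \<zero>\<^bsub>N\<^esub>, \<zero>\<^bsub>M\<^esub>, \<zero>\<^bsub>B\<^esub>)" and ?e' = "(\<zero>\<^bsub>A\<^esub>, \<zero>\<^bsub>N\<^esub>, \<zero>\<^bsub>M\<^esub>, \<one>\<^bsub>B\<^esub>)"
    have e: "?e \<in> carrier \<Lambda>" "?e' \<in> carrier \<Lambda>" by (rule CA.kappa_one_closed, rule CB.kappa_one_closed)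
    let ?C = "cyclic \<Lambda> Z"
    have es: "?e \<odot>\<^bsub>Z\<^esub> s \<in> carrier Z" "?e' \<odot>\<^bsub>Z\<^esub> s \<in> carrier Z" using e s(1) by (simp_all only: Z.lsmult_closed)
    have one: "\<one>\<^bsub>\<Lambda>\<^esub> = ?e \<oplus>\<^bsub>\<Lambda>\<^esub> ?e'"
    proof -
      interpret N: left_module A N by (rule mc.modules)
      interpret M: left_module B M by (rule mc.modules)
      show ?thesis unfolding assms(2) by simp
    qed
    have "s = \<one>\<^bsub>\<Lambda>\<^esub> \<odot>\<^bsub>Z\<^esub> s" using Z.lsmult_one[OF s(1)] by simp
    also have "\<dots> = ?e \<odot>\<^bsub>Z\<^esub> s \<oplus>\<^bsub>Z\<^esub> ?e' \<odot>\<^bsub>Z\<^esub> s" unfolding one by (rule Z.lsmult_l_distr[OF e s(1)])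
    finally have "?C (?e \<odot>\<^bsub>Z\<^esub> s \<oplus>\<^bsub>Z\<^esub> ?e' \<odot>\<^bsub>Z\<^esub> s) = carrier Z" using s(2) by simp
    from hollowD(2)[OF hollow Z.cyclic_submodule[OF es(1)] Z.cyclic_submodule[OF es(2)] Z.cyclic_add[OF es this]]
    show "(\<exists>P :: ('a, 'z) module. indecomposable_projective A P \<and>
               isomorphic_modules \<Lambda> Z (tuple_module A B N M (T_A A B N M \<psi> P))) \<or>
            (\<exists>Q :: ('b, 'z) module. indecomposable_projective B Q \<and>
               isomorphic_modules \<Lambda> Z (tuple_module A B N M (T_B A B N M \<phi> Q)))"
    proof
      assume "?C (?e \<odot>\<^bsub>Z\<^esub> s) = carrier Z"
      from CA.corner_classification[OF Z hollow db s(1) this TA[OF CA.corner_module_left_module[OF Z]]]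
      show ?thesis by blast
    next
      assume "?C (?e' \<odot>\<^bsub>Z\<^esub> s) = carrier Z"
      from CB.corner_classification[OF Z hollow db s(1) this TB[OF CB.corner_module_left_module[OF Z]]]
      show ?thesis by blast
    qed
  qed
qed

end
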